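(* Let $R\subseteq\mathbb{Z}[x_1,\dots,x_n]$ be a subring and $M=\{t_\lambda:\lambda\in\Lambda\}$ a $\mathbb{Z}$-basis of $R$ which is $(K,L_A)$-friendly for a function $K=K(\lambda,n)$ and an invertible $(0,1)$-matrix $A$, such that from $\lambda$ the leading exponent $\mathbf{e}_\lambda$ is efficiently computable and vice versa. Suppose we have access to an oracle $\mathcal{O}(\lambda,\mathbf{a})$ returning $t_\lambda(\mathbf{a})$ for $\mathbf{a}\in\mathbb{N}^n$. Then there is a deterministic algorithm that, given a black box for $f=\sum_{\lambda\in\Gamma}a_\lambda t_\lambda$ with $a_\lambda\in\mathbb{Z}\setminus\{0\}$ and the promise $\deg(f)\le d$, $|\Gamma|\le m$, computes this expansion of $f$ in time $\mathrm{poly}(n,d,m,\log(\sum_\lambda|a_\lambda|),\log K)$.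
   Context: $M$ is $K$-bounded if for every $\lambda$ all coefficients in the monomial expansion of $t_\lambda$ have absolute value at most $K(\lambda,n)$. For an invertible $(0,1)$-matrix $A$, $L_A$ is the set of linear forms $\mathbf{e}\mapsto\langle\mathbf{c},\mathbf{e}\rangle$ with $\mathbf{c}=A\mathbf{c}'$ for some $\mathbf{c}'\in(\mathbb{Z}^+)^n$ (positive integer entries). $M$ is $L_A$-compatible if to each $t_\lambda$ one can associate an exponent $\mathbf{e}_\lambda\in\mathbb{N}^n$ such that (1) every form in $L_A$ attains its maximum over $E_{t_\lambda}=\{\mathbf{e}:\mathbf{x}^{\mathbf{e}}\text{ has nonzero coefficient in }t_\lambda\}$ uniquely at $\mathbf{e}_\lambda$; (2) $\mathbf{e}_\lambda\ne\mathbf{e}_{\lambda'}$ for $\lambda\ne\lambda'$; (3) the coefficient of $\mathbf{x}^{\mathbf{e}_\lambda}$ in $t_\lambda$ is $1$. $\mathbf{e}_\lambda$ is the leading exponent. $M$ is $(K,L_A)$-friendly if it is $K$-bounded and $L_A$-compatible. Oracle calls count at unit cost; $K$ in the running time is the coefficient bound $K(\lambda,n)$ for the basis elements involved. *)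

theory Defs
  imports
    Complex_Main
    "HOL-Library.Poly_Mapping"
    "HOL-Library.Log_Nat"
    "Jordan_Normal_Form.Matrix"
begin

section \<open>Integer polynomials in \<open>n\<close> variables\<close>

text \<open>The variables are numbered \<open>0, \<dots>, n - 1\<close>. The set of exponents of nonzero coefficients
  of \<open>p\<close> is \<open>keys p\<close>; the coefficient at \<open>e\<close> is \<open>lookup p e\<close>.\<close>

type_synonym exponent = "nat \<Rightarrow>\<^sub>0 nat"
type_synonym int_mpoly = "exponent \<Rightarrow>\<^sub>0 int"

definition exponents :: "nat \<Rightarrow> exponent set" where
  "exponents n = {e. Poly_Mapping.keys e \<subseteq> {..<n}}"

definition polys :: "nat \<Rightarrow> int_mpoly set" where
  "polys n = {p. Poly_Mapping.keys p \<subseteq> exponents n}"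

definition eval_poly :: "int_mpoly \<Rightarrow> (nat \<Rightarrow> int) \<Rightarrow> int" where
  "eval_poly p a = (\<Sum>e\<in>Poly_Mapping.keys p.
     Poly_Mapping.lookup p e * (\<Prod>i\<in>Poly_Mapping.keys e. a i ^ Poly_Mapping.lookup e i))"

definition total_degree :: "int_mpoly \<Rightarrow> nat" where
  "total_degree p =
     Max (insert 0 ((\<lambda>e. \<Sum>i\<in>Poly_Mapping.keys e. Poly_Mapping.lookup e i) ` Poly_Mapping.keys p))"

definition subring_of_polys :: "nat \<Rightarrow> int_mpoly set \<Rightarrow> bool" where
  "subring_of_polys n R \<longleftrightarrow> R \<subseteq> polys n \<and> 1 \<in> R \<and>
     (\<forall>p\<in>R. \<forall>q\<in>R. p - q \<in> R \<and> p * q \<in> R)"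

definition int_scale :: "int \<Rightarrow> int_mpoly \<Rightarrow> int_mpoly" where
  "int_scale c p = of_int c * p"

global_interpretation int_module: Modules.module int_scale
  by unfold_locales (simp_all add: int_scale_def algebra_simps)

definition int_basis :: "int_mpoly set \<Rightarrow> 'l set \<Rightarrow> ('l \<Rightarrow> int_mpoly) \<Rightarrow> bool" where
  "int_basis R \<Lambda> t \<longleftrightarrow> inj_on t \<Lambda> \<and> \<not> int_module.dependent (t ` \<Lambda>) \<and> int_module.span (t ` \<Lambda>) = R"


section \<open>Friendly families\<close>

text \<open>Invertibility is over the rationals, i.e. \<open>A\<close> is nonsingular but need not be unimodular.\<close>

definition invertible_01_mat :: "nat \<Rightarrow> int mat \<Rightarrow> bool" where
  "invertible_01_mat n A \<longleftrightarrow> A \<in> carrier_mat n n \<and> (\<forall>i<n. \<forall>j<n. A $$ (i, j) \<in> {0, 1}) \<and>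
     invertible_mat (map_mat rat_of_int A)"

definition linear_forms :: "nat \<Rightarrow> int mat \<Rightarrow> (exponent \<Rightarrow> int) set" where
  "linear_forms n A =
     {\<lambda>e. (A *\<^sub>v c') \<bullet> vec n (\<lambda>i. int (Poly_Mapping.lookup e i))
      | c'. c' \<in> carrier_vec n \<and> (\<forall>i<n. c' $ i > 0)}"

definition bounded_family :: "('l \<Rightarrow> nat \<Rightarrow> real) \<Rightarrow> nat \<Rightarrow> 'l set \<Rightarrow> ('l \<Rightarrow> int_mpoly) \<Rightarrow> bool" where
  "bounded_family K n \<Lambda> t \<longleftrightarrow> (\<forall>l\<in>\<Lambda>. \<forall>e. \<bar>real_of_int (Poly_Mapping.lookup (t l) e)\<bar> \<le> K l n)"

text \<open>\<open>lead\<close> is the assignment \<open>\<lambda> \<mapsto> e\<^sub>\<lambda>\<close>. On \<open>\<Lambda>\<close> it is determined by uniqueness of maxima, since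
  \<open>linear_forms n A\<close> is nonempty.\<close>

definition compatible_family ::
  "nat \<Rightarrow> int mat \<Rightarrow> 'l set \<Rightarrow> ('l \<Rightarrow> int_mpoly) \<Rightarrow> ('l \<Rightarrow> exponent) \<Rightarrow> bool" where
  "compatible_family n A \<Lambda> t lead \<longleftrightarrow>
     (\<forall>l\<in>\<Lambda>. lead l \<in> exponents n) \<and>
     (\<forall>l\<in>\<Lambda>. \<forall>L\<in>linear_forms n A.
        lead l \<in> Poly_Mapping.keys (t l) \<and>
        (\<forall>e\<in>Poly_Mapping.keys (t l). e \<noteq> lead l \<longrightarrow> L e < L (lead l))) \<and>
     (\<forall>l\<in>\<Lambda>. \<forall>l'\<in>\<Lambda>. l \<noteq> l' \<longrightarrow> lead l \<noteq> lead l') \<and>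
     (\<forall>l\<in>\<Lambda>. Poly_Mapping.lookup (t l) (lead l) = 1)"

definition friendly_family ::
  "('l \<Rightarrow> nat \<Rightarrow> real) \<Rightarrow> nat \<Rightarrow> int mat \<Rightarrow> 'l set \<Rightarrow> ('l \<Rightarrow> int_mpoly) \<Rightarrow> ('l \<Rightarrow> exponent) \<Rightarrow> bool" where
  "friendly_family K n A \<Lambda> t lead \<longleftrightarrow>
     bounded_family K n \<Lambda> t \<and> compatible_family n A \<Lambda> t lead"


section \<open>Model of computation\<close>

text \<open>Programs transform finite binary trees with integer leaves; the size of a tree counts the
  binary digits of its leaves. The language is a variable-free WHILE language over such trees
  (\<open>Fork\<close> supplies copies of the current value, so that the current value plays the role of
  the store). Every step is charged the size of the value it reads and, for basic operations, also
  the size of the value it produces, which makes the model polynomially equivalent to Turing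
  machines. Only calls of oracles have cost 1, whatever the sizes of query and answer.\<close>

datatype data = VInt int | VPair data data

fun dsize :: "data \<Rightarrow> nat" where
  "dsize (VInt z) = 1 + floorlog 2 (nat \<bar>z\<bar>)"
| "dsize (VPair u v) = 1 + dsize u + dsize v"

datatype basic_op = Ident | Const data | Fst | Snd | IsPair | Add | Sub | Mul | Div | Mod | Less

text \<open>\<open>None\<close> means that the operation is not applicable; execution is then stuck.\<close>

fun apply_op :: "basic_op \<Rightarrow> data \<Rightarrow> data option" where
  "apply_op Ident v = Some v"
| "apply_op (Const c) v = Some c"
| "apply_op Fst (VPair u v) = Some u"
| "apply_op Snd (VPair u v) = Some v"
| "apply_op IsPair (VPair u v) = Some (VInt 1)"
| "apply_op IsPair (VInt x) = Some (VInt 0)"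
| "apply_op Add (VPair (VInt x) (VInt y)) = Some (VInt (x + y))"
| "apply_op Sub (VPair (VInt x) (VInt y)) = Some (VInt (x - y))"
| "apply_op Mul (VPair (VInt x) (VInt y)) = Some (VInt (x * y))"
| "apply_op Div (VPair (VInt x) (VInt y)) = Some (VInt (x div y))"
| "apply_op Mod (VPair (VInt x) (VInt y)) = Some (VInt (x mod y))"
| "apply_op Less (VPair (VInt x) (VInt y)) = Some (VInt (if x < y then 1 else 0))"
| "apply_op _ _ = None"

datatype oracle_name = BlackBox | BasisOracle

datatype prog =
    Basic basic_op
  | Call oracle_name
  | Fork prog prog
  | Seq prog prog
  | Cond prog prog prog
  | While prog prog

type_synonym oracles = "oracle_name \<Rightarrow> data \<Rightarrow> data \<Rightarrow> bool"

text \<open>\<open>exec \<O> p v w T\<close>: with oracles \<open>\<O>\<close> (relating queries to answers), program \<open>p\<close> halts on input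
  \<open>v\<close> with output \<open>w\<close> after time \<open>T\<close>. As a test result, \<open>VInt 0\<close> stands for false and everything
  else for true.\<close>

inductive exec :: "oracles \<Rightarrow> prog \<Rightarrow> data \<Rightarrow> data \<Rightarrow> nat \<Rightarrow> bool" for \<O> :: oracles where
  Basic: "apply_op b v = Some w \<Longrightarrow> exec \<O> (Basic b) v w (dsize v + dsize w)"
| Call: "\<O> q v w \<Longrightarrow> exec \<O> (Call q) v w 1"
| Fork: "exec \<O> p v x T1 \<Longrightarrow> exec \<O> q v y T2 \<Longrightarrow>
    exec \<O> (Fork p q) v (VPair x y) (dsize v + T1 + T2)"
| Seq: "exec \<O> p v u T1 \<Longrightarrow> exec \<O> q u w T2 \<Longrightarrow> exec \<O> (Seq p q) v w (dsize v + T1 + T2)"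
| CondTrue: "exec \<O> b v x T1 \<Longrightarrow> x \<noteq> VInt 0 \<Longrightarrow> exec \<O> p v w T2 \<Longrightarrow>
    exec \<O> (Cond b p q) v w (dsize v + T1 + T2)"
| CondFalse: "exec \<O> b v (VInt 0) T1 \<Longrightarrow> exec \<O> q v w T2 \<Longrightarrow>
    exec \<O> (Cond b p q) v w (dsize v + T1 + T2)"
| WhileFalse: "exec \<O> b v (VInt 0) T1 \<Longrightarrow> exec \<O> (While b p) v v (dsize v + T1)"
| WhileTrue: "exec \<O> b v x T1 \<Longrightarrow> x \<noteq> VInt 0 \<Longrightarrow> exec \<O> p v u T2 \<Longrightarrow>
    exec \<O> (While b p) u w T3 \<Longrightarrow> exec \<O> (While b p) v w (dsize v + T1 + T2 + T3)"

inductive_cases exec_elims: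
  "exec \<O> (Basic b) v w T"
  "exec \<O> (Call q) v w T"
  "exec \<O> (Fork p q) v w T"
  "exec \<O> (Seq p q) v w T"
  "exec \<O> (Cond b p q) v w T"
  "exec \<O> (While b p) v w T"

definition no_oracle :: oracles where
  "no_oracle q v w \<longleftrightarrow> False"

fun enc_list :: "data list \<Rightarrow> data" where
  "enc_list [] = VInt 0"
| "enc_list (v # vs) = VPair v (enc_list vs)"

definition enc_ints :: "int list \<Rightarrow> data" where
  "enc_ints zs = enc_list (map VInt zs)"

definition enc_exponent :: "nat \<Rightarrow> exponent \<Rightarrow> data" where
  "enc_exponent n e = enc_ints (map (\<lambda>i. int (Poly_Mapping.lookup e i)) [0..<n])"

definition enc_mat :: "int mat \<Rightarrow> data" where
  "enc_mat A = enc_list (map enc_ints (mat_to_list A))"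

definition enc_input :: "nat \<Rightarrow> int mat \<Rightarrow> nat \<Rightarrow> nat \<Rightarrow> data" where
  "enc_input n A d m = enc_list [VInt (int n), enc_mat A, VInt (int d), VInt (int m)]"

text \<open>The black box for \<open>f\<close> answers on integer points; the basis queries for the \<open>t\<^sub>\<lambda>\<close> are answered only
  for \<open>\<lambda> \<in> \<Lambda>\<close> and natural points. Any other call is stuck.\<close>

inductive interpolation_oracle ::
  "nat \<Rightarrow> int_mpoly \<Rightarrow> data set \<Rightarrow> (data \<Rightarrow> int_mpoly) \<Rightarrow> oracles"
  for n f \<Lambda> t where
  "length a = n \<Longrightarrow>
    interpolation_oracle n f \<Lambda> t BlackBox (enc_ints a) (VInt (eval_poly f (nth a)))"
| "l \<in> \<Lambda> \<Longrightarrow> length a = n \<Longrightarrow>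
    interpolation_oracle n f \<Lambda> t BasisOracle (VPair l (enc_ints (map int a)))
      (VInt (eval_poly (t l) (\<lambda>i. int (a ! i))))"

text \<open>\<open>p\<close> computes \<open>out l\<close> from \<open>inp l\<close> for \<open>l \<in> \<Lambda>\<close>, with running time polynomial in \<open>n\<close> and the input size; \<open>n\<close> is
  part of the input.\<close>

definition computes_in_poly_time ::
  "prog \<Rightarrow> nat \<Rightarrow> nat \<Rightarrow> nat \<Rightarrow> 'l set \<Rightarrow> ('l \<Rightarrow> data) \<Rightarrow> ('l \<Rightarrow> data) \<Rightarrow> bool" where
  "computes_in_poly_time p C k n \<Lambda> inp out \<longleftrightarrow>
     (\<forall>l\<in>\<Lambda>. \<exists>T. exec no_oracle p (VPair (VInt (int n)) (inp l)) (out l) T \<and>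
        T \<le> C * (1 + n + dsize (inp l)) ^ k)"

definition lead_efficient ::
  "prog \<Rightarrow> prog \<Rightarrow> nat \<Rightarrow> nat \<Rightarrow> nat \<Rightarrow> data set \<Rightarrow> (data \<Rightarrow> exponent) \<Rightarrow> bool" where
  "lead_efficient to_exp to_idx C k n \<Lambda> lead \<longleftrightarrow>
     computes_in_poly_time to_exp C k n \<Lambda> (\<lambda>l. l) (\<lambda>l. enc_exponent n (lead l)) \<and>
     computes_in_poly_time to_idx C k n \<Lambda> (\<lambda>l. enc_exponent n (lead l)) (\<lambda>l. l)"

definition enc_expansion :: "(data \<Rightarrow> int) \<Rightarrow> data list \<Rightarrow> data" where
  "enc_expansion a ls = enc_list (map (\<lambda>l. VPair l (VInt (a l))) ls)"


subsection \<open>Programs are deterministic\<close>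

lemma exec_deterministic:
  assumes "exec \<O> p v w T" "exec \<O> p v w' T'"
    and "\<And>q v w w'. \<O> q v w \<Longrightarrow> \<O> q v w' \<Longrightarrow> w = w'"
  shows "w = w' \<and> T = T'"
  using assms(1,2)
proof (induction arbitrary: w' T' rule: exec.induct)
  case (Basic b v w)
  from Basic.prems Basic.hyps show ?case by (auto elim: exec_elims(1))
next
  case (Call q v w)
  from Call.prems have "T' = 1 \<and> \<O> q v w'" by (auto elim: exec_elims(2))
  with assms(3)[OF Call.hyps] show ?case by simp
next
  case (Fork p v x T1 q y T2)
  from Fork.prems obtain x' T1' y' T2' where
    "w' = VPair x' y'" "T' = dsize v + T1' + T2'" "exec \<O> p v x' T1'" "exec \<O> q v y' T2'"
    by (rule exec_elims(3))
  with Fork.IH(1)[of x' T1'] Fork.IH(2)[of y' T2'] show ?case by simp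
next
  case (Seq p v u T1 q w T2)
  from Seq.prems obtain u' T1' T2' where
    "T' = dsize v + T1' + T2'" "exec \<O> p v u' T1'" "exec \<O> q u' w' T2'"
    by (rule exec_elims(4))
  with Seq.IH(1)[of u' T1'] Seq.IH(2)[of w' T2'] show ?case by simp
next
  case (CondTrue b v x T1 p w T2 q)
  have x: False if "exec \<O> b v (VInt 0) T1'" for T1'
    using CondTrue.IH(1)[OF that] CondTrue.hyps(2) by simp
  from CondTrue.prems obtain x' T1' T2' where
    "T' = dsize v + T1' + T2'" "exec \<O> b v x' T1'" "exec \<O> p v w' T2'"
    by (rule exec_elims(5)) (blast dest: x)+
  with CondTrue.IH(1)[of x' T1'] CondTrue.IH(2)[of w' T2'] show ?case by simp
next
  case (CondFalse b v T1 q w T2 p)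
  have x: "x = VInt 0" if "exec \<O> b v x T1'" for x T1'
    using CondFalse.IH(1)[OF that] by simp
  from CondFalse.prems obtain T1' T2' where
    "T' = dsize v + T1' + T2'" "exec \<O> b v (VInt 0) T1'" "exec \<O> q v w' T2'"
    by (rule exec_elims(5)) (auto dest: x)
  with CondFalse.IH(1)[of "VInt 0" T1'] CondFalse.IH(2)[of w' T2'] show ?case by simp
next
  case (WhileFalse b v T1 p)
  have x: "x = VInt 0" if "exec \<O> b v x T1'" for x T1'
    using WhileFalse.IH(1)[OF that] by simp
  from WhileFalse.prems obtain T1' where
    "w' = v" "T' = dsize v + T1'" "exec \<O> b v (VInt 0) T1'"
    by (rule exec_elims(6)) (auto dest: x)
  with WhileFalse.IH(1)[of "VInt 0" T1'] show ?case by simp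
next
  case (WhileTrue b v x T1 p u T2 w T3)
  have x: False if "exec \<O> b v (VInt 0) T1'" for T1'
    using WhileTrue.IH(1)[OF that] WhileTrue.hyps(2) by simp
  from WhileTrue.prems obtain x' T1' u' T2' T3' where
    T: "T' = dsize v + T1' + T2' + T3'" and b: "exec \<O> b v x' T1'"
    and p: "exec \<O> p v u' T2'" and w: "exec \<O> (While b p) u' w' T3'"
    by (rule exec_elims(6)) (blast dest: x)+
  have 2: "u = u' \<and> T2 = T2'" by (rule WhileTrue.IH(2)[OF p])
  from w have "exec \<O> (While b p) u w' T3'" by (simp only: 2)
  from WhileTrue.IH(3)[OF this] WhileTrue.IH(1)[OF b] 2 T show ?case by (simp only:)
qed

lemma enc_ints_inject: "enc_ints xs = enc_ints ys \<longleftrightarrow> xs = ys"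
proof (induction xs arbitrary: ys)
  case Nil
  show ?case by (cases ys) (auto simp: enc_ints_def)
next
  case (Cons x xs)
  then show ?case by (cases ys) (auto simp: enc_ints_def)
qed

lemma interpolation_oracle_functional:
  "interpolation_oracle n f \<Lambda> t q v w \<Longrightarrow> interpolation_oracle n f \<Lambda> t q v w' \<Longrightarrow> w = w'"
  by (erule interpolation_oracle.cases; erule interpolation_oracle.cases)
     (simp_all add: enc_ints_inject)

end

theory Submission
  imports Defs
begin

text \<open>
  The leading exponents \<open>e\<^sub>\<lambda>\<close> are peeled off one at a time. For positive weights \<open>c'\<close> put \<open>c = A c'\<close>
  and restrict the residual \<open>g = f - \<Sum> a\<^sub>\<lambda> t\<^sub>\<lambda>\<close> (sum over the terms already found) to the curves
  \<open>y \<mapsto> (z\<^sub>i\<^sup>s y\<^bsup>c\<^sub>i\<^esup>)\<^sub>i\<close>. The exponents other than the \<open>e\<^sub>\<lambda>\<close> have smaller weight, so the leading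
  coefficient in \<open>y\<close> is \<open>\<Sum> a\<^sub>\<lambda> W\<^sub>\<lambda>\<^sup>s\<close> with \<open>W\<^sub>\<lambda> = \<Prod> z\<^sub>i\<^bsup>e\<^sub>\<lambda>\<^sub>i\<^esup>\<close>, summed over the
  \<open>\<lambda>\<close> of maximal weight. No bound on the coefficients of \<open>f\<close> is known in advance, so degree and leading
  coefficient are read off exactly from finite differences at \<open>y = 0, \<dots>, D\<close>.

  The basis oracle and the program \<open>to_idx\<close> may get stuck away from \<open>\<Lambda>\<close>, so one must certify that a single
  \<open>\<lambda>\<close> attains the maximal weight: by a Vandermonde argument this is the case as soon as the leading
  coefficients for \<open>s = 0, \<dots>, m + 1\<close> form a geometric progression. Their ratio is \<open>W\<^sub>\<lambda>\<close>, which
  determines \<open>e\<^sub>\<lambda>\<close> because the \<open>z\<^sub>i = 1 + (i + 1) n!\<close> are pairwise coprime. Suitable weights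
  are \<open>c'\<^sub>j = q + (d + 1)\<^sup>j mod q\<close>: they separate the \<open>e\<^sub>\<lambda>\<close> unless \<open>q\<close> divides a fixed nonzero
  integer with polynomially many bits, and Nair's bound \<open>k (2k choose k) | lcm(1, \<dots>, 2k)\<close> yields a
  small \<open>q\<close> that does not.
\<close>


section \<open>Polynomially bounded executions\<close>

text \<open>The degree bound on f says little about single basis elements: monomials of the
  t_\<lambda>, leading ones included, may cancel in f, and some t_\<lambda> may have degree above d.
  What stays controlled are the entries of A^T e. Each monomial of t_\<lambda> is dominated
  entrywise by e_\<lambda>, because positive weights can be concentrated on one column, and a
  leading exponent maximal for dominance cannot cancel. As A has entries 0 and 1, all entries of A^T
  e are at most d; invertibility excludes zero rows and so bounds the single exponents as well. The
  test is sound for every q and complete for at least one q in a range known to the program, so any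
  q that passes may be trusted. Neither K nor the a_\<lambda> are input: they influence only the
  sizes of values, while n, d and m control the loops. An oracle call costs 1, but its answer is
  read afterwards, so the bit sizes of all values need bounds. Inside loops these come from the
  meaning of the accumulator: composing the bounds of single rounds would let the exponents grow
  with the number of rounds.\<close>

text \<open>Relative to a size parameter \<open>s\<close>, exponents \<open>a\<close> of \<open>s + 2\<close> bound the size of data (\<open>small\<close>),
  natural numbers (\<open>below\<close>), and all sizes and times of an execution (\<open>computes\<close>). The base \<open>s + 2\<close> is at
  least \<open>2\<close>, so that sums and products of bounds amount to sums of exponents.\<close>

definition small :: "nat \<Rightarrow> data \<Rightarrow> nat \<Rightarrow> bool" where
  "small s v a \<longleftrightarrow> dsize v \<le> (s + 2) ^ a"

definition below :: "nat \<Rightarrow> nat \<Rightarrow> nat \<Rightarrow> bool" where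
  "below s N a \<longleftrightarrow> N \<le> (s + 2) ^ a"

definition computes :: "nat \<Rightarrow> oracles \<Rightarrow> prog \<Rightarrow> data \<Rightarrow> data \<Rightarrow> nat \<Rightarrow> bool" where
  "computes s \<O> p x y a \<longleftrightarrow> small s x a \<and> small s y a \<and> (\<exists>T. exec \<O> p x y T \<and> below s T a)"

lemma below_mono: "below s N a \<Longrightarrow> a \<le> b \<Longrightarrow> below s N b"
  unfolding below_def by (erule order_trans) (simp add: power_increasing)

lemma below_le: "below s N a \<Longrightarrow> M \<le> N \<Longrightarrow> below s M a"
  unfolding below_def by simp

lemma below_mult: "below s M a \<Longrightarrow> below s N b \<Longrightarrow> below s (M * N) (a + b)"
  unfolding below_def by (simp add: power_add mult_mono)

lemma below_add: assumes "below s M a" "below s N b" shows "below s (M + N) (a + b + 1)"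
proof -
  let ?p = "(s + 2) ^ a" and ?q = "(s + 2) ^ b"
  have "M + N \<le> ?p + ?q" using assms by (simp add: below_def)
  also have "\<dots> \<le> ?p * ?q + ?p * ?q" by (intro add_mono) simp_all
  also have "\<dots> = 2 * (?p * ?q)" by simp
  also have "\<dots> \<le> (s + 2) * (?p * ?q)" by (intro mult_right_mono) simp_all
  also have "\<dots> = (s + 2) ^ (a + b + 1)" by (simp add: power_add)
  finally show ?thesis by (simp add: below_def)
qed

text \<open>The exponent is the constant itself, which is crude but independent of s; all that is
  asked of exponents is that they be fixed numbers.\<close>

lemma below_const: "below s N N"
proof -
  have "N \<le> 2 ^ N" by (simp add: less_imp_le)
  also have "\<dots> \<le> (s + 2) ^ N" by (intro power_mono) simp_all
  finally show ?thesis by (simp add: below_def)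
qed

lemma below_0: "below s 0 0" and below_1: "below s 1 0" "below s (Suc 0) 0"
  by (simp_all add: below_def)

lemma below_Suc: "below s N a \<Longrightarrow> below s (Suc N) (a + 1)"
  using below_add[of s N a 1 0] by (simp add: below_1)

lemma below_param: "N \<le> s \<Longrightarrow> below s N 1"
  by (simp add: below_def)

lemma below_power: "below s N a \<Longrightarrow> below s (N ^ k) (a * k)"
  unfolding below_def by (simp add: power_mult power_mono)

lemma small_mono: "small s v a \<Longrightarrow> a \<le> b \<Longrightarrow> small s v b"
  using below_mono unfolding below_def small_def by blast

lemma small_VPair: "small s u a \<Longrightarrow> small s v b \<Longrightarrow> small s (VPair u v) (a + b + 2)"
  using below_Suc[OF below_add[of s "dsize u" a "dsize v" b]]
  by (simp add: below_def small_def)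

lemma small_VPairD: "small s (VPair u v) a \<Longrightarrow> small s u a" "small s (VPair u v) a \<Longrightarrow> small s v a"
  by (simp_all add: small_def)

section \<open>Bit sizes of integer arithmetic\<close>

lemma dsize_VInt_le: "dsize (VInt z) \<le> Suc k \<longleftrightarrow> \<bar>z\<bar> < 2 ^ k"
proof -
  have "floorlog 2 (nat \<bar>z\<bar>) \<le> k \<longleftrightarrow> nat \<bar>z\<bar> < 2 ^ k"
    by (cases "z = 0") (auto simp: floorlog_le_iff)
  also have "\<dots> \<longleftrightarrow> \<bar>z\<bar> < 2 ^ k" by (simp add: nat_less_iff)
  finally show ?thesis by simp
qed

lemma dsize_pos: "0 < dsize v"
  by (cases v) simp_all

lemma abs_less_dsize: "\<bar>z\<bar> < 2 ^ (dsize (VInt z) - 1)"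
  using dsize_VInt_le[of z "dsize (VInt z) - 1"] dsize_pos[of "VInt z"] by simp

lemma dsize_mult: "dsize (VInt (x * y)) \<le> dsize (VInt x) + dsize (VInt y)"
proof -
  have "\<bar>x * y\<bar> < 2 ^ (dsize (VInt x) - 1 + (dsize (VInt y) - 1))"
    unfolding abs_mult power_add
    by (rule mult_strict_mono'[OF abs_less_dsize abs_less_dsize]) simp_all
  then have "dsize (VInt (x * y)) \<le> Suc (dsize (VInt x) - 1 + (dsize (VInt y) - 1))"
    unfolding dsize_VInt_le .
  then show ?thesis using dsize_pos[of "VInt x"] dsize_pos[of "VInt y"] by linarith
qed

lemma dsize_sum:
  assumes "\<bar>z\<bar> \<le> \<bar>x\<bar> + \<bar>y\<bar>" shows "dsize (VInt z) \<le> dsize (VInt x) + dsize (VInt y)"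
proof -
  let ?a = "dsize (VInt x) - 1" and ?b = "dsize (VInt y) - 1"
  have "\<bar>x\<bar> < 2 ^ max ?a ?b" "\<bar>y\<bar> < 2 ^ max ?a ?b"
    by (rule less_le_trans[OF abs_less_dsize power_increasing]; simp del: dsize.simps)+
  with assms have "\<bar>z\<bar> < 2 ^ Suc (max ?a ?b)" by simp
  then have "dsize (VInt z) \<le> Suc (Suc (max ?a ?b))" unfolding dsize_VInt_le .
  then show ?thesis using dsize_pos[of "VInt x"] dsize_pos[of "VInt y"] by linarith
qed

lemma small_VInt_dsize:
  assumes "dsize (VInt z) \<le> dsize (VInt x) + dsize (VInt y)" "small s (VInt x) a" "small s (VInt y) b"
  shows "small s (VInt z) (a + b + 1)"
  using below_add[of s "dsize (VInt x)" a "dsize (VInt y)" b] assms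
  unfolding below_def small_def by linarith

lemma small_add: "small s (VInt x) a \<Longrightarrow> small s (VInt y) b \<Longrightarrow> small s (VInt (x + y)) (a + b + 1)"
  and small_diff: "small s (VInt x) a \<Longrightarrow> small s (VInt y) b \<Longrightarrow> small s (VInt (x - y)) (a + b + 1)"
  and small_times: "small s (VInt x) a \<Longrightarrow> small s (VInt y) b \<Longrightarrow> small s (VInt (x * y)) (a + b + 1)"
  by (erule small_VInt_dsize[rotated], assumption, (rule dsize_mult dsize_sum, simp?))+

text \<open>\<open>div\<close> rounds towards minus infinity, so a negative quotient can exceed the
  exact one in absolute value. For x < 0 < y the lower bound comes from x * y \<le> x; a negative
  divisor is reduced to a positive one by flipping both signs.\<close>

lemma abs_div_le: "\<bar>x div y\<bar> \<le> \<bar>x :: int\<bar>"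
proof -
  have *: "\<bar>x div y\<bar> \<le> \<bar>x\<bar>" if "y > 0" for x y :: int
  proof (cases "x \<ge> 0")
    case True
    have "x div y \<le> x div 1" using True that by (intro zdiv_mono2) auto
    then show ?thesis using True that by (simp add: pos_imp_zdiv_nonneg_iff)
  next
    case False
    then have "x * y \<le> x" using that by (simp add: mult_le_cancel_left1)
    then have "x * y div y \<le> x div y" using that by (intro zdiv_mono1)
    moreover have "x div y < 0" using False that by (simp add: neg_imp_zdiv_neg_iff pos_imp_zdiv_neg_iff)
    ultimately show ?thesis using that by simp
  qed
  show ?thesis using *[of y x] *[of "- y" "- x"] by (cases "y > 0"; cases "y = 0") auto
qed

lemma abs_mod_le: "\<bar>x mod y\<bar> \<le> \<bar>x :: int\<bar> + \<bar>y\<bar>"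
  by (cases "y = 0") (use abs_mod_less[of y x] in auto)

lemma small_div: "small s (VInt x) a \<Longrightarrow> small s (VInt y) b \<Longrightarrow> small s (VInt (x div y)) (a + b + 1)"
  and small_mod: "small s (VInt x) a \<Longrightarrow> small s (VInt y) b \<Longrightarrow> small s (VInt (x mod y)) (a + b + 1)"
   apply (erule small_VInt_dsize[rotated], assumption, rule dsize_sum)
  using abs_div_le[of x y] apply linarith
  apply (erule small_VInt_dsize[rotated], assumption, rule dsize_sum, rule abs_mod_le)
  done

lemma small_bit: "small s (VInt 0) 1" "small s (VInt 1) 1" "small s (VInt (if b then 1 else 0)) 1"
  by (simp_all add: small_def floorlog_def)

lemma small_const: "small s v (dsize v)"
  using below_const by (simp add: below_def small_def)

lemma small_nat: assumes "below s N a" shows "small s (VInt (int N)) (a + 1)"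
proof -
  have "dsize (VInt (int N)) \<le> Suc N" unfolding dsize_VInt_le by simp
  with below_Suc[OF assms] show ?thesis unfolding below_def small_def by linarith
qed

text \<open>N summands of absolute value at most 2^B add up to less than 2^(B + N), so the exponent
  grows once. Adding one summand at a time with \<open>small_add\<close> would raise it in every
  step.\<close>

lemma small_sum:
  assumes "\<And>j. j < N \<Longrightarrow> small s (VInt (u j)) a" "below s N b" "S \<subseteq> {..<N}"
  shows "small s (VInt (\<Sum>j\<in>S. u j)) (a + b + 2)"
proof -
  have "\<bar>\<Sum>j\<in>S. u j\<bar> < 2 ^ ((s + 2) ^ a + N)"
  proof -
    have "\<bar>u j\<bar> \<le> 2 ^ ((s + 2) ^ a)" if "j \<in> S" for j
    proof -
      have "dsize (VInt (u j)) \<le> Suc ((s + 2) ^ a)"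
        using assms(1)[of j] assms(3) that unfolding small_def by fastforce
      then show ?thesis unfolding dsize_VInt_le by simp
    qed
    then have "(\<Sum>j\<in>S. \<bar>u j\<bar>) \<le> of_nat (card S) * 2 ^ ((s + 2) ^ a)"
      by (rule sum_bounded_above)
    also have "\<dots> < 2 ^ N * 2 ^ ((s + 2) ^ a)"
    proof -
      have "card S \<le> N" using card_mono[OF _ assms(3)] by simp
      also have "N < 2 ^ N" by simp
      finally have "int (card S) < 2 ^ N" by (metis of_nat_less_iff of_nat_numeral of_nat_power)
      then show ?thesis by simp
    qed
    finally have "(\<Sum>j\<in>S. \<bar>u j\<bar>) < 2 ^ N * 2 ^ ((s + 2) ^ a)" .
    then show ?thesis using sum_abs[of u S] by (simp only: power_add mult.commute)
  qed
  then have "dsize (VInt (\<Sum>j\<in>S. u j)) \<le> Suc ((s + 2) ^ a + N)" unfolding dsize_VInt_le .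
  moreover have "below s (Suc ((s + 2) ^ a + N)) (a + b + 2)"
    using below_Suc[OF below_add[of s "(s + 2) ^ a" a N b]] assms(2) by (simp add: below_def)
  ultimately show ?thesis unfolding below_def small_def by linarith
qed

lemma small_prod:
  assumes "\<And>j. j < N \<Longrightarrow> small s (VInt (u j)) a" "below s N b" "S \<subseteq> {..<N}"
  shows "small s (VInt (\<Prod>j\<in>S. u j)) (a + b + 2)"
proof -
  have "\<bar>\<Prod>j\<in>S. u j\<bar> < 2 ^ (Suc ((s + 2) ^ a * N))"
  proof -
    have u: "\<bar>u j\<bar> \<le> 2 ^ ((s + 2) ^ a)" if "j \<in> S" for j
    proof -
      have "dsize (VInt (u j)) \<le> Suc ((s + 2) ^ a)"
        using assms(1)[of j] assms(3) that unfolding small_def by fastforce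
      then show ?thesis unfolding dsize_VInt_le by simp
    qed
    have "\<bar>\<Prod>j\<in>S. u j\<bar> = (\<Prod>j\<in>S. \<bar>u j\<bar>)" by (induction S rule: infinite_finite_induct) (simp_all add: abs_mult)
    also have "\<dots> \<le> (\<Prod>j\<in>S. 2 ^ ((s + 2) ^ a))"
      by (rule prod_mono) (use u in simp)
    also have "\<dots> = 2 ^ ((s + 2) ^ a * card S)" by (simp add: power_mult)
    also have "\<dots> \<le> 2 ^ ((s + 2) ^ a * N)"
      using card_mono[OF _ assms(3)] by (intro power_increasing mult_le_mono) simp_all
    also have "\<dots> < 2 ^ (Suc ((s + 2) ^ a * N))" by simp
    finally show ?thesis .
  qed
  then have "dsize (VInt (\<Prod>j\<in>S. u j)) \<le> Suc (Suc ((s + 2) ^ a * N))" unfolding dsize_VInt_le .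
  moreover have "below s (Suc (Suc ((s + 2) ^ a * N))) (a + b + 1 + 1)"
    by (intro below_Suc below_mult) (use assms(2) in \<open>simp_all add: below_def\<close>)
  ultimately show ?thesis unfolding below_def small_def by simp
qed

lemma dsize_enc_list: "dsize (enc_list vs) = 1 + length vs + (\<Sum>v\<leftarrow>vs. dsize v)"
  by (induction vs) (simp_all add: floorlog_def)

lemma small_enc_list:
  assumes "\<And>v. v \<in> set vs \<Longrightarrow> small s v a" "below s (length vs) b"
  shows "small s (enc_list vs) (a + b + b + 2)"
proof -
  have "(\<Sum>v\<leftarrow>vs. dsize v) \<le> (\<Sum>v\<leftarrow>vs. (s + 2) ^ a)"
    using assms(1) unfolding small_def by (intro sum_list_mono) auto
  also have "\<dots> = (s + 2) ^ a * length vs" by (simp add: sum_list_triv)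
  finally have *: "dsize (enc_list vs) \<le> Suc (length vs + (s + 2) ^ a * length vs)"
    by (simp add: dsize_enc_list)
  have "below s (Suc (length vs + (s + 2) ^ a * length vs)) (b + (a + b) + 1 + 1)"
    by (intro below_Suc below_add below_mult) (use assms(2) in \<open>simp_all add: below_def\<close>)
  with * show ?thesis unfolding below_def small_def by (simp add: ac_simps)
qed

lemma length_le_dsize_enc_list: "length vs \<le> dsize (enc_list vs)"
  by (simp add: dsize_enc_list)

lemma small_enc_list_length: "small s (enc_list vs) a \<Longrightarrow> below s (length vs) a"
  using length_le_dsize_enc_list[of vs] by (simp add: small_def below_def)


subsection \<open>Primitive steps\<close>

lemma computesD: "computes s \<O> p x y a \<Longrightarrow> small s x a" "computes s \<O> p x y a \<Longrightarrow> small s y a"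
  by (simp_all add: computes_def)

lemma computes_mono: "computes s \<O> p x y a \<Longrightarrow> a \<le> b \<Longrightarrow> computes s \<O> p x y b"
  unfolding computes_def using small_mono below_mono by blast

lemma computesI:
  assumes "small s x a" "small s y b" "exec \<O> p x y T" "below s T c" "a \<le> d" "b \<le> d" "c \<le> d"
  shows "computes s \<O> p x y d"
  unfolding computes_def using assms small_mono below_mono by blast

lemma computes_Basic:
  assumes "apply_op b x = Some y" "small s x a" "small s y c"
  shows "computes s \<O> (Basic b) x y (a + c + 1)"
  by (rule computesI[OF assms(2,3) exec.Basic[OF assms(1)] below_add[of _ _ a _ c]])
     (use assms in \<open>simp_all add: small_def below_def\<close>)

lemma computes_Call:
  assumes "\<O> q x y" "small s x a" "small s y c"
  shows "computes s \<O> (Call q) x y (a + c)"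
  by (rule computesI[OF assms(2,3) exec.Call[of \<O>, OF assms(1)] below_1(1)]) simp_all

lemma computes_Fork:
  assumes "computes s \<O> p x u a" "computes s \<O> q x v b"
  shows "computes s \<O> (Fork p q) x (VPair u v) (a + a + b + 2)"
proof -
  from assms obtain T1 T2 where T: "exec \<O> p x u T1" "below s T1 a" "exec \<O> q x v T2" "below s T2 b"
    by (auto simp: computes_def)
  have "below s (dsize x) a" using computesD(1)[OF assms(1)] by (simp add: small_def below_def)
  from below_add[OF below_add[OF this T(2)] T(4)] show ?thesis
    by (rule computesI[OF computesD(1)[OF assms(1)] small_VPair[OF assms[THEN computesD(2)]] exec.Fork[OF T(1,3)]])
       simp_all
qed

text \<open>The size of the intermediate value is handed to the second premise, so a program can be
  analysed from left to right with exponents still undetermined; a single inequality between numbers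
  remains at the end.\<close>

lemma computes_Seq:
  assumes "computes s \<O> p x u a" "small s u a \<Longrightarrow> computes s \<O> q u y b"
  shows "computes s \<O> (Seq p q) x y (a + a + b + 2)"
proof -
  have 2: "computes s \<O> q u y b" by (rule assms(2)[OF computesD(2)[OF assms(1)]])
  with assms(1) obtain T1 T2 where T: "exec \<O> p x u T1" "below s T1 a" "exec \<O> q u y T2" "below s T2 b"
    by (auto simp: computes_def)
  have "below s (dsize x) a" using computesD(1)[OF assms(1)] by (simp add: small_def below_def)
  from below_add[OF below_add[OF this T(2)] T(4)] show ?thesis
    by (rule computesI[OF computesD(1)[OF assms(1)] computesD(2)[OF 2] exec.Seq[OF T(1,3)]]) simp_all
qed

lemma computes_Cond:
  assumes "computes s \<O> c x v a"
    and "v \<noteq> VInt 0 \<Longrightarrow> computes s \<O> p x y b" "v = VInt 0 \<Longrightarrow> computes s \<O> q x y b'"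
  shows "computes s \<O> (Cond c p q) x y (a + a + b + b' + 2)"
proof -
  from assms(1) obtain T1 where T1: "exec \<O> c x v T1" "below s T1 a"
    by (auto simp: computes_def)
  have x: "below s (dsize x) a" using computesD(1)[OF assms(1)] by (simp add: small_def below_def)
  show ?thesis
  proof (cases "v = VInt 0")
    case True
    from assms(3)[OF this] obtain T2 where T2: "exec \<O> q x y T2" "below s T2 b'" "small s y b'"
      by (auto simp: computes_def)
    from below_add[OF below_add[OF x T1(2)] T2(2)] show ?thesis
      by (rule computesI[OF computesD(1)[OF assms(1)] T2(3) exec.CondFalse[OF T1(1)[unfolded True] T2(1)]])
         simp_all
  next
    case False
    from assms(2)[OF this] obtain T2 where T2: "exec \<O> p x y T2" "below s T2 b" "small s y b"
      by (auto simp: computes_def)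
    from below_add[OF below_add[OF x T1(2)] T2(2)] show ?thesis
      by (rule computesI[OF computesD(1)[OF assms(1)] T2(3) exec.CondTrue[OF T1(1) False T2(1)]]) simp_all
  qed
qed

text \<open>One exponent bounds the test, and one the body, in all rounds, so N rounds contribute
  only c. States are numbered by the rounds still to come.\<close>

lemma computes_While:
  assumes "below s N c"
    and test: "\<And>j. j \<le> N \<Longrightarrow> computes s \<O> b (st j) (VInt (if j = 0 then 0 else 1)) a"
    and body: "\<And>j. j < N \<Longrightarrow> computes s \<O> p (st (Suc j)) (st j) a'"
  shows "computes s \<O> (While b p) (st N) (st 0) (a + a + a' + c + 3)"
proof -
  let ?B = "(s + 2) ^ a + (s + 2) ^ a + (s + 2) ^ a'"
  \<comment> \<open>\<open>Suc j\<close> rather than j because the test is evaluated once more than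
    the body.\<close>
  have "\<exists>T. exec \<O> (While b p) (st j) (st 0) T \<and> T \<le> Suc j * ?B" if "j \<le> N" for j
    using that
  proof (induction j)
    case 0
    from test[OF 0] obtain T where T: "exec \<O> b (st 0) (VInt 0) T" "T \<le> (s + 2) ^ a" "dsize (st 0) \<le> (s + 2) ^ a"
      by (auto simp: computes_def below_def small_def)
    from exec.WhileFalse[OF T(1), of p] T(2,3) show ?case by (intro exI conjI) auto
  next
    case (Suc j)
    then obtain T3 where T3: "exec \<O> (While b p) (st j) (st 0) T3" "T3 \<le> Suc j * ?B" by auto
    from test[OF Suc.prems] obtain T where T: "exec \<O> b (st (Suc j)) (VInt 1) T" "T \<le> (s + 2) ^ a"
      "dsize (st (Suc j)) \<le> (s + 2) ^ a" by (auto simp: computes_def below_def small_def)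
    from body[of j] Suc.prems obtain T2 where T2: "exec \<O> p (st (Suc j)) (st j) T2" "T2 \<le> (s + 2) ^ a'"
      by (auto simp: computes_def below_def)
    from exec.WhileTrue[OF T(1) _ T2(1) T3(1)] T(2,3) T2(2) T3(2) show ?case
      by (intro exI conjI) auto
  qed
  from this[of N] obtain T where T: "exec \<O> (While b p) (st N) (st 0) T" "T \<le> Suc N * ?B" by auto
  have "below s (Suc N * ?B) ((c + 1) + ((a + a + 1) + a' + 1))"
    by (intro below_mult below_add below_Suc assms(1)) (simp_all add: below_def)
  from computesI[OF computesD(1)[OF test[of N]] computesD(1)[OF test[of 0]] T(1) below_le[OF this T(2)]]
  show ?thesis by simp
qed


subsection \<open>Expressions over an environment\<close>

text \<open>An environment is a right-nested list of values; \<open>VAR k\<close> is its \<open>k\<close>-th entry and each binder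
  pushes a new value onto it, as with de Bruijn indices.\<close>

primrec VAR :: "nat \<Rightarrow> prog" where
  "VAR 0 = Basic Fst"
| "VAR (Suc k) = Seq (Basic Snd) (VAR k)"

fun dnth :: "nat \<Rightarrow> data \<Rightarrow> data option" where
  "dnth 0 (VPair u v) = Some u"
| "dnth (Suc k) (VPair u v) = dnth k v"
| "dnth _ _ = None"

lemma dnth_numeral [simp]: "dnth (numeral k) (VPair u v) = dnth (pred_numeral k) v"
  by (simp add: numeral_eq_Suc)

lemma computes_VAR: "dnth k x = Some y \<Longrightarrow> small s x a \<Longrightarrow> computes s \<O> (VAR k) x y (a * (4 * k + 2) + 4 * k + 1)"
proof (induction k x rule: dnth.induct)
  case (1 u v)
  then have "computes s \<O> (Basic Fst) (VPair u v) y (a + a + 1)"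
    by (intro computes_Basic) (auto dest: small_VPairD)
  then show ?case by (simp add: computes_mono)
next
  case (2 k u v)
  have "computes s \<O> (VAR (Suc k)) (VPair u v) y ((a + a + 1) + (a + a + 1) + (a * (4 * k + 2) + 4 * k + 1) + 2)"
    unfolding VAR.simps
    by (rule computes_Seq[where u = v], rule computes_Basic) (use 2 in \<open>auto dest: small_VPairD\<close>)
  then show ?case by (rule computes_mono) (simp add: algebra_simps)
qed simp_all

definition LIT :: "int \<Rightarrow> prog" where "LIT z = Basic (Const (VInt z))"
definition ADD :: "prog \<Rightarrow> prog \<Rightarrow> prog" where "ADD p q = Seq (Fork p q) (Basic Add)"
definition SUB :: "prog \<Rightarrow> prog \<Rightarrow> prog" where "SUB p q = Seq (Fork p q) (Basic Sub)"
definition MUL :: "prog \<Rightarrow> prog \<Rightarrow> prog" where "MUL p q = Seq (Fork p q) (Basic Mul)"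
definition DIV :: "prog \<Rightarrow> prog \<Rightarrow> prog" where "DIV p q = Seq (Fork p q) (Basic Div)"
definition MOD :: "prog \<Rightarrow> prog \<Rightarrow> prog" where "MOD p q = Seq (Fork p q) (Basic Mod)"
definition LESS :: "prog \<Rightarrow> prog \<Rightarrow> prog" where "LESS p q = Seq (Fork p q) (Basic Less)"
definition FST :: "prog \<Rightarrow> prog" where "FST p = Seq p (Basic Fst)"
definition SND :: "prog \<Rightarrow> prog" where "SND p = Seq p (Basic Snd)"
definition ISPAIR :: "prog \<Rightarrow> prog" where "ISPAIR p = Seq p (Basic IsPair)"
definition LET :: "prog \<Rightarrow> prog \<Rightarrow> prog" where "LET p q = Seq (Fork p (Basic Ident)) q"
text \<open>Equality is not a basic operation: 1 - [v < u] - [u < v] is 1 exactly for u = v.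
  \<open>Seq (Basic Snd) q\<close> evaluates q in the environment without the value just
  pushed.\<close>

definition EQ :: "prog \<Rightarrow> prog \<Rightarrow> prog" where
  "EQ p q = LET p (LET (Seq (Basic Snd) q)
     (SUB (SUB (LIT 1) (LESS (VAR 0) (VAR 1))) (LESS (VAR 1) (VAR 0))))"

lemma computes_LIT: "small s x a \<Longrightarrow> v = VInt z \<Longrightarrow> computes s \<O> (LIT z) x v (a + dsize (VInt z) + 1)"
  unfolding LIT_def by (rule computes_Basic) (simp_all add: small_const del: dsize.simps)

lemma computes_binop:
  assumes "computes s \<O> p x (VInt u) a" "computes s \<O> q x (VInt v) b"
    and "apply_op f (VPair (VInt u) (VInt v)) = Some w"
    and "small s (VInt u) a \<Longrightarrow> small s (VInt v) b \<Longrightarrow> small s w (a + b + 1)"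
  shows "computes s \<O> (Seq (Fork p q) (Basic f)) x w (7 * a + 4 * b + 20)"
proof -
  note * = computes_Fork[OF assms(1,2)]
  have "computes s \<O> (Seq (Fork p q) (Basic f)) x w
    ((a + a + b + 2) + (a + a + b + 2) + ((a + a + b + 2) + (a + b + 1) + 1) + 2)"
    by (rule computes_Seq[OF *], rule computes_Basic[OF assms(3)])
       (use assms(4)[OF computesD(2)[OF assms(1)] computesD(2)[OF assms(2)]] in simp_all)
  then show ?thesis by (rule computes_mono) simp
qed

lemma computes_ADD: "computes s \<O> p x (VInt u) a \<Longrightarrow> computes s \<O> q x (VInt v) b \<Longrightarrow> w = VInt (u + v) \<Longrightarrow>
    computes s \<O> (ADD p q) x w (7 * a + 4 * b + 20)"
  and computes_SUB: "computes s \<O> p x (VInt u) a \<Longrightarrow> computes s \<O> q x (VInt v) b \<Longrightarrow> w = VInt (u - v) \<Longrightarrow>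
    computes s \<O> (SUB p q) x w (7 * a + 4 * b + 20)"
  and computes_MUL: "computes s \<O> p x (VInt u) a \<Longrightarrow> computes s \<O> q x (VInt v) b \<Longrightarrow> w = VInt (u * v) \<Longrightarrow>
    computes s \<O> (MUL p q) x w (7 * a + 4 * b + 20)"
  and computes_DIV: "computes s \<O> p x (VInt u) a \<Longrightarrow> computes s \<O> q x (VInt v) b \<Longrightarrow> w = VInt (u div v) \<Longrightarrow>
    computes s \<O> (DIV p q) x w (7 * a + 4 * b + 20)"
  and computes_MOD: "computes s \<O> p x (VInt u) a \<Longrightarrow> computes s \<O> q x (VInt v) b \<Longrightarrow> w = VInt (u mod v) \<Longrightarrow>
    computes s \<O> (MOD p q) x w (7 * a + 4 * b + 20)"
  and computes_LESS: "computes s \<O> p x (VInt u) a \<Longrightarrow> computes s \<O> q x (VInt v) b \<Longrightarrow>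
    w = VInt (if u < v then 1 else 0) \<Longrightarrow> computes s \<O> (LESS p q) x w (7 * a + 4 * b + 20)"
  unfolding ADD_def SUB_def MUL_def DIV_def MOD_def LESS_def
  by (erule computes_binop, assumption, simp,
      hypsubst, (rule small_add small_diff small_times small_div small_mod small_mono[OF small_bit(3)]; simp))+

lemma computes_FST: "computes s \<O> p x (VPair u v) a \<Longrightarrow> computes s \<O> (FST p) x u (a + a + (a + a + 1) + 2)"
  and computes_SND: "computes s \<O> p x (VPair u v) a \<Longrightarrow> computes s \<O> (SND p) x v (a + a + (a + a + 1) + 2)"
  unfolding FST_def SND_def
  by (erule computes_Seq, rule computes_Basic; auto dest: small_VPairD)+

lemma computes_ISPAIR:
  "computes s \<O> p x w a \<Longrightarrow> y = VInt (case w of VPair u v \<Rightarrow> 1 | VInt z \<Rightarrow> 0) \<Longrightarrow>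
   computes s \<O> (ISPAIR p) x y (a + a + (a + 1 + 1) + 2)"
  unfolding ISPAIR_def
  by (erule computes_Seq, rule computes_Basic) (auto simp: small_bit[simplified] split: data.split)

lemma computes_LET:
  assumes "computes s \<O> p x u a" "small s (VPair u x) (4 * a + 10) \<Longrightarrow> computes s \<O> q (VPair u x) y b"
  shows "computes s \<O> (LET p q) x y (8 * a + b + 30)"
proof -
  have x: "small s x a" by (rule computesD(1)[OF assms(1)])
  have I: "computes s \<O> (Basic Ident) x x (a + a + 1)" by (rule computes_Basic) (simp_all add: x)
  have F: "computes s \<O> (Fork p (Basic Ident)) x (VPair u x) (4 * a + 10)"
    by (rule computes_mono[OF computes_Fork[OF assms(1) I]]) simp
  show ?thesis unfolding LET_def
    by (rule computes_mono[OF computes_Seq[OF F assms(2)]]) simp_all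
qed

lemma computes_EQ:
  assumes p: "computes s \<O> p x (VInt u) a" and q: "computes s \<O> q x (VInt v) b"
    and w: "w = VInt (if u = v then 1 else 0)"
  shows "computes s \<O> (EQ p q) x w (100000 * (a + b + 10))"
proof -
  have S: "computes s \<O> (Basic Snd) (VPair (VInt u) x) x c" if "small s (VPair (VInt u) x) d" "c = d + d + 1" for c d
    unfolding that(2) by (rule computes_Basic) (use that(1) in \<open>auto dest: small_VPairD\<close>)
  have "\<exists>c. computes s \<O> (EQ p q) x w c \<and> c \<le> 100000 * (a + b + 10)" unfolding EQ_def w
    by (intro exI conjI)
      (rule computes_LET computes_SUB computes_LESS computes_LIT computes_VAR p q computes_Seq[OF S] | assumption | simp | rule refl |
       simp add: floorlog_def)+
  then show ?thesis using computes_mono by blast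
qed


subsection \<open>Bounded iteration\<close>

text \<open>The body of \<open>ITER\<close> sees the loop index, which runs downwards, on top of the accumulator.\<close>

definition ITER :: "prog \<Rightarrow> prog \<Rightarrow> prog \<Rightarrow> prog" where
  "ITER cnt ini body = Seq (Fork cnt (Fork ini (Basic Ident)))
     (Seq (While (LESS (LIT 0) (VAR 0))
        (Seq (Fork (SUB (VAR 0) (LIT 1)) (Basic Snd))
           (Fork (VAR 0) (Fork body (SND (Basic Snd))))))
      (VAR 1))"

lemma computes_Ident: "small s x a \<Longrightarrow> computes s \<O> (Basic Ident) x x (a + a + 1)"
  by (rule computes_Basic) simp_all

lemma computes_Snd: "small s (VPair u v) a \<Longrightarrow> computes s \<O> (Basic Snd) (VPair u v) v (a + a + 1)"
  by (rule computes_Basic) (auto dest: small_VPairD)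

text \<open>The store is the triple of counter, accumulator and environment. The counter is
  decremented before the body runs, so the body turns \<open>acc (Suc j)\<close> into
  \<open>acc j\<close> and sees j. One exponent d bounds all accumulators in advance, which allows
  the same e for the body in every round.\<close>

lemma computes_ITER:
  assumes cnt: "computes s \<O> cnt x (VInt z) a" and z: "z = int N" and N: "below s N b"
    and ini: "computes s \<O> ini x (acc N) c"
    and acc: "\<And>j. j < N \<Longrightarrow> small s (acc j) d"
    and body: "\<And>j. j < N \<Longrightarrow>
      small s (VPair (VInt (int j)) (VPair (acc (Suc j)) x)) (a + b + c + d + 5) \<Longrightarrow>
      computes s \<O> body (VPair (VInt (int j)) (VPair (acc (Suc j)) x)) (acc j) e"
    and y: "y = acc 0"
  shows "computes s \<O> (ITER cnt ini body) x y (2000 * (a + b + c + d + e + 10))"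
proof -
  let ?st = "\<lambda>j. VPair (VInt (int j)) (VPair (acc j) x)"
  have x: "small s x a" by (rule computesD(1)[OF cnt])
  have acc': "small s (acc j) (c + d)" if "j \<le> N" for j
    using acc[of j] computesD(2)[OF ini] that small_mono by (cases "j = N") fastforce+
  have szI: "small s (VPair (VInt (int j)) (VPair (acc i) x)) (a + b + c + d + 5)" if "j \<le> N" "i \<le> N" for i j
    by (rule small_mono[OF small_VPair[OF small_nat[OF below_le[OF N that(1)]] small_VPair[OF acc'[OF that(2)] x]]]) simp
  have dec: "computes s \<O> (Fork (SUB (VAR 0) (LIT 1)) (Basic Snd)) (?st (Suc j))
      (VPair (VInt (int j)) (VPair (acc (Suc j)) x)) (80 * (a + b + c + d + 10))" if "j < N" for j
    using szI[of "Suc j" "Suc j"] that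
    by (intro computes_mono[OF computes_Fork[OF computes_SUB[OF computes_VAR computes_LIT] computes_Snd]])
       (assumption | simp | simp add: floorlog_def)+
  have SS: "computes s \<O> (SND (Basic Snd)) (VPair (VInt (int j)) (VPair (acc i) x)) x (20 * (a + b + c + d + 10))"
    if "j \<le> N" "i \<le> N" for i j
    by (rule computes_mono[OF computes_SND[OF computes_Snd[OF szI[OF that]]]]) simp
  have step: "computes s \<O> (Seq (Fork (SUB (VAR 0) (LIT 1)) (Basic Snd)) (Fork (VAR 0) (Fork body (SND (Basic Snd)))))
      (?st (Suc j)) (?st j) (400 * (a + b + c + d + e + 10))" if "j < N" for j
  proof -
    have j: "j \<le> N" "Suc j \<le> N" using that by auto
    have "computes s \<O> (Fork (VAR 0) (Fork body (SND (Basic Snd)))) (VPair (VInt (int j)) (VPair (acc (Suc j)) x)) (?st j)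
       (40 * (a + b + c + d + e + 10))"
      by (rule computes_mono[OF computes_Fork[OF computes_VAR[OF _ szI[OF j]] computes_Fork[OF body[OF that szI[OF j]] SS[OF j]]]]) simp_all
    from computes_Seq[OF dec[OF that] this] show ?thesis by (rule computes_mono) simp_all
  qed
  have test: "computes s \<O> (LESS (LIT 0) (VAR 0)) (?st j) (VInt (if j = 0 then 0 else 1)) (20 * (a + b + c + d + 10))"
    if "j \<le> N" for j
    using szI[OF that that]
    by (intro computes_mono[OF computes_LESS[OF computes_LIT computes_VAR]]) (assumption | simp | simp add: floorlog_def)+
  have W: "computes s \<O> (While (LESS (LIT 0) (VAR 0))
        (Seq (Fork (SUB (VAR 0) (LIT 1)) (Basic Snd)) (Fork (VAR 0) (Fork body (SND (Basic Snd))))))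
      (?st N) (?st 0) (500 * (a + b + c + d + e + 10))"
    by (rule computes_mono[OF computes_While[of s N b \<O> _ ?st, OF N test step]]) simp_all
  have V: "computes s \<O> (VAR 1) (?st 0) (acc 0) (100 * (a + b + c + d + 10))"
    by (rule computes_mono[OF computes_VAR[OF _ szI]]) simp_all
  have I: "computes s \<O> (Fork cnt (Fork ini (Basic Ident))) x (?st N) (20 * (a + b + c + d + 10))"
    by (rule computes_mono[OF computes_Fork[OF cnt[unfolded z] computes_Fork[OF ini computes_Ident[OF x]]]]) simp
  show ?thesis unfolding ITER_def y
    by (rule computes_mono[OF computes_Seq[OF I computes_Seq[OF W V]]]) simp_all
qed

text \<open>Below the binders \<open>TAB\<close>, \<open>TSUM\<close> and \<open>TPROD\<close> the accumulator is hidden.\<close>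

definition HIDE :: "prog \<Rightarrow> prog" where
  "HIDE p = Seq (Fork (VAR 0) (SND (Basic Snd))) p"

lemma computes_HIDE:
  assumes "small s (VPair u (VPair v x)) a"
    and "small s (VPair u x) (50 * a + 50) \<Longrightarrow> computes s \<O> p (VPair u x) y b"
  shows "computes s \<O> (HIDE p) (VPair u (VPair v x)) y (100 * a + b + 200)"
proof -
  have "computes s \<O> (SND (Basic Snd)) (VPair u (VPair v x)) x (20 * a + 10)"
    by (rule computes_mono[OF computes_SND[OF computes_Snd[OF assms(1)]]]) simp
  with assms(1) have F: "computes s \<O> (Fork (VAR 0) (SND (Basic Snd))) (VPair u (VPair v x)) (VPair u x) (50 * a + 50)"
    by (intro computes_mono[OF computes_Fork[OF computes_VAR]]) (assumption | simp)+
  show ?thesis unfolding HIDE_def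
    by (rule computes_mono[OF computes_Seq[OF F assms(2)]]) simp_all
qed

definition TAB :: "prog \<Rightarrow> prog \<Rightarrow> prog" where
  "TAB cnt p = ITER cnt (LIT 0) (Fork (HIDE p) (VAR 1))"

definition TSUM :: "prog \<Rightarrow> prog \<Rightarrow> prog" where
  "TSUM cnt p = ITER cnt (LIT 0) (ADD (HIDE p) (VAR 1))"

definition TPROD :: "prog \<Rightarrow> prog \<Rightarrow> prog" where
  "TPROD cnt p = ITER cnt (LIT 1) (MUL (HIDE p) (VAR 1))"

text \<open>Counting down suits lists: consing the values for N - 1, ..., 0 leaves them in ascending
  order.\<close>

lemma computes_TAB:
  assumes cnt: "computes s \<O> cnt x (VInt z) a" and z: "z = int N" and N: "below s N b"
    and body: "\<And>j. j < N \<Longrightarrow> small s (VPair (VInt (int j)) x) (a + b + 5) \<Longrightarrow>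
      computes s \<O> p (VPair (VInt (int j)) x) (u j) e"
    and y: "y = enc_list (map u [0..<N])"
  shows "computes s \<O> (TAB cnt p) x y (20000000 * (a + b + e + 10))"
proof -
  have x: "small s x a" by (rule computesD(1)[OF cnt])
  have szI: "small s (VPair (VInt (int j)) x) (a + b + 5)" if "j < N" for j
    by (rule small_mono[OF small_VPair[OF small_nat[OF below_le[OF N]] x]]) (use that in simp_all)
  have u: "small s (u j) e" if "j < N" for j
    by (rule computesD(2)[OF body[OF that szI[OF that]]])
  show ?thesis unfolding TAB_def
  proof (rule computes_mono[OF computes_ITER[OF cnt z N, where acc = "\<lambda>j. enc_list (map u [j..<N])"]])
    show "computes s \<O> (LIT 0) x (enc_list (map u [N..<N])) (a + 2)"
      using x by (intro computes_mono[OF computes_LIT]) (assumption | simp | simp add: floorlog_def)+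
    show "small s (enc_list (map u [j..<N])) (e + b + b + 2)" if "j < N" for j
      by (rule small_enc_list) (use u below_le[OF N] in auto)
    fix j assume j: "j < N"
      and small: "small s (VPair (VInt (int j)) (VPair (enc_list (map u [Suc j..<N])) x)) (a + b + (a + 2) + (e + b + b + 2) + 5)"
    have eq: "enc_list (map u [j..<N]) = VPair (u j) (enc_list (map u [Suc j..<N]))"
      by (simp add: upt_conv_Cons[OF j])
    show "computes s \<O> (Fork (HIDE p) (VAR 1)) (VPair (VInt (int j)) (VPair (enc_list (map u [Suc j..<N])) x))
        (enc_list (map u [j..<N])) (5000 * (a + b + e + 10))" unfolding eq
      by (rule computes_mono[OF computes_Fork[OF computes_HIDE[OF small body[OF j szI[OF j]]] computes_VAR[OF _ small]]]; simp)
  next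
    show "y = enc_list (map u [0..<N])" by (rule y)
  qed simp
qed

lemma computes_TSUM:
  assumes cnt: "computes s \<O> cnt x (VInt z) a" and z: "z = int N" and N: "below s N b"
    and body: "\<And>j. j < N \<Longrightarrow> small s (VPair (VInt (int j)) x) (a + b + 5) \<Longrightarrow>
      computes s \<O> p (VPair (VInt (int j)) x) (VInt (u j)) e"
    and y: "y = VInt (\<Sum>j<N. u j)"
  shows "computes s \<O> (TSUM cnt p) x y (20000000 * (a + b + e + 10))"
proof -
  have x: "small s x a" by (rule computesD(1)[OF cnt])
  have szI: "small s (VPair (VInt (int j)) x) (a + b + 5)" if "j < N" for j
    by (rule small_mono[OF small_VPair[OF small_nat[OF below_le[OF N]] x]]) (use that in simp_all)
  have u: "small s (VInt (u j)) e" if "j < N" for j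
    by (rule computesD(2)[OF body[OF that szI[OF that]]])
  show ?thesis unfolding TSUM_def
  proof (rule computes_mono[OF computes_ITER[OF cnt z N, where acc = "\<lambda>j. VInt (\<Sum>i\<in>{j..<N}. u i)"]])
    show "computes s \<O> (LIT 0) x (VInt (\<Sum>i\<in>{N..<N}. u i)) (a + 2)"
      using x by (intro computes_mono[OF computes_LIT]) (assumption | simp | simp add: floorlog_def)+
    show "small s (VInt (\<Sum>i\<in>{j..<N}. u i)) (e + b + 2)" if "j < N" for j
      by (rule small_sum[OF u N]) auto
    fix j assume j: "j < N"
      and small: "small s (VPair (VInt (int j)) (VPair (VInt (\<Sum>i\<in>{Suc j..<N}. u i)) x)) (a + b + (a + 2) + (e + b + 2) + 5)"
    show "computes s \<O> (ADD (HIDE p) (VAR 1)) (VPair (VInt (int j)) (VPair (VInt (\<Sum>i\<in>{Suc j..<N}. u i)) x))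
        (VInt (\<Sum>i\<in>{j..<N}. u i)) (5000 * (a + b + e + 10))"
      unfolding sum.atLeast_Suc_lessThan[OF j]
      by (rule computes_mono[OF computes_ADD[OF computes_HIDE[OF small body[OF j szI[OF j]]] computes_VAR[OF _ small] refl]]; simp)
  next
    show "y = VInt (\<Sum>i\<in>{0..<N}. u i)" by (simp add: y atLeast0LessThan)
  qed simp
qed

lemma computes_TPROD:
  assumes cnt: "computes s \<O> cnt x (VInt z) a" and z: "z = int N" and N: "below s N b"
    and body: "\<And>j. j < N \<Longrightarrow> small s (VPair (VInt (int j)) x) (a + b + 5) \<Longrightarrow>
      computes s \<O> p (VPair (VInt (int j)) x) (VInt (u j)) e"
    and y: "y = VInt (\<Prod>j<N. u j)"
  shows "computes s \<O> (TPROD cnt p) x y (20000000 * (a + b + e + 10))"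
proof -
  have x: "small s x a" by (rule computesD(1)[OF cnt])
  have szI: "small s (VPair (VInt (int j)) x) (a + b + 5)" if "j < N" for j
    by (rule small_mono[OF small_VPair[OF small_nat[OF below_le[OF N]] x]]) (use that in simp_all)
  have u: "small s (VInt (u j)) e" if "j < N" for j
    by (rule computesD(2)[OF body[OF that szI[OF that]]])
  show ?thesis unfolding TPROD_def
  proof (rule computes_mono[OF computes_ITER[OF cnt z N, where acc = "\<lambda>j. VInt (\<Prod>i\<in>{j..<N}. u i)"]])
    show "computes s \<O> (LIT 1) x (VInt (\<Prod>i\<in>{N..<N}. u i)) (a + 3)"
      using x by (intro computes_mono[OF computes_LIT]) (assumption | simp | simp add: floorlog_def)+
    show "small s (VInt (\<Prod>i\<in>{j..<N}. u i)) (e + b + 2)" if "j < N" for j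
      by (rule small_prod[OF u N]) auto
    fix j assume j: "j < N"
      and small: "small s (VPair (VInt (int j)) (VPair (VInt (\<Prod>i\<in>{Suc j..<N}. u i)) x)) (a + b + (a + 3) + (e + b + 2) + 5)"
    show "computes s \<O> (MUL (HIDE p) (VAR 1)) (VPair (VInt (int j)) (VPair (VInt (\<Prod>i\<in>{Suc j..<N}. u i)) x))
        (VInt (\<Prod>i\<in>{j..<N}. u i)) (5000 * (a + b + e + 10))"
      unfolding prod.atLeast_Suc_lessThan[OF j]
      by (rule computes_mono[OF computes_MUL[OF computes_HIDE[OF small body[OF j szI[OF j]]] computes_VAR[OF _ small] refl]]; simp)
  next
    show "y = VInt (\<Prod>i\<in>{0..<N}. u i)" by (simp add: y atLeast0LessThan)
  qed simp
qed

lemma small_enc_list_drop: "small s (enc_list vs) a \<Longrightarrow> small s (enc_list (drop j vs)) a"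
proof -
  have "dsize (enc_list (drop j vs)) \<le> dsize (enc_list vs)"
  proof (induction vs arbitrary: j)
    case (Cons v vs)
    then show ?case by (cases j) (simp_all add: le_SucI trans_le_add2)
  qed simp
  then show "small s (enc_list vs) a \<Longrightarrow> ?thesis" by (simp add: small_def)
qed

definition NTH :: "prog \<Rightarrow> prog \<Rightarrow> prog" where
  "NTH i l = FST (ITER i l (SND (VAR 1)))"

lemma computes_NTH:
  assumes i: "computes s \<O> i x (VInt z) a" and l: "computes s \<O> l x (enc_list vs) b"
    and z: "z = int k" and k: "k < length vs" and y: "y = vs ! k"
  shows "computes s \<O> (NTH i l) x y (20000000 * (a + b + 10))"
proof -
  have small: "small s (enc_list (drop j vs)) b" for j
    by (rule small_enc_list_drop[OF computesD(2)[OF l]])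
  have N: "below s k b"
    by (rule below_le[OF small_enc_list_length[OF computesD(2)[OF l]]]) (use k in simp)
  have "computes s \<O> (ITER i l (SND (VAR 1))) x (enc_list (drop k vs)) (2000000 * (a + b + 10))"
  proof (rule computes_mono[OF computes_ITER[OF i z N, where acc = "\<lambda>j. enc_list (drop (k - j) vs)"]])
    show "computes s \<O> l x (enc_list (drop (k - k) vs)) b" using l by simp
    show "small s (enc_list (drop (k - j) vs)) b" for j by (rule small)
    fix j assume j: "j < k" and small': "small s (VPair (VInt (int j)) (VPair (enc_list (drop (k - Suc j) vs)) x)) (a + b + b + b + 5)"
    have "drop (k - Suc j) vs = vs ! (k - Suc j) # drop (k - j) vs"
      using Cons_nth_drop_Suc[of "k - Suc j" vs] j k by (simp add: Suc_diff_Suc)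
    then have "enc_list (drop (k - Suc j) vs) = VPair (vs ! (k - Suc j)) (enc_list (drop (k - j) vs))"
      by simp
    with small' show "computes s \<O> (SND (VAR 1)) (VPair (VInt (int j)) (VPair (enc_list (drop (k - Suc j) vs)) x))
       (enc_list (drop (k - j) vs)) (200 * (a + b + 10))"
      by (intro computes_mono[OF computes_SND[OF computes_VAR[where k = 1]]]) (assumption | simp)+
  qed simp_all
  moreover have "enc_list (drop k vs) = VPair y (enc_list (drop (Suc k) vs))"
    using k by (simp add: y Cons_nth_drop_Suc[symmetric])
  ultimately show ?thesis unfolding NTH_def
    by (intro computes_mono[OF computes_FST]) (auto simp: algebra_simps)
qed

text \<open>Meant for lists whose length is not stored: the loop runs until the tail is no longer a
  pair. The program p sees the head on top of the original environment.\<close>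

definition LSUM :: "prog \<Rightarrow> prog \<Rightarrow> prog" where
  "LSUM l p = Seq (Fork l (Fork (LIT 0) (Basic Ident)))
     (Seq (While (ISPAIR (VAR 0))
        (Fork (SND (VAR 0))
           (Fork (ADD (Seq (Fork (FST (VAR 0)) (SND (Basic Snd))) p) (VAR 1)) (SND (Basic Snd)))))
      (VAR 1))"

lemma computes_LSUM:
  assumes l: "computes s \<O> l x (enc_list vs) a"
    and body: "\<And>i. i < length vs \<Longrightarrow> small s (VPair (vs ! i) x) (2 * a + 2) \<Longrightarrow>
      computes s \<O> p (VPair (vs ! i) x) (VInt (u i)) e"
    and y: "y = VInt (\<Sum>i<length vs. u i)"
  shows "computes s \<O> (LSUM l p) x y (20000 * (a + e + 10))"
proof -
  let ?N = "length vs"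
  let ?st = "\<lambda>j. VPair (enc_list (drop (?N - j) vs)) (VPair (VInt (\<Sum>i<?N - j. u i)) x)"
  have x: "small s x a" by (rule computesD(1)[OF l])
  have vs: "small s (enc_list vs) a" by (rule computesD(2)[OF l])
  have N: "below s ?N a" by (rule small_enc_list_length[OF vs])
  have el: "small s (vs ! i) a" if "i < ?N" for i
  proof -
    have "small s (VPair (vs ! i) (enc_list (drop (Suc i) vs))) a"
      using small_enc_list_drop[OF vs, of i] that by (simp flip: Cons_nth_drop_Suc)
    then show ?thesis by (rule small_VPairD)
  qed
  have sz2: "small s (VPair (vs ! i) x) (2 * a + 2)" if "i < ?N" for i
    using small_VPair[OF el[OF that] x] by (simp add: mult_2)
  have u: "small s (VInt (u i)) e" if "i < ?N" for i
    by (rule computesD(2)[OF body[OF that sz2[OF that]]])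
  have S: "small s (VInt (\<Sum>i<k. u i)) (e + a + 2)" if "k \<le> ?N" for k
    by (rule small_sum[OF u N]) (use that in auto)
  have st: "small s (?st j) (3 * a + e + 10)" for j
    by (rule small_mono[OF small_VPair[OF small_enc_list_drop[OF vs] small_VPair[OF S x]]]) simp_all
  have test: "computes s \<O> (ISPAIR (VAR 0)) (?st j) (VInt (if j = 0 then 0 else 1)) (100 * (a + e + 10))"
    if "j \<le> ?N" for j
    by (rule computes_mono[OF computes_ISPAIR[OF computes_VAR[OF _ st[of j]]]])
      (use that Cons_nth_drop_Suc[of "?N - j" vs] in \<open>auto simp flip: Cons_nth_drop_Suc\<close>)
  have step: "computes s \<O> (Fork (SND (VAR 0))
      (Fork (ADD (Seq (Fork (FST (VAR 0)) (SND (Basic Snd))) p) (VAR 1)) (SND (Basic Snd))))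
      (?st (Suc j)) (?st j) (5000 * (a + e + 10))" if "j < ?N" for j
  proof -
    let ?i = "?N - Suc j" and ?t = "enc_list (drop (?N - j) vs)" and ?z = "\<Sum>i<?N - Suc j. u i"
    have i: "?i < ?N" "Suc ?i = ?N - j" using that by auto
    have eq: "?st (Suc j) = VPair (VPair (vs ! ?i) ?t) (VPair (VInt ?z) x)"
      using Cons_nth_drop_Suc[OF i(1)] i(2) by (simp flip: Cons_nth_drop_Suc)
    have sum: "(\<Sum>i<?N - j. u i) = u ?i + ?z" unfolding i(2)[symmetric] by simp
    note st' = st[of "Suc j", unfolded eq]
    have V: "computes s \<O> (VAR 0) (VPair (VPair (vs ! ?i) ?t) (VPair (VInt ?z) x)) (VPair (vs ! ?i) ?t)
        (2 * (3 * a + e + 10) + 1)"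
      using computes_VAR[OF _ st', of 0] by simp
    have X: "computes s \<O> (SND (Basic Snd)) (VPair (VPair (vs ! ?i) ?t) (VPair (VInt ?z) x)) x
        (8 * (3 * a + e + 10) + 10)"
      by (rule computes_mono[OF computes_SND[OF computes_Snd[OF st']]]) simp
    have P: "computes s \<O> (Seq (Fork (FST (VAR 0)) (SND (Basic Snd))) p)
        (VPair (VPair (vs ! ?i) ?t) (VPair (VInt ?z) x)) (VInt (u ?i)) (200 * (a + e + 10))"
      by (rule computes_mono[OF computes_Seq[OF computes_Fork[OF computes_FST[OF V] X] body[OF i(1) sz2[OF i(1)]]]]) simp
    show ?thesis unfolding eq sum
      by (rule computes_mono[OF computes_Fork[OF computes_SND[OF V] computes_Fork[OF computes_ADD[OF P computes_VAR[where k = 1, OF _ st'] refl] X]]]) simp_all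
  qed
  have W: "computes s \<O> (While (ISPAIR (VAR 0)) (Fork (SND (VAR 0))
      (Fork (ADD (Seq (Fork (FST (VAR 0)) (SND (Basic Snd))) p) (VAR 1)) (SND (Basic Snd)))))
      (?st ?N) (?st 0) (6000 * (a + e + 10))"
    by (rule computes_mono[OF computes_While[of s ?N a \<O> _ ?st, OF N test step]]) simp_all
  have V: "computes s \<O> (VAR 1) (?st 0) y (100 * (a + e + 10))"
    by (rule computes_mono[OF computes_VAR[OF _ st]]) (simp_all add: y)
  have I: "computes s \<O> (Fork l (Fork (LIT 0) (Basic Ident))) x (?st ?N) (20 * (a + e + 10))"
    using computes_mono[OF computes_Fork[OF l computes_Fork[OF computes_LIT[OF x refl, of \<O> 0] computes_Ident[OF x]]]]
    by (simp add: floorlog_def)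
  show ?thesis unfolding LSUM_def
    by (rule computes_mono[OF computes_Seq[OF I computes_Seq[OF W V]]]) simp_all
qed

text \<open>Without oracle calls, time pays for output: basic steps are charged the size of their
  result, and a fork pays for its new node with the charge for its input. The second claim is what
  later bounds the sizes of the indices.\<close>

lemma exec_no_oracle:
  assumes "exec no_oracle p v w T"
  shows "exec \<O> p v w T" "dsize w \<le> T"
proof -
  have "exec \<O> p v w T \<and> dsize w \<le> T"
    using assms
  proof (induction rule: exec.induct)
    case (Fork p v x T1 q y T2)
    then show ?case using dsize_pos[of v] by (auto intro: exec.Fork)
  qed (auto intro: exec.intros simp: no_oracle_def)
  then show "exec \<O> p v w T" "dsize w \<le> T" by auto
qed

lemma computes_poly_time:
  assumes "computes_in_poly_time p C k n \<Lambda> inp out" "l \<in> \<Lambda>"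
    and "small s (VPair (VInt (int n)) (inp l)) a" "below s n b"
  shows "computes s \<O> p (VPair (VInt (int n)) (inp l)) (out l) (a + C + (b + a + 2) * k)"
proof -
  from assms(1,2) obtain T where T: "exec no_oracle p (VPair (VInt (int n)) (inp l)) (out l) T"
    "T \<le> C * (1 + n + dsize (inp l)) ^ k"
    unfolding computes_in_poly_time_def by blast
  have "below s (dsize (inp l)) a" using small_VPairD(2)[OF assms(3)] by (simp add: small_def below_def)
  then have "below s (C * (1 + n + dsize (inp l)) ^ k) (C + (b + a + 2) * k)"
    using below_Suc[OF below_add[OF assms(4)]] by (intro below_mult below_power below_const) simp
  from below_le[OF this T(2)] have TT: "below s T (C + (b + a + 2) * k)" .
  then have "small s (out l) (C + (b + a + 2) * k)"
    using exec_no_oracle(2)[OF T(1)] by (simp add: below_def small_def)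
  from computesI[OF assms(3) this exec_no_oracle(1)[OF T(1)] TT] show ?thesis by simp
qed


section \<open>Separating weights\<close>

text \<open>The recurrence of Leibniz's harmonic triangle with entries 1 / (m * C(n, m)). It rests
  on (n - m) * C(n, m) = n * C(n - 1, m) = (m + 1) * C(n, m + 1).\<close>

lemma leibniz_triangle:
  assumes "1 \<le> m" "m < n"
  shows "1 / (real m * real (n choose m)) =
    1 / (real m * real ((n - 1) choose m)) - 1 / (real (Suc m) * real (n choose Suc m))"
proof -
  let ?c = "real ((n - 1) choose m)"
  have c: "?c > 0" using assms by simp
  have 1: "real (n - m) * real (n choose m) = real n * ?c"
    by (metis binomial_absorb_comp of_nat_mult)
  have "Suc m * (n choose Suc m) = (n - m) * (n choose m)"
    using binomial_absorption[of m n] binomial_absorb_comp[of n m] by simp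
  then have 2: "real (Suc m) * real (n choose Suc m) = real n * ?c"
    by (metis 1 of_nat_mult)
  have "real (n choose m) = real n * ?c / real (n - m)" using 1 assms by (simp add: field_simps)
  then show ?thesis unfolding 2 using assms c by (simp add: field_simps of_nat_diff)
qed

text \<open>Nair's argument: X times any entry of the harmonic triangle is an integer, by induction
  on the rows. Within a row one descends from m = n, where the entry is 1 / n; every other entry is
  one of the previous row minus the one just treated.\<close>

lemma mult_binomial_dvd:
  assumes "\<And>q. 1 \<le> q \<Longrightarrow> q \<le> N \<Longrightarrow> q dvd X" and "1 \<le> m" "m \<le> n" "n \<le> N"
  shows "m * (n choose m) dvd X"
proof -
  have "real X / (real m * real (n choose m)) \<in> \<int>"
    using assms(2-)
  proof (induction n arbitrary: m)
    case (Suc n)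
    from Suc.prems(2,1) show ?case
    proof (induction m rule: inc_induct)
      case base
      have "Suc n dvd X" using assms(1) Suc.prems by simp
      then have "real X / real (Suc n) = real (X div Suc n)" by (rule real_of_nat_div[symmetric])
      then show ?case by (metis Ints_of_nat binomial_n_n mult.right_neutral of_nat_1)
    next
      case (step m)
      have *: "real X / (real m * real (Suc n choose m)) = real X / (real m * real (n choose m)) -
        real X / (real (Suc m) * real (Suc n choose Suc m))"
        using arg_cong[OF leibniz_triangle[of m "Suc n"], of "\<lambda>t. real X * t"] step
        by (simp add: right_diff_distrib del: binomial_Suc_Suc)
      show ?case unfolding * using step Suc by (intro Ints_diff) auto
    qed
  qed simp
  then obtain z :: int where "real X / (real m * real (n choose m)) = of_int z" by (elim Ints_cases)
  then have "real X = of_int z * (real m * real (n choose m))"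
    using assms by (simp add: field_simps)
  then have "int X = z * int (m * (n choose m))"
    by (metis of_int_eq_iff of_int_mult of_int_of_nat_eq of_nat_mult)
  then show ?thesis by (metis dvd_triv_right int_dvd_int_iff)
qed

text \<open>Otherwise K * C(2K, K) divides X for K = k + 1, but this product is at least 4^K / 2 = 2
  * 4^k > 2^k.\<close>

lemma exists_nondivisor:
  assumes "0 < X" "X \<le> 2 ^ k"
  shows "\<exists>q. 1 \<le> q \<and> q \<le> 2 * (k + 1) \<and> \<not> q dvd X"
proof (rule ccontr)
  define K where "K = k + 1"
  define B where "B = (2 * K) choose K"
  assume "\<not> ?thesis"
  then have "K * B dvd X"
    unfolding B_def by (intro mult_binomial_dvd[of "2 * K"]) (auto simp: K_def)
  then have "K * B \<le> X" using assms(1) by (rule dvd_imp_le)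
  then have "K * B \<le> 2 ^ k" using assms(2) by (rule order_trans)
  then have "real (K * B) \<le> real (2 ^ k)" by (rule of_nat_mono)
  then have le: "real K * real B \<le> 2 ^ k" by simp
  have K: "real K > 0" by (simp add: K_def)
  have "4 ^ K / (2 * real K) \<le> real B"
    using central_binomial_lower_bound[of K] K by (simp add: B_def)
  then have "4 ^ K / 2 \<le> real K * real B" using K by (simp add: field_simps)
  with le have "(4::real) ^ K / 2 \<le> 2 ^ k" by linarith
  moreover have "(2::real) ^ k \<le> 4 ^ k" by (intro power_mono) auto
  moreover have "(0::real) < 4 ^ k" by simp
  ultimately show False by (simp add: K_def)
qed

lemma digits_inject:
  fixes u v :: "nat \<Rightarrow> nat"
  assumes "\<And>j. j < n \<Longrightarrow> u j \<le> d" "\<And>j. j < n \<Longrightarrow> v j \<le> d"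
    and "(\<Sum>j<n. u j * (d + 1) ^ j) = (\<Sum>j<n. v j * (d + 1) ^ j)"
  shows "\<forall>j<n. u j = v j"
  using assms
proof (induction n arbitrary: u v)
  case (Suc n)
  have split: "(\<Sum>j<Suc n. w j * (d + 1) ^ j) = w 0 + (d + 1) * (\<Sum>j<n. w (Suc j) * (d + 1) ^ j)"
    for w :: "nat \<Rightarrow> nat"
    unfolding sum.lessThan_Suc_shift by (simp add: sum_distrib_left algebra_simps)
  from Suc.prems(3) have eq: "u 0 + (d + 1) * (\<Sum>j<n. u (Suc j) * (d + 1) ^ j) =
    v 0 + (d + 1) * (\<Sum>j<n. v (Suc j) * (d + 1) ^ j)" by (simp only: split)
  have "u 0 < d + 1" "v 0 < d + 1" using Suc.prems(1,2)[of 0] by auto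
  with arg_cong[OF eq, of "\<lambda>t. t mod (d + 1)"] have 0: "u 0 = v 0"
    by (metis mod_less mod_mult_self2)
  have "(d + 1) * (\<Sum>j<n. u (Suc j) * (d + 1) ^ j) = (d + 1) * (\<Sum>j<n. v (Suc j) * (d + 1) ^ j)"
    using eq 0 by linarith
  then have "(\<Sum>j<n. u (Suc j) * (d + 1) ^ j) = (\<Sum>j<n. v (Suc j) * (d + 1) ^ j)"
    by (metis add_is_0 mult_left_cancel one_neq_zero)
  with Suc.IH[of "u \<circ> Suc" "v \<circ> Suc"] Suc.prems(1,2) have "\<forall>j<n. u (Suc j) = v (Suc j)" by simp
  with 0 show ?case by (metis less_Suc_eq_0_disj)
qed simp

lemma digits_less:
  fixes u :: "nat \<Rightarrow> nat"
  assumes "\<And>j. j < n \<Longrightarrow> u j \<le> d"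
  shows "(\<Sum>j<n. u j * (d + 1) ^ j) < (d + 1) ^ n"
  using assms
proof (induction n)
  case (Suc n)
  have "u n * (d + 1) ^ n \<le> d * (d + 1) ^ n" using Suc.prems[of n] by (intro mult_right_mono) auto
  moreover have "(\<Sum>j<n. u j * (d + 1) ^ j) < (d + 1) ^ n" using Suc.prems by (intro Suc.IH) simp
  ultimately show ?case
    by (simp only: sum.lessThan_Suc power_Suc distrib_right mult_1)
qed simp

text \<open>Congruent modulo q to (d + 1)^j, the weights of Kronecker's substitution, which separate
  exponents but are too large to serve as exponents of y. For q \<ge> 1 the summand q makes the
  weights positive, as the forms in L_A require, and they stay below 2 q.\<close>

definition weight :: "nat \<Rightarrow> nat \<Rightarrow> nat \<Rightarrow> nat" where
  "weight d q j = q + (d + 1) ^ j mod q"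

lemma exists_separating_weight:
  fixes V :: "(nat \<Rightarrow> nat) set"
  assumes fin: "finite V" and card: "card V \<le> m"
    and le: "\<And>v j. v \<in> V \<Longrightarrow> j < n \<Longrightarrow> v j \<le> d"
    and diff: "\<And>u v. u \<in> V \<Longrightarrow> v \<in> V \<Longrightarrow> u \<noteq> v \<Longrightarrow> \<exists>j<n. u j \<noteq> v j"
  shows "\<exists>q. 1 \<le> q \<and> q \<le> 2 * (m * m * n * d + 1) \<and>
    inj_on (\<lambda>v. \<Sum>j<n. v j * weight d q j) V"
proof -
  define \<kappa> where "\<kappa> v = (\<Sum>j<n. v j * (d + 1) ^ j)" for v :: "nat \<Rightarrow> nat"
  define P where "P = {(u, v). u \<in> V \<and> v \<in> V \<and> u \<noteq> v}"
  \<comment> \<open>Ordered pairs give at most m * m factors, each at most (d + 1)^n \<le> 2^(n d);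
    this is the origin of the range for q. A q that does not divide X divides no difference of two
    \<kappa>-values.\<close>
  define X where "X = (\<Prod>(u, v)\<in>P. nat \<bar>int (\<kappa> u) - int (\<kappa> v)\<bar>)"
  have PV: "P \<subseteq> V \<times> V" by (auto simp: P_def)
  then have finP: "finite P" using fin finite_subset by blast
  have \<kappa>: "\<kappa> u \<noteq> \<kappa> v" if "u \<in> V" "v \<in> V" "u \<noteq> v" for u v
    using digits_inject[of n u d v] le diff that unfolding \<kappa>_def by metis
  have "X > 0" unfolding X_def using finP \<kappa> by (auto simp: P_def intro!: prod_pos)
  moreover have "X \<le> 2 ^ (m * m * n * d)"
  proof -
    have "nat \<bar>int (\<kappa> u) - int (\<kappa> v)\<bar> \<le> 2 ^ (n * d)" if "(u, v) \<in> P" for u v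
    proof -
      have "\<kappa> u < (d + 1) ^ n" "\<kappa> v < (d + 1) ^ n"
        using that le unfolding \<kappa>_def P_def by (auto intro!: digits_less[simplified])
      then have "nat \<bar>int (\<kappa> u) - int (\<kappa> v)\<bar> \<le> (d + 1) ^ n" by linarith
      also have "\<dots> \<le> (2 ^ d) ^ n" by (intro power_mono) (simp_all add: Suc_le_eq)
      finally show ?thesis by (simp add: ac_simps flip: power_mult)
    qed
    then have "X \<le> (\<Prod>p\<in>P. 2 ^ (n * d))" unfolding X_def by (intro prod_mono) auto
    also have "\<dots> = 2 ^ (card P * (n * d))" by (simp add: ac_simps flip: power_mult)
    also have "\<dots> \<le> 2 ^ (m * m * (n * d))"
    proof (rule power_increasing)
      have "card P \<le> card V * card V"
        using card_mono[OF _ PV] fin by (simp add: card_cartesian_product)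
      also have "\<dots> \<le> m * m" using card by (intro mult_le_mono)
      finally show "card P * (n * d) \<le> m * m * (n * d)" by (rule mult_le_mono1)
    qed simp
    finally show ?thesis by (simp add: mult.assoc)
  qed
  ultimately obtain q where q: "1 \<le> q" "q \<le> 2 * (m * m * n * d + 1)" "\<not> q dvd X"
    using exists_nondivisor by blast
  have "u = v" if uv: "u \<in> V" "v \<in> V" and eq: "(\<Sum>j<n. u j * weight d q j) = (\<Sum>j<n. v j * weight d q j)" for u v
  proof (rule ccontr)
    assume "u \<noteq> v"
    with uv have P: "(u, v) \<in> P" by (simp add: P_def)
    have w: "(\<Sum>j<n. w j * weight d q j) mod q = \<kappa> w mod q" for w
    proof -
      have "(\<Sum>j<n. w j * weight d q j) mod q = (\<Sum>j<n. (w j * weight d q j) mod q) mod q"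
        by (simp add: mod_sum_eq)
      also have "(\<Sum>j<n. (w j * weight d q j) mod q) = (\<Sum>j<n. (w j * (d + 1) ^ j) mod q)"
        by (intro sum.cong refl) (metis mod_add_self1 mod_mod_trivial mod_mult_right_eq weight_def)
      also have "\<dots> mod q = \<kappa> w mod q" by (simp add: mod_sum_eq \<kappa>_def)
      finally show ?thesis .
    qed
    have "\<kappa> u mod q = \<kappa> v mod q" using w[of u] w[of v] eq by simp
    then have "int q dvd int (\<kappa> u) - int (\<kappa> v)"
      by (metis mod_eq_dvd_iff of_nat_mod)
    then have "q dvd nat \<bar>int (\<kappa> u) - int (\<kappa> v)\<bar>" by (simp add: dvd_nat_abs_iff)
    also have "\<dots> dvd X" unfolding X_def
      using dvd_prodI[OF finP P, of "\<lambda>(u, v). nat \<bar>int (\<kappa> u) - int (\<kappa> v)\<bar>"] by simp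
    finally show False using q(3) by simp
  qed
  then have "inj_on (\<lambda>v. \<Sum>j<n. v j * weight d q j) V" by (intro inj_onI)
  with q show ?thesis by blast
qed


section \<open>Finite differences and leading coefficients\<close>

primrec fdiff :: "nat \<Rightarrow> (nat \<Rightarrow> int) \<Rightarrow> nat \<Rightarrow> int" where
  "fdiff 0 g y = g y"
| "fdiff (Suc k) g y = fdiff k g (Suc y) - fdiff k g y"

lemma fdiff_Suc': "fdiff (Suc k) g y = fdiff k (\<lambda>y. g (Suc y) - g y) y"
  by (induction k arbitrary: y) simp_all

lemma fdiff_sum: "fdiff k (\<lambda>y. \<Sum>i\<in>S. c i * h i y) y = (\<Sum>i\<in>S. c i * fdiff k (h i) y)"
  by (induction k arbitrary: y) (simp_all add: sum_subtractf right_diff_distrib)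

text \<open>One difference turns y^r into a combination of powers below r. Of these only y^k
  survives k further differences, and it occurs just for r = k + 1, with coefficient k + 1.\<close>

lemma fdiff_power:
  assumes "r \<le> k" shows "fdiff k (\<lambda>y. int y ^ r) y = (if r = k then fact k else 0)"
  using assms
proof (induction k arbitrary: r y)
  case (Suc k)
  have "int (Suc y) ^ r - int y ^ r = (\<Sum>i<r. int (r choose i) * int y ^ i)" for y
    using binomial_ring[of "int y" 1 r] by (simp add: lessThan_Suc_atMost[symmetric] add.commute)
  then have "fdiff (Suc k) (\<lambda>y. int y ^ r) y = (\<Sum>i<r. int (r choose i) * fdiff k (\<lambda>y. int y ^ i) y)"
    unfolding fdiff_Suc' by (simp add: fdiff_sum)
  also have "\<dots> = (\<Sum>i<r. if i = k then int (r choose i) * fact k else 0)"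
    using Suc by (intro sum.cong) auto
  also have "\<dots> = (if r = Suc k then fact (Suc k) else 0)"
    using Suc.prems by (auto simp: sum.delta)
  finally show ?case .
qed simp

text \<open>Records the degree, as its distance from \<open>D\<close>, and the last nonzero difference.\<close>

primrec top_diff :: "nat \<Rightarrow> (nat \<Rightarrow> int) \<Rightarrow> nat \<Rightarrow> nat \<times> int" where
  "top_diff D g 0 = (0, 0)"
| "top_diff D g (Suc k) = (if fdiff k g 0 \<noteq> 0 then (D - k, fdiff k g 0) else top_diff D g k)"

lemma top_diff:
  assumes "top_diff D g (Suc D) = (j, t)"
  shows "j \<le> D" "t = fdiff (D - j) g 0" "\<And>k. D - j < k \<Longrightarrow> k \<le> D \<Longrightarrow> fdiff k g 0 = 0"
proof -
  \<comment> \<open>The default (0, 0) reports degree D with coefficient 0. It occurs only if all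
    differences vanish, the one of order D included, so it satisfies the same claims.\<close>
  have "top_diff D g K = (j, t) \<Longrightarrow> K \<le> Suc D \<Longrightarrow>
    (t = 0 \<and> j = 0 \<and> (\<forall>k<K. fdiff k g 0 = 0)) \<or>
    (j \<le> D \<and> t = fdiff (D - j) g 0 \<and> (\<forall>k. D - j < k \<and> k < K \<longrightarrow> fdiff k g 0 = 0))" for K
    by (induction K) (auto split: if_splits simp: less_Suc_eq)
  from this[OF assms] show "j \<le> D" "t = fdiff (D - j) g 0" "\<And>k. D - j < k \<Longrightarrow> k \<le> D \<Longrightarrow> fdiff k g 0 = 0"
    by auto
qed

lemma top_diff_eqI:
  assumes "\<delta> \<le> D" "fdiff \<delta> g 0 \<noteq> 0" "\<And>k. \<delta> < k \<Longrightarrow> fdiff k g 0 = 0"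
  shows "top_diff D g (Suc D) = (D - \<delta>, fdiff \<delta> g 0)"
proof -
  have "\<delta> < K \<Longrightarrow> top_diff D g K = (D - \<delta>, fdiff \<delta> g 0)" for K
    by (induction K) (use assms in \<open>auto simp: less_Suc_eq\<close>)
  then show ?thesis using assms(1) le_imp_less_Suc by blast
qed

text \<open>Equation s + 1 minus w z times equation s eliminates z. What remains is a system for F
  with one equation less and the coefficients b x * (w x - w z), where the second factor is
  nonzero.\<close>

lemma vandermonde:
  fixes b w :: "'a \<Rightarrow> int"
  assumes "finite F" "inj_on w F" "card F \<le> M" "\<And>s. s < M \<Longrightarrow> (\<Sum>x\<in>F. b x * w x ^ s) = 0" "x \<in> F"
  shows "b x = 0"
  using assms
proof (induction F arbitrary: b M x rule: finite_induct)
  case (insert z F)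
  obtain M' where M: "M = Suc M'" using insert.prems(2) insert.hyps by (cases M) auto
  have "(\<Sum>x\<in>F. (b x * (w x - w z)) * w x ^ s) = 0" if "s < M'" for s
  proof -
    have "(\<Sum>x\<in>insert z F. b x * w x ^ Suc s) - w z * (\<Sum>x\<in>insert z F. b x * w x ^ s) = 0"
      using insert.prems(3)[of s] insert.prems(3)[of "Suc s"] that M by simp
    then have "(\<Sum>x\<in>insert z F. b x * w x ^ Suc s - w z * (b x * w x ^ s)) = 0"
      by (simp only: sum_distrib_left sum_subtractf)
    then show ?thesis using insert.hyps by (simp add: algebra_simps)
  qed
  then have 0: "b x * (w x - w z) = 0" if "x \<in> F" for x
    using insert.IH[of M' "\<lambda>x. b x * (w x - w z)" x] that insert.prems insert.hyps M by auto
  then have F: "b x = 0" if "x \<in> F" for x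
  proof -
    have "w x \<noteq> w z" using inj_onD[OF insert.prems(1), of x z] insert.hyps(2) that by auto
    with 0[OF that] show ?thesis by simp
  qed
  moreover have "b z = 0" using insert.prems(3)[of 0] insert.hyps F M by simp
  ultimately show ?case using insert.prems(4) by blast
qed simp


section \<open>Recognising a single leading term\<close>

text \<open>Along the curve \<open>y \<mapsto> (z\<^sub>i\<^sup>s y\<^bsup>c\<^sub>i\<^esup>)\<^sub>i\<close> the monomial \<open>x\<^sup>e\<close> becomes \<open>W e\<^sup>s y\<^bsup>L e\<^esup>\<close>.\<close>

locale leading_terms =
  fixes G :: "'l set" and E :: "'l \<Rightarrow> 'e set" and c :: "'l \<Rightarrow> 'e \<Rightarrow> int" and lead :: "'l \<Rightarrow> 'e"
    and a :: "'l \<Rightarrow> int" and W :: "'e \<Rightarrow> nat" and L :: "'e \<Rightarrow> nat" and m D :: nat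
  assumes fin: "finite G" "\<And>l. l \<in> G \<Longrightarrow> finite (E l)"
    and card: "card G \<le> m"
    and a: "\<And>l. l \<in> G \<Longrightarrow> a l \<noteq> 0"
    and lead: "\<And>l. l \<in> G \<Longrightarrow> lead l \<in> E l" "\<And>l. l \<in> G \<Longrightarrow> c l (lead l) = 1"
    and less: "\<And>l e. l \<in> G \<Longrightarrow> e \<in> E l \<Longrightarrow> e \<noteq> lead l \<Longrightarrow> L e < L (lead l)"
    and D: "\<And>l. l \<in> G \<Longrightarrow> L (lead l) \<le> D"
    and W: "inj_on (\<lambda>l. W (lead l)) G" "\<And>l. l \<in> G \<Longrightarrow> W (lead l) > 0"
begin

definition curve :: "nat \<Rightarrow> nat \<Rightarrow> int" where
  "curve s y = (\<Sum>l\<in>G. a l * (\<Sum>e\<in>E l. c l e * int (W e ^ s * y ^ L e)))"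

definition face :: "nat \<Rightarrow> 'l set" where
  "face \<delta> = {l \<in> G. L (lead l) = \<delta>}"

text \<open>With k at least every leading weight, all other exponents have weight below k and are
  annihilated. A leading exponent survives only at weight exactly k, and its coefficient in t_l is
  1.\<close>

lemma fdiff_curve:
  assumes "\<And>l. l \<in> G \<Longrightarrow> L (lead l) \<le> k"
  shows "fdiff k (curve s) y = fact k * (\<Sum>l\<in>face k. a l * int (W (lead l)) ^ s)"
proof -
  have "fdiff k (curve s) y =
    (\<Sum>l\<in>G. a l * (\<Sum>e\<in>E l. (c l e * int (W e) ^ s) * fdiff k (\<lambda>y. int y ^ L e) y))"
    unfolding curve_def fdiff_sum[symmetric] by (simp add: mult.assoc)
  also have "\<dots> = (\<Sum>l\<in>G. a l * (if L (lead l) = k then fact k * int (W (lead l)) ^ s else 0))"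
  proof (intro sum.cong refl arg_cong2[of _ _ _ _ "(*)"])
    fix l assume l: "l \<in> G"
    have "(\<Sum>e\<in>E l. (c l e * int (W e) ^ s) * fdiff k (\<lambda>y. int y ^ L e) y) =
      (\<Sum>e\<in>E l. if e = lead l then (if L (lead l) = k then fact k * int (W (lead l)) ^ s else 0) else 0)"
    proof (intro sum.cong refl)
      fix e assume e: "e \<in> E l"
      have "L e \<le> k" using assms[OF l] less[OF l e] by (cases "e = lead l") auto
      then show "(c l e * int (W e) ^ s) * fdiff k (\<lambda>y. int y ^ L e) y =
        (if e = lead l then (if L (lead l) = k then fact k * int (W (lead l)) ^ s else 0) else 0)"
        using fdiff_power[of "L e" k y] lead(2)[OF l] less[OF l e] assms[OF l] by auto
    qed
    also have "\<dots> = (if L (lead l) = k then fact k * int (W (lead l)) ^ s else 0)"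
      using fin(2)[OF l] lead(1)[OF l] by simp
    finally show "(\<Sum>e\<in>E l. (c l e * int (W e) ^ s) * fdiff k (\<lambda>y. int y ^ L e) y) = \<dots>" .
  qed
  also have "\<dots> = (\<Sum>l\<in>face k. a l * (fact k * int (W (lead l)) ^ s))"
    unfolding face_def using fin(1) by (simp add: sum.inter_filter if_distrib cong: if_cong)
  finally show ?thesis by (simp add: sum_distrib_left ac_simps)
qed

lemma fdiff_curve_0:
  assumes "\<And>l. l \<in> G \<Longrightarrow> L (lead l) < k"
  shows "fdiff k (curve s) y = 0"
proof -
  have "face k = {}" using assms by (force simp: face_def)
  moreover have "L (lead l) \<le> k" if "l \<in> G" for l using assms[OF that] by simp
  ultimately show ?thesis using fdiff_curve[of k s y] by simp
qed

lemma finite_face: "finite (face \<delta>)"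
  using fin by (simp add: face_def)

lemma face_vandermonde:
  assumes "\<And>s. s < m \<Longrightarrow> (\<Sum>l\<in>face \<delta>. b l * int (W (lead l)) ^ s) = 0" "l \<in> face \<delta>"
  shows "b l = 0"
proof (rule vandermonde[OF finite_face _ _ assms])
  show "inj_on (\<lambda>l. int (W (lead l))) (face \<delta>)"
    using W(1) unfolding inj_on_def face_def by auto
  have "card (face \<delta>) \<le> card G" using fin by (intro card_mono) (auto simp: face_def)
  with card show "card (face \<delta>) \<le> m" by simp
qed

definition top :: "nat \<Rightarrow> nat \<times> int" where
  "top s = top_diff D (curve s) (Suc D)"

text \<open>Equal degrees are demanded because a leading coefficient that vanishes for some s would
  show up as a smaller degree. The geometric progression is stated by cross-multiplication, without
  division. With m + 2 curves the one for s = 1 exists even for m = 0.\<close>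

definition isolated :: bool where
  "isolated \<longleftrightarrow> snd (top 0) \<noteq> 0 \<and> (\<forall>s<m + 2. fst (top s) = fst (top 0)) \<and>
     (\<forall>s<m + 1. snd (top (Suc s)) * snd (top 0) = snd (top s) * snd (top 1))"

definition max_weight :: nat where
  "max_weight = Max ((\<lambda>l. L (lead l)) ` G)"

lemma max_weight:
  assumes "G \<noteq> {}"
  shows "\<And>l. l \<in> G \<Longrightarrow> L (lead l) \<le> max_weight" "face max_weight \<noteq> {}" "max_weight \<le> D"
proof -
  have "max_weight \<in> (\<lambda>l. L (lead l)) ` G"
    unfolding max_weight_def using assms fin by (intro Max_in) auto
  then show "face max_weight \<noteq> {}" "max_weight \<le> D" using D by (auto simp: face_def)
  show "L (lead l) \<le> max_weight" if "l \<in> G" for l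
    unfolding max_weight_def using that fin by (intro Max_ge) auto
qed

text \<open>Let t0, t1 be the leading coefficients for s = 0, 1. The progression makes the sums of
  a_l (W_l t0 - t1) W_l^s over the face vanish for s < m. By Vandermonde every W_l on the face
  equals t1 / t0, and injectivity of W leaves a single l.\<close>

theorem isolated_sound:
  assumes isolated
  shows "\<exists>l\<in>G. snd (top 0) = fact (D - fst (top 0)) * a l \<and>
    snd (top 1) = snd (top 0) * int (W (lead l))"
proof -
  have ne: "snd (top 0) \<noteq> 0" and deg: "\<And>s. s < m + 2 \<Longrightarrow> fst (top s) = fst (top 0)"
    and rat: "\<And>s. s < m + 1 \<Longrightarrow> snd (top (Suc s)) * snd (top 0) = snd (top s) * snd (top 1)"
    using assms unfolding isolated_def by blast+
  define \<delta> where "\<delta> = D - fst (top 0)"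
  have top: "snd (top s) = fdiff \<delta> (curve s) 0" "\<And>k. \<delta> < k \<Longrightarrow> k \<le> D \<Longrightarrow> fdiff k (curve s) 0 = 0"
    if "s < m + 2" for s
  proof -
    have "top_diff D (curve s) (Suc D) = (fst (top s), snd (top s))" by (simp only: top_def prod.collapse)
    also have "fst (top s) = fst (top 0)" by (rule deg[OF that])
    finally have "top_diff D (curve s) (Suc D) = (fst (top 0), snd (top s))" .
    from top_diff[OF this] show "snd (top s) = fdiff \<delta> (curve s) 0"
      "\<And>k. \<delta> < k \<Longrightarrow> k \<le> D \<Longrightarrow> fdiff k (curve s) 0 = 0"
      unfolding \<delta>_def by auto
  qed
  have ne': "fdiff \<delta> (curve 0) 0 \<noteq> 0" using ne top(1)[of 0] by (simp only:) simp
  have G: "G \<noteq> {}"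
  proof
    assume "G = {}"
    then have "fdiff \<delta> (curve 0) 0 = 0" by (intro fdiff_curve_0) blast
    with ne' show False by blast
  qed
  note mw = max_weight[OF G]
  have \<delta>: "\<delta> = max_weight"
  proof (rule antisym)
    show "\<delta> \<le> max_weight"
    proof (rule ccontr)
      assume "\<not> ?thesis"
      with mw(1) have "fdiff \<delta> (curve 0) 0 = 0" by (intro fdiff_curve_0) fastforce
      with ne' show False by blast
    qed
    \<comment> \<open>A smaller common degree would mean that the face of maximal weight contributes
      0 for every s < m, which Vandermonde excludes since the a_l are nonzero.\<close>
    show "max_weight \<le> \<delta>"
    proof (rule ccontr)
      assume "\<not> ?thesis"
      then have "fdiff max_weight (curve s) 0 = 0" if "s < m" for s
        using top(2)[of s max_weight] mw(3) that by linarith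
      then have "(\<Sum>l\<in>face max_weight. a l * int (W (lead l)) ^ s) = 0" if "s < m" for s
        using fdiff_curve[OF mw(1), of s 0] that by simp
      then have "a l = 0" if "l \<in> face max_weight" for l by (rule face_vandermonde[OF _ that])
      moreover obtain l where "l \<in> face max_weight" using mw(2) by blast
      ultimately show False using a[of l] by (simp add: face_def)
    qed
  qed
  define S where "S s = (\<Sum>l\<in>face \<delta>. a l * int (W (lead l)) ^ s)" for s
  have top': "snd (top s) = fact \<delta> * S s" if "s < m + 2" for s
    unfolding S_def top(1)[OF that] by (rule fdiff_curve) (unfold \<delta>, rule mw(1))
  have "(\<Sum>l\<in>face \<delta>. (a l * (int (W (lead l)) * snd (top 0) - snd (top 1))) * int (W (lead l)) ^ s) = 0"
    if "s < m" for s
  proof -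
    have "(\<Sum>l\<in>face \<delta>. (a l * (int (W (lead l)) * t - t')) * int (W (lead l)) ^ s) = S (Suc s) * t - S s * t'" for t t'
      unfolding S_def by (simp add: algebra_simps sum_distrib_left sum_subtractf)
    moreover have "fact \<delta> * (S (Suc s) * snd (top 0) - S s * snd (top 1)) = 0"
      using rat[of s] that top'[of s] top'[of "Suc s"] by (simp add: right_diff_distrib mult.assoc)
    ultimately show ?thesis by simp
  qed
  then have eq: "int (W (lead l)) * snd (top 0) = snd (top 1)" if "l \<in> face \<delta>" for l
    using face_vandermonde[where b = "\<lambda>l. a l * (int (W (lead l)) * snd (top 0) - snd (top 1))", OF _ that]
      that a[of l] by (simp add: face_def)
  obtain l where l: "l \<in> face \<delta>" using mw(2) \<delta> by blast
  have "l' = l" if "l' \<in> face \<delta>" for l'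
  proof -
    have "int (W (lead l')) * snd (top 0) = int (W (lead l)) * snd (top 0)"
      unfolding eq[OF l] eq[OF that] ..
    then have "W (lead l') = W (lead l)" using ne by simp
    moreover have "l' \<in> G" "l \<in> G" using that l by (simp_all add: face_def)
    ultimately show ?thesis by (rule inj_onD[OF W(1)])
  qed
  with l have "face \<delta> = {l}" by blast
  then have "snd (top 0) = fact \<delta> * a l" using top'[of 0] by (simp add: S_def)
  moreover have "l \<in> G" using l by (simp add: face_def)
  ultimately show ?thesis using eq[OF l] unfolding \<delta>_def by (metis mult.commute)
qed

text \<open>For a singleton face the leading coefficient is a_l W_l^s up to a factorial. As W_l > 0
  it is nonzero for every s, so no curve loses degree.\<close>

theorem isolated_complete:
  assumes "G \<noteq> {}" "inj_on (\<lambda>l. L (lead l)) G"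
  shows isolated
proof -
  note mw = max_weight[OF assms(1)]
  obtain l where l: "l \<in> face max_weight" using mw(2) by auto
  then have "face max_weight = {l}" using assms(2) by (auto simp: face_def inj_on_def)
  then have f: "fdiff max_weight (curve s) 0 = fact max_weight * (a l * int (W (lead l)) ^ s)" for s
    using fdiff_curve[OF mw(1)] by simp
  have z: "fdiff k (curve s) 0 = 0" if "max_weight < k" for k s
    using fdiff_curve_0 mw(1) that by (meson le_less_trans)
  have al: "a l \<noteq> 0" using a l by (simp add: face_def)
  have Wl: "W (lead l) \<noteq> 0" using W(2) l by (simp add: face_def)
  have "top s = (D - max_weight, fact max_weight * (a l * int (W (lead l)) ^ s))" for s
    unfolding top_def using top_diff_eqI[OF mw(3) _ z] f al Wl by simp
  then show ?thesis unfolding isolated_def using al Wl by simp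
qed

end


section \<open>Recovering an exponent from a product of pairwise coprime bases\<close>

text \<open>The moduli of Goedel's beta function: pairwise coprime for indices below n and explicit,
  so no primes have to be found.\<close>

definition base :: "nat \<Rightarrow> nat \<Rightarrow> nat" where
  "base n i = 1 + (i + 1) * fact n"

text \<open>A common divisor divides the difference (j - i) * n! and is coprime to n!, hence it
  divides j - i, which itself divides n!.\<close>

lemma coprime_base:
  assumes "i < n" "j < n" "i \<noteq> j"
  shows "coprime (base n i) (base n j)"
proof -
  have *: "coprime (base n i) (base n j)" if "i < j" "j < n" for i j
  proof (rule coprimeI)
    fix c assume c: "c dvd base n i" "c dvd base n j"
    have "coprime (fact n) ((i + 1) * fact n + 1 :: nat)"
      unfolding coprime_iff_gcd_eq_1 gcd_add_mult by (rule gcd_1_nat)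
    then have "coprime (base n i) (fact n)"
      unfolding base_def by (subst coprime_commute, subst add.commute)
    then have cop: "coprime c (fact n)" by (rule coprime_divisors[OF c(1) dvd_refl])
    have "base n j = base n i + (j - i) * fact n"
      unfolding base_def distrib_right[symmetric] add.assoc using that by simp
    with c have "c dvd (j - i) * fact n" by (simp only: dvd_add_right_iff)
    then have "c dvd j - i" by (simp only: coprime_dvd_mult_left_iff[OF cop])
    also have "j - i dvd fact n" using that by (intro dvd_fact) auto
    finally show "is_unit c" using cop by (metis coprime_absorb_left)
  qed
  show ?thesis using *[of i j] *[of j i] assms by (cases "i < j") (auto simp: coprime_commute)
qed

lemma base_ge_2: "2 \<le> base n i"
  using mult_le_mono[of 1 "i + 1" 1 "fact n"] fact_ge_1[of n, where 'a = nat] unfolding base_def by linarith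

definition monom_val :: "nat \<Rightarrow> (nat \<Rightarrow> nat) \<Rightarrow> nat" where
  "monom_val n e = (\<Prod>i<n. base n i ^ e i)"

lemma power_dvd_monom_val:
  assumes "i < n"
  shows "base n i ^ k dvd monom_val n e \<longleftrightarrow> k \<le> e i"
proof -
  let ?r = "\<Prod>j\<in>{..<n} - {i}. base n j ^ e j"
  have eq: "monom_val n e = base n i ^ e i * ?r"
    unfolding monom_val_def using assms by (simp add: prod.remove)
  have cop: "coprime (base n i) ?r"
    using assms by (intro prod_coprime_right) (auto intro: coprime_base)
  show ?thesis
  proof
    assume "k \<le> e i"
    then show "base n i ^ k dvd monom_val n e" unfolding eq by (simp add: le_imp_power_dvd)
  next
    assume d: "base n i ^ k dvd monom_val n e"
    then have "base n i ^ k dvd base n i ^ e i"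
      unfolding eq using cop by (subst (asm) coprime_dvd_mult_left_iff) auto
    then show "k \<le> e i" using power_dvd_imp_le base_ge_2[of n i] by simp
  qed
qed

text \<open>The exponent is the number of k < d for which the power k + 1 of the base divides the
  value. The sum is the loop that the program runs.\<close>

lemma exponent_from_monom_val:
  assumes "i < n" "e i \<le> d"
  shows "(\<Sum>k<d. if monom_val n e mod base n i ^ Suc k = 0 then 1 else 0) = int (e i)"
proof -
  have "monom_val n e mod base n i ^ Suc k = 0 \<longleftrightarrow> k < e i" for k
    using power_dvd_monom_val[OF assms(1), of "Suc k" e] by (simp only: dvd_eq_mod_eq_0 Suc_le_eq)
  then have "(\<Sum>k<d. if monom_val n e mod base n i ^ Suc k = 0 then 1 else 0) = (\<Sum>k<d. if k < e i then 1 else (0::int))"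
    by (simp only:)
  also have "\<dots> = int (card {k \<in> {..<d}. k < e i})" by (simp flip: sum.inter_filter)
  also have "{k \<in> {..<d}. k < e i} = {..<e i}" using assms(2) by auto
  finally show ?thesis by simp
qed

lemma monom_val_inject:
  assumes "monom_val n e = monom_val n e'" "i < n"
  shows "e i = e' i"
  using power_dvd_monom_val[OF assms(2)] assms(1) by (metis dual_order.refl le_antisym)


section \<open>Evaluation of integer polynomials\<close>

definition mon :: "exponent \<Rightarrow> (nat \<Rightarrow> int) \<Rightarrow> int" where
  "mon e x = (\<Prod>i\<in>Poly_Mapping.keys e. x i ^ Poly_Mapping.lookup e i)"

lemma eval_poly_superset:
  assumes "finite S" "Poly_Mapping.keys p \<subseteq> S"
  shows "eval_poly p x = (\<Sum>e\<in>S. Poly_Mapping.lookup p e * mon e x)"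
  unfolding eval_poly_def mon_def
  by (rule sum.mono_neutral_left) (use assms in \<open>auto simp: in_keys_iff\<close>)

lemma lookup_int_scale: "Poly_Mapping.lookup (int_scale c p) e = c * Poly_Mapping.lookup p e"
proof -
  have nat: "Poly_Mapping.lookup (of_nat k * p) e = int k * Poly_Mapping.lookup p e" for k p
    by (induction k) (simp_all add: distrib_right lookup_add)
  show ?thesis
  proof (cases c)
    case (nonneg k)
    then show ?thesis using nat[of k p] by (simp add: int_scale_def)
  next
    case (neg k)
    have "int_scale c p = - (of_nat (Suc k) * p)"
      unfolding int_scale_def neg of_int_minus of_int_of_nat_eq by (rule minus_mult_left[symmetric])
    then show ?thesis using nat[of "Suc k" p] neg by (simp only: lookup_uminus)
  qed
qed

text \<open>Monomials may cancel in the combination, so both sides are expanded over the union of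
  the supports before the sums are exchanged.\<close>

lemma eval_poly_combination:
  assumes "finite G"
  shows "eval_poly (\<Sum>l\<in>G. int_scale (a l) (t l)) x = (\<Sum>l\<in>G. a l * eval_poly (t l) x)"
proof -
  let ?S = "\<Union>l\<in>G. Poly_Mapping.keys (t l)"
  have S: "finite ?S" using assms by simp
  have l: "Poly_Mapping.lookup (\<Sum>l\<in>G. int_scale (a l) (t l)) e = (\<Sum>l\<in>G. a l * Poly_Mapping.lookup (t l) e)" for e
    by (simp add: lookup_sum lookup_int_scale)
  have "Poly_Mapping.keys (\<Sum>l\<in>G. int_scale (a l) (t l)) \<subseteq> ?S"
    by (rule subsetI) (fastforce simp: in_keys_iff l intro: ccontr sum.neutral)
  then have "eval_poly (\<Sum>l\<in>G. int_scale (a l) (t l)) x = (\<Sum>e\<in>?S. (\<Sum>l\<in>G. a l * Poly_Mapping.lookup (t l) e) * mon e x)"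
    using eval_poly_superset[OF S] by (simp add: l)
  also have "\<dots> = (\<Sum>l\<in>G. a l * (\<Sum>e\<in>?S. Poly_Mapping.lookup (t l) e * mon e x))"
    by (simp add: sum_distrib_left sum_distrib_right mult.assoc sum.swap[of _ G])
  also have "\<dots> = (\<Sum>l\<in>G. a l * eval_poly (t l) x)"
    by (intro sum.cong refl arg_cong2[of _ _ _ _ "(*)"] eval_poly_superset[symmetric] S) auto
  finally show ?thesis .
qed

lemma mon_eq: "e \<in> exponents n \<Longrightarrow> mon e x = (\<Prod>i<n. x i ^ Poly_Mapping.lookup e i)"
  unfolding mon_def exponents_def by (rule prod.mono_neutral_left) (auto simp: in_keys_iff)

lemma lookup_exponents: "e \<in> exponents n \<Longrightarrow> \<not> i < n \<Longrightarrow> Poly_Mapping.lookup e i = 0"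
  using not_in_keys_iff_lookup_eq_zero[of i e] unfolding exponents_def by blast


section \<open>Friendly instances\<close>

locale friendly_instance =
  fixes n :: nat and \<Lambda> :: "'l set" and t :: "'l \<Rightarrow> int_mpoly" and K :: "'l \<Rightarrow> nat \<Rightarrow> real"
    and A :: "int mat" and lead :: "'l \<Rightarrow> exponent"
    and \<Gamma> :: "'l set" and a :: "'l \<Rightarrow> int" and d m :: nat
  assumes inv: "invertible_01_mat n A"
    and friendly: "friendly_family K n A \<Lambda> t lead"
    and polys: "\<And>l. l \<in> \<Lambda> \<Longrightarrow> t l \<in> polys n"
    and \<Gamma>: "\<Gamma> \<subseteq> \<Lambda>" "finite \<Gamma>" "card \<Gamma> \<le> m"
    and a: "\<And>l. l \<in> \<Gamma> \<Longrightarrow> a l \<noteq> 0"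
    and degree: "total_degree (\<Sum>l\<in>\<Gamma>. int_scale (a l) (t l)) \<le> d"
begin

abbreviation f :: int_mpoly where
  "f \<equiv> \<Sum>l\<in>\<Gamma>. int_scale (a l) (t l)"

definition Anat :: "nat \<Rightarrow> nat \<Rightarrow> nat" where
  "Anat i j = nat (A $$ (i, j))"

lemma A_01: "i < n \<Longrightarrow> j < n \<Longrightarrow> A $$ (i, j) = int (Anat i j)" "i < n \<Longrightarrow> j < n \<Longrightarrow> Anat i j \<le> 1"
proof -
  have "A $$ (i, j) = 0 \<or> A $$ (i, j) = 1" if "i < n" "j < n"
    using inv that unfolding invertible_01_mat_def by blast
  then show "i < n \<Longrightarrow> j < n \<Longrightarrow> A $$ (i, j) = int (Anat i j)" "i < n \<Longrightarrow> j < n \<Longrightarrow> Anat i j \<le> 1"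
    by (auto simp: Anat_def)
qed

lemma A_carrier: "A \<in> carrier_mat n n"
  using inv unfolding invertible_01_mat_def by auto

text \<open>The j-th entry of A^T e. Since <A c', e> = <c', A^T e>, the forms in L_A are the
  combinations of these entries with positive integer weights.\<close>

definition tdeg :: "exponent \<Rightarrow> nat \<Rightarrow> nat" where
  "tdeg e j = (\<Sum>i<n. Anat i j * Poly_Mapping.lookup e i)"

lemma linear_form:
  assumes "\<And>j. j < n \<Longrightarrow> b j > 0"
  shows "(\<lambda>e. int (\<Sum>j<n. tdeg e j * b j)) \<in> linear_forms n A"
proof -
  let ?c = "vec n (\<lambda>j. int (b j))"
  have "int (\<Sum>j<n. tdeg e j * b j) = (A *\<^sub>v ?c) \<bullet> vec n (\<lambda>i. int (Poly_Mapping.lookup e i))" for e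
  proof -
    have "(A *\<^sub>v ?c) \<bullet> vec n (\<lambda>i. int (Poly_Mapping.lookup e i)) =
      (\<Sum>i<n. (\<Sum>j<n. int (Anat i j) * int (b j)) * int (Poly_Mapping.lookup e i))"
      using A_carrier A_01(1) by (simp add: scalar_prod_def atLeast0LessThan)
    also have "\<dots> = (\<Sum>j<n. \<Sum>i<n. int (Anat i j) * int (b j) * int (Poly_Mapping.lookup e i))"
      unfolding sum_distrib_right by (rule sum.swap)
    finally show ?thesis by (simp add: tdeg_def sum_distrib_right sum_distrib_left ac_simps)
  qed
  then show ?thesis unfolding linear_forms_def using assms by (intro CollectI exI[of _ ?c]) auto
qed

text \<open>For u = e - e' the hypothesis says u^T A = 0; multiplying by the rational inverse B
  gives u = 0.\<close>

lemma tdeg_inject: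
  assumes "e \<in> exponents n" "e' \<in> exponents n" "\<And>j. j < n \<Longrightarrow> tdeg e j = tdeg e' j"
  shows "e = e'"
proof -
  let ?A = "map_mat rat_of_int A"
  have AC: "?A \<in> carrier_mat n n" using A_carrier by simp
  obtain B where B: "inverts_mat ?A B" "inverts_mat B ?A"
    using inv unfolding invertible_01_mat_def invertible_mat_def by auto
  have AB: "?A * B = 1\<^sub>m n" using B(1) AC unfolding inverts_mat_def by auto
  have BA: "B * ?A = 1\<^sub>m (dim_row B)" using B(2) unfolding inverts_mat_def by auto
  have BC: "B \<in> carrier_mat n n"
    using arg_cong[OF AB, of dim_col] arg_cong[OF BA, of dim_col] AC by auto
  define u where "u i = rat_of_nat (Poly_Mapping.lookup e i) - rat_of_nat (Poly_Mapping.lookup e' i)" for i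
  have 0: "(\<Sum>i<n. u i * ?A $$ (i, j)) = 0" if "j < n" for j
  proof -
    have *: "(\<Sum>i<n. rat_of_nat (Poly_Mapping.lookup e i) * ?A $$ (i, j)) = rat_of_nat (tdeg e j)" for e
      unfolding tdeg_def using that A_01(1) A_carrier by (simp add: mult.commute)
    show ?thesis unfolding u_def left_diff_distrib sum_subtractf * using assms(3)[OF that] by simp
  qed
  have "u k = 0" if k: "k < n" for k
  proof -
    have "u k = (\<Sum>i<n. u i * (?A * B) $$ (i, k))"
      unfolding AB using k by (simp add: if_distrib cong: if_cong)
    also have "\<dots> = (\<Sum>i<n. \<Sum>j<n. u i * ?A $$ (i, j) * B $$ (j, k))"
      using AC BC k by (simp add: scalar_prod_def atLeast0LessThan sum_distrib_left mult.assoc)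
    also have "\<dots> = (\<Sum>j<n. (\<Sum>i<n. u i * ?A $$ (i, j)) * B $$ (j, k))"
      unfolding sum_distrib_right by (rule sum.swap)
    also have "\<dots> = 0" by (intro sum.neutral ballI) (simp only: 0 lessThan_iff mult_zero_left)
    finally show ?thesis .
  qed
  then have "Poly_Mapping.lookup e i = Poly_Mapping.lookup e' i" if "i < n" for i
    using that by (simp add: u_def)
  moreover have "Poly_Mapping.lookup e i = 0" "Poly_Mapping.lookup e' i = 0" if "\<not> i < n" for i
    using assms(1,2) that unfolding exponents_def by (auto simp: in_keys_iff)
  ultimately show ?thesis by (metis poly_mapping_eqI)
qed

text \<open>If row i were zero, the unit exponent at i and the zero exponent would have the same
  image under A^T.\<close>

lemma ex_column: assumes "i < n" shows "\<exists>j<n. Anat i j = 1"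
proof (rule ccontr)
  assume "\<not> ?thesis"
  then have 0: "Anat i j = 0" if "j < n" for j using A_01(2)[OF assms that] that by (metis le_antisym less_one not_le)
  let ?e = "Poly_Mapping.single i (1::nat)"
  have "?e = 0"
  proof (rule tdeg_inject)
    show "?e \<in> exponents n" "0 \<in> exponents n" using assms by (simp_all add: exponents_def)
    show "tdeg ?e j = tdeg 0 j" if "j < n" for j
      using 0[OF that] by (auto simp: tdeg_def lookup_single when_def)
  qed
  then show False by (metis lookup_single_eq lookup_zero one_neq_zero)
qed

section \<open>Degree bounds for the monomials of the basis elements\<close>

lemma keys_exponents: "l \<in> \<Lambda> \<Longrightarrow> e \<in> Poly_Mapping.keys (t l) \<Longrightarrow> e \<in> exponents n"
  using polys unfolding polys_def by auto

lemma lead_props: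
  assumes "l \<in> \<Lambda>"
  shows "lead l \<in> exponents n" "Poly_Mapping.lookup (t l) (lead l) = 1"
    "lead l \<in> Poly_Mapping.keys (t l)"
  using friendly assms unfolding friendly_family_def compatible_family_def by (auto simp: in_keys_iff)

lemma lead_inject: "l \<in> \<Lambda> \<Longrightarrow> l' \<in> \<Lambda> \<Longrightarrow> lead l = lead l' \<Longrightarrow> l = l'"
  using friendly unfolding friendly_family_def compatible_family_def by blast

lemma lead_less:
  assumes "l \<in> \<Lambda>" "e \<in> Poly_Mapping.keys (t l)" "e \<noteq> lead l" "\<And>j. j < n \<Longrightarrow> b j > 0"
  shows "(\<Sum>j<n. tdeg e j * b j) < (\<Sum>j<n. tdeg (lead l) j * b j)"
proof -
  have "\<forall>L\<in>linear_forms n A. \<forall>e\<in>Poly_Mapping.keys (t l). e \<noteq> lead l \<longrightarrow> L e < L (lead l)"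
    using friendly assms(1) unfolding friendly_family_def compatible_family_def by simp
  from bspec[OF bspec[OF this linear_form[of b, OF assms(4)]] assms(2)] assms(3)
  have "int (\<Sum>j<n. tdeg e j * b j) < int (\<Sum>j<n. tdeg (lead l) j * b j)" by blast
  then show ?thesis by (simp only: of_nat_less_iff)
qed

lemma tdeg_le_lead:
  assumes "l \<in> \<Lambda>" "e \<in> Poly_Mapping.keys (t l)" "j < n"
  shows "tdeg e j \<le> tdeg (lead l) j"
proof (rule ccontr)
  assume less: "\<not> ?thesis"
  \<comment> \<open>N is the sum of all columns of the leading exponent, so with N added to the
    weight of column j a single excess unit there decides the comparison.\<close>
  define N where "N = (\<Sum>j<n. tdeg (lead l) j)"
  let ?b = "\<lambda>j'. 1 + (if j' = j then N else 0)"
  have form: "(\<Sum>j'<n. tdeg e j' * ?b j') = (\<Sum>j'<n. tdeg e j') + tdeg e j * N" for e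
    using assms(3) by (simp add: distrib_left sum.distrib if_distrib[of "(*) _"] cong: if_cong)
  have "(\<Sum>j'<n. tdeg e j' * ?b j') < (\<Sum>j'<n. tdeg (lead l) j' * ?b j')"
    by (rule lead_less[OF assms(1,2)]) (use less in auto)
  then have "tdeg e j * N < N + tdeg (lead l) j * N" unfolding form N_def[symmetric] by simp
  also have "\<dots> = Suc (tdeg (lead l) j) * N" by simp
  also have "\<dots> \<le> tdeg e j * N" using less by (intro mult_right_mono) auto
  finally show False by simp
qed

lemma tdeg_le_degree:
  assumes "e \<in> exponents n" "j < n"
  shows "tdeg e j \<le> (\<Sum>i\<in>Poly_Mapping.keys e. Poly_Mapping.lookup e i)"
proof -
  have "tdeg e j \<le> (\<Sum>i<n. Poly_Mapping.lookup e i)"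
    unfolding tdeg_def
  proof (rule sum_mono)
    fix i assume "i \<in> {..<n}"
    then have "Anat i j \<le> 1" using A_01(2) assms(2) by blast
    from mult_right_mono[OF this] show "Anat i j * Poly_Mapping.lookup e i \<le> Poly_Mapping.lookup e i" by simp
  qed
  also have "\<dots> = (\<Sum>i\<in>Poly_Mapping.keys e. Poly_Mapping.lookup e i)"
    using assms(1) unfolding exponents_def by (intro sum.mono_neutral_right) (auto simp: in_keys_iff)
  finally show ?thesis .
qed

lemma lookup_f: "Poly_Mapping.lookup f e = (\<Sum>l\<in>\<Gamma>. a l * Poly_Mapping.lookup (t l) e)"
  by (simp add: lookup_sum lookup_int_scale)

text \<open>The leading monomial of l itself may cancel in f. Among the leading exponents dominating
  it, choose \<open>lead k\<close> with maximal column sum. Any other t_l' containing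
  \<open>lead k\<close> would have a dominating leading exponent of larger sum, so the coefficient
  of f at \<open>lead k\<close> is a_k, and the degree of f bounds \<open>lead k\<close> and
  whatever it dominates.\<close>

lemma tdeg_lead_le:
  assumes "l \<in> \<Gamma>" "j < n"
  shows "tdeg (lead l) j \<le> d"
proof -
  define M where "M = {l' \<in> \<Gamma>. \<forall>j<n. tdeg (lead l) j \<le> tdeg (lead l') j}"
  define \<sigma> where "\<sigma> l' = (\<Sum>j<n. tdeg (lead l') j * 1)" for l'
  have M: "finite M" "l \<in> M" using \<Gamma> assms by (auto simp: M_def)
  then have "Max (\<sigma> ` M) \<in> \<sigma> ` M" by (intro Max_in) auto
  then obtain k where k: "k \<in> M" "\<sigma> k = Max (\<sigma> ` M)" by auto
  have max: "\<sigma> l' \<le> \<sigma> k" if "l' \<in> M" for l' using that M k(2) by simp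
  have k\<Gamma>: "k \<in> \<Gamma>" "k \<in> \<Lambda>" using k(1) \<Gamma> by (auto simp: M_def)
  have 0: "Poly_Mapping.lookup (t l') (lead k) = 0" if l': "l' \<in> \<Gamma>" "l' \<noteq> k" for l'
  proof (rule ccontr)
    assume "\<not> ?thesis"
    then have key: "lead k \<in> Poly_Mapping.keys (t l')" by (simp add: in_keys_iff)
    have l'\<Lambda>: "l' \<in> \<Lambda>" using l' \<Gamma> by auto
    have "lead k \<noteq> lead l'" using lead_inject[OF k\<Gamma>(2) l'\<Lambda>] l'(2) by auto
    then have "\<sigma> k < \<sigma> l'" unfolding \<sigma>_def by (intro lead_less[OF l'\<Lambda> key]) auto
    moreover have "l' \<in> M" using k(1) l' tdeg_le_lead[OF l'\<Lambda> key] unfolding M_def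
      by (auto intro: order_trans)
    ultimately show False using max by fastforce
  qed
  have "Poly_Mapping.lookup f (lead k) = (\<Sum>l'\<in>\<Gamma>. if l' = k then a k else 0)"
    unfolding lookup_f by (intro sum.cong refl) (use 0 lead_props(2)[OF k\<Gamma>(2)] in auto)
  then have "lead k \<in> Poly_Mapping.keys f" using \<Gamma> k\<Gamma> a by (simp add: in_keys_iff)
  then have "(\<Sum>i\<in>Poly_Mapping.keys (lead k). Poly_Mapping.lookup (lead k) i) \<le> total_degree f"
    unfolding total_degree_def by (intro Max_ge) auto
  with degree tdeg_le_degree[OF lead_props(1)[OF k\<Gamma>(2)] assms(2)] have "tdeg (lead k) j \<le> d" by linarith
  then show ?thesis using k(1) assms(2) by (auto simp: M_def intro: order_trans)
qed

lemma tdeg_le: "l \<in> \<Gamma> \<Longrightarrow> e \<in> Poly_Mapping.keys (t l) \<Longrightarrow> j < n \<Longrightarrow> tdeg e j \<le> d"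
  using tdeg_le_lead[of l e j] tdeg_lead_le[of l j] \<Gamma> by fastforce

text \<open>Row i of A has an entry 1 in some column j, so the i-th exponent is a summand of
  \<open>tdeg e j\<close>.\<close>

lemma lookup_le:
  assumes "l \<in> \<Gamma>" "e \<in> Poly_Mapping.keys (t l)"
  shows "Poly_Mapping.lookup e i \<le> d"
proof (cases "i < n")
  case True
  then obtain j where j: "j < n" "Anat i j = 1" using ex_column by auto
  have "Poly_Mapping.lookup e i = Anat i j * Poly_Mapping.lookup e i" using j by simp
  also have "\<dots> \<le> tdeg e j" unfolding tdeg_def using True by (intro member_le_sum) auto
  finally show ?thesis using tdeg_le[OF assms j(1)] by simp
next
  case False
  have "e \<in> exponents n" using keys_exponents assms \<Gamma> by auto
  then show ?thesis using False by (simp add: lookup_exponents)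
qed

section \<open>Curves and the test of a candidate q\<close>

definition cexp :: "nat \<Rightarrow> nat \<Rightarrow> nat" where
  "cexp q i = (\<Sum>j<n. Anat i j * weight d q j)"

text \<open>The numbers \<open>cexp q i\<close> are the entries of A c' for the weights c'. All
  coordinates are natural numbers, so the basis oracle accepts the point.\<close>

definition point :: "nat \<Rightarrow> nat \<Rightarrow> nat \<Rightarrow> nat list" where
  "point q s y = map (\<lambda>i. base n i ^ s * y ^ cexp q i) [0..<n]"

definition Lw :: "nat \<Rightarrow> exponent \<Rightarrow> nat" where
  "Lw q e = (\<Sum>j<n. tdeg e j * weight d q j)"

lemma mon_point:
  assumes "e \<in> exponents n"
  shows "mon e (\<lambda>i. int (point q s y ! i)) = int (monom_val n (Poly_Mapping.lookup e) ^ s * y ^ Lw q e)"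
proof -
  have "(\<Sum>i<n. cexp q i * Poly_Mapping.lookup e i) = Lw q e"
    unfolding cexp_def Lw_def tdeg_def sum_distrib_right
    by (subst sum.swap) (simp add: ac_simps)
  then have "y ^ Lw q e = (\<Prod>i<n. y ^ (cexp q i * Poly_Mapping.lookup e i))"
    by (simp only: power_sum[symmetric])
  moreover have "mon e (\<lambda>i. int (point q s y ! i)) =
      int (\<Prod>i<n. (base n i ^ s * y ^ cexp q i) ^ Poly_Mapping.lookup e i)"
    unfolding mon_eq[OF assms] point_def by simp
  ultimately show ?thesis
    by (simp add: monom_val_def power_mult_distrib prod.distrib prod_power_distrib power_mult[symmetric] mult.commute)
qed

definition Q :: nat where "Q = 2 * (m * m * n * d + 1)"

text \<open>Bounds the weight of a leading exponent: n columns, entries of A^T e at most d, weights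
  at most 2 Q.\<close>

definition D :: nat where "D = 2 * Q * n * d"

definition resid :: "'l set \<Rightarrow> nat \<Rightarrow> nat \<Rightarrow> nat \<Rightarrow> int" where
  "resid S q s y = (\<Sum>l\<in>S. a l * eval_poly (t l) (\<lambda>i. int (point q s y ! i)))"

definition tp :: "'l set \<Rightarrow> nat \<Rightarrow> nat \<Rightarrow> nat \<times> int" where
  "tp S q s = top_diff D (resid S q s) (Suc D)"

text \<open>The condition \<open>isolated\<close> as a total function of S and q, which the program
  can refer to; \<open>test_eq\<close> identifies the two for S within \<Gamma> and q in
  range.\<close>

definition test :: "'l set \<Rightarrow> nat \<Rightarrow> bool" where
  "test S q \<longleftrightarrow> snd (tp S q 0) \<noteq> 0 \<and> (\<forall>s<m + 2. fst (tp S q s) = fst (tp S q 0)) \<and>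
     (\<forall>s<m + 1. snd (tp S q (Suc s)) * snd (tp S q 0) = snd (tp S q s) * snd (tp S q 1))"

lemma lead_lookup_inject:
  assumes "l \<in> \<Lambda>" "l' \<in> \<Lambda>"
    and "\<And>i. i < n \<Longrightarrow> Poly_Mapping.lookup (lead l) i = Poly_Mapping.lookup (lead l') i"
  shows "l = l'"
proof (rule lead_inject[OF assms(1,2)], rule poly_mapping_eqI)
  fix i
  show "Poly_Mapping.lookup (lead l) i = Poly_Mapping.lookup (lead l') i"
    using lead_props(1)[OF assms(1)] lead_props(1)[OF assms(2)] assms(3)[of i]
    by (cases "i < n") (simp_all add: lookup_exponents)
qed

lemma leading_terms:
  assumes S: "S \<subseteq> \<Gamma>" and q: "1 \<le> q" "q \<le> Q"
  shows "leading_terms S (\<lambda>l. Poly_Mapping.keys (t l)) (\<lambda>l. Poly_Mapping.lookup (t l)) lead a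
    (\<lambda>e. monom_val n (Poly_Mapping.lookup e)) (Lw q) m D"
proof
  have S\<Lambda>: "l \<in> \<Lambda>" if "l \<in> S" for l using that S \<Gamma> by auto
  show "finite S" using S \<Gamma> finite_subset by blast
  show "card S \<le> m" using card_mono[OF \<Gamma>(2) S] \<Gamma>(3) by simp
  show "a l \<noteq> 0" if "l \<in> S" for l using a that S by auto
  show "lead l \<in> Poly_Mapping.keys (t l)" "Poly_Mapping.lookup (t l) (lead l) = 1" if "l \<in> S" for l
    using lead_props S\<Lambda>[OF that] by auto
  have w: "0 < weight d q j" "weight d q j \<le> 2 * Q" for j
  proof -
    have "(d + 1) ^ j mod q < q" using q by simp
    then show "0 < weight d q j" "weight d q j \<le> 2 * Q" using q unfolding weight_def by linarith+
  qed
  show "Lw q e < Lw q (lead l)" if "l \<in> S" "e \<in> Poly_Mapping.keys (t l)" "e \<noteq> lead l" for l e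
    unfolding Lw_def by (rule lead_less[OF S\<Lambda>[OF that(1)] that(2,3) w(1)])
  show "Lw q (lead l) \<le> D" if "l \<in> S" for l
  proof -
    have "Lw q (lead l) \<le> (\<Sum>j<n. d * (2 * Q))"
      unfolding Lw_def using that S by (intro sum_mono mult_le_mono tdeg_lead_le w) auto
    then show ?thesis by (simp add: D_def ac_simps)
  qed
  show "inj_on (\<lambda>l. monom_val n (Poly_Mapping.lookup (lead l))) S"
    using lead_lookup_inject monom_val_inject S\<Lambda> by (intro inj_onI) blast
  show "0 < monom_val n (Poly_Mapping.lookup (lead l))" for l
    unfolding monom_val_def using base_ge_2[of n] by (intro prod_pos) (simp add: zero_less_power less_le_trans[OF _ base_ge_2])
qed (use finite_keys in simp)

lemma curve_eq:
  assumes "S \<subseteq> \<Gamma>" "1 \<le> q" "q \<le> Q"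
  shows "leading_terms.curve S (\<lambda>l. Poly_Mapping.keys (t l)) (\<lambda>l. Poly_Mapping.lookup (t l)) a
    (\<lambda>e. monom_val n (Poly_Mapping.lookup e)) (Lw q) = resid S q"
proof (intro ext)
  fix s y
  have "eval_poly (t l) (\<lambda>i. int (point q s y ! i)) = (\<Sum>e\<in>Poly_Mapping.keys (t l).
    Poly_Mapping.lookup (t l) e * int (monom_val n (Poly_Mapping.lookup e) ^ s * y ^ Lw q e))" if "l \<in> S" for l
    unfolding eval_poly_superset[OF finite_keys order_refl]
    using assms(1) \<Gamma>(1) that by (intro sum.cong refl) (use mon_point keys_exponents in auto)
  then show "leading_terms.curve S (\<lambda>l. Poly_Mapping.keys (t l)) (\<lambda>l. Poly_Mapping.lookup (t l)) a
    (\<lambda>e. monom_val n (Poly_Mapping.lookup e)) (Lw q) s y = resid S q s y"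
    unfolding leading_terms.curve_def[OF leading_terms[OF assms]] resid_def by simp
qed

lemma tp_eq:
  assumes "S \<subseteq> \<Gamma>" "1 \<le> q" "q \<le> Q"
  shows "leading_terms.top S (\<lambda>l. Poly_Mapping.keys (t l)) (\<lambda>l. Poly_Mapping.lookup (t l)) a
    (\<lambda>e. monom_val n (Poly_Mapping.lookup e)) (Lw q) D = tp S q"
  by (rule ext) (simp only: leading_terms.top_def[OF leading_terms[OF assms]] curve_eq[OF assms] tp_def)

lemma test_eq:
  assumes "S \<subseteq> \<Gamma>" "1 \<le> q" "q \<le> Q"
  shows "leading_terms.isolated S (\<lambda>l. Poly_Mapping.keys (t l)) (\<lambda>l. Poly_Mapping.lookup (t l)) a
    (\<lambda>e. monom_val n (Poly_Mapping.lookup e)) (Lw q) m D = test S q"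
  unfolding leading_terms.isolated_def[OF leading_terms[OF assms]] tp_eq[OF assms] test_def ..

lemma test_sound:
  assumes "S \<subseteq> \<Gamma>" "1 \<le> q" "q \<le> Q" "test S q"
  shows "\<exists>l\<in>S. snd (tp S q 0) = fact (D - fst (tp S q 0)) * a l \<and>
    snd (tp S q 1) = snd (tp S q 0) * int (monom_val n (Poly_Mapping.lookup (lead l)))"
  using leading_terms.isolated_sound[OF leading_terms[OF assms(1-3)]] assms(4)
  unfolding tp_eq[OF assms(1-3)] test_eq[OF assms(1-3)] by blast

lemma test_complete:
  assumes "S \<subseteq> \<Gamma>" "S \<noteq> {}"
  shows "\<exists>q. 1 \<le> q \<and> q \<le> Q \<and> test S q"
proof -
  \<comment> \<open>Cut off to 0 from n on, so that vectors agreeing below n are equal as functions,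
    as separation on a set of functions requires.\<close>
  define v where "v l j = (if j < n then tdeg (lead l) j else 0)" for l j
  have S: "finite S" "card S \<le> m" "S \<subseteq> \<Lambda>"
    using assms(1) \<Gamma> finite_subset card_mono[OF \<Gamma>(2) assms(1)] by auto
  have v_inj: "l = l'" if "l \<in> S" "l' \<in> S" "v l = v l'" for l l'
  proof (rule lead_inject)
    show l: "l \<in> \<Lambda>" "l' \<in> \<Lambda>" using that S by auto
    show "lead l = lead l'"
      using that(3) by (intro tdeg_inject lead_props l) (metis v_def)
  qed
  have "\<exists>q. 1 \<le> q \<and> q \<le> 2 * (m * m * n * d + 1) \<and> inj_on (\<lambda>v. \<Sum>j<n. v j * weight d q j) (v ` S)"
  proof (rule exists_separating_weight)
    show "finite (v ` S)" using S by simp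
    show "card (v ` S) \<le> m" using S card_image_le order_trans by blast
    show "u j \<le> d" if "u \<in> v ` S" "j < n" for u j
      using that tdeg_lead_le assms(1) by (auto simp: v_def)
    show "\<exists>j<n. u j \<noteq> w j" if "u \<in> v ` S" "w \<in> v ` S" "u \<noteq> w" for u w
    proof (rule ccontr)
      assume "\<not> ?thesis"
      then have "u = w" using that(1,2) by (intro ext) (auto simp: v_def)
      with that(3) show False by simp
    qed
  qed
  then obtain q where q: "1 \<le> q" "q \<le> Q" "inj_on (\<lambda>v. \<Sum>j<n. v j * weight d q j) (v ` S)"
    unfolding Q_def by blast
  have Lv: "Lw q (lead l) = (\<Sum>j<n. v l j * weight d q j)" for l by (simp add: Lw_def v_def)
  have "inj_on (\<lambda>l. Lw q (lead l)) S"
  proof (rule inj_onI)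
    fix l l' assume l: "l \<in> S" "l' \<in> S" "Lw q (lead l) = Lw q (lead l')"
    then have "v l = v l'" using inj_onD[OF q(3), of "v l" "v l'"] unfolding Lv by blast
    then show "l = l'" by (rule v_inj[OF l(1,2)])
  qed
  then have "test S q"
    using leading_terms.isolated_complete[OF leading_terms[OF assms(1) q(1,2)] assms(2)]
    unfolding test_eq[OF assms(1) q(1,2)] by blast
  with q show ?thesis by blast
qed

section \<open>Bit sizes of polynomial values\<close>

lemma card_keys:
  assumes "l \<in> \<Gamma>" shows "card (Poly_Mapping.keys (t l)) \<le> 2 ^ (n * d)"
proof -
  let ?r = "\<lambda>e. restrict (Poly_Mapping.lookup e) {..<n}"
  have "inj_on ?r (exponents n)"
  proof (intro inj_onI poly_mapping_eqI)
    fix e e' i assume e: "e \<in> exponents n" "e' \<in> exponents n" "?r e = ?r e'"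
    show "Poly_Mapping.lookup e i = Poly_Mapping.lookup e' i"
    proof (cases "i < n")
      case True
      then show ?thesis using fun_cong[OF e(3), of i] by simp
    next
      case False
      then show ?thesis using e(1,2) by (simp add: lookup_exponents)
    qed
  qed
  then have inj: "inj_on ?r (Poly_Mapping.keys (t l))"
    by (rule inj_on_subset) (use keys_exponents assms \<Gamma> in auto)
  have "card (Poly_Mapping.keys (t l)) \<le> card ({..<n} \<rightarrow>\<^sub>E {..d})"
  proof (rule card_inj_on_le[OF inj])
    show "?r ` Poly_Mapping.keys (t l) \<subseteq> {..<n} \<rightarrow>\<^sub>E {..d}"
      by (intro image_subsetI) (simp only: restrict_PiE_iff atMost_iff lookup_le[OF assms] ball_triv simp_thms)
  qed (simp add: finite_PiE)
  also have "\<dots> = (d + 1) ^ n" by (simp add: card_PiE)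
  also have "\<dots> \<le> (2 ^ d) ^ n" by (intro power_mono) (simp_all add: Suc_le_eq)
  finally show ?thesis by (simp add: mult.commute flip: power_mult)
qed

text \<open>The number of monomials may be exponential, but being at most 2^(n d) it adds only n d
  bits to the value.\<close>

lemma eval_poly_bound:
  assumes l: "l \<in> \<Gamma>" and K: "K l n \<le> 2 ^ \<kappa>" and x: "\<And>i. i < n \<Longrightarrow> \<bar>x i\<bar> \<le> 2 ^ b"
  shows "\<bar>eval_poly (t l) x\<bar> \<le> 2 ^ (\<kappa> + n * d + b * (n * d))"
proof -
  have l\<Lambda>: "l \<in> \<Lambda>" using l \<Gamma> by auto
  have abs_prod: "\<bar>\<Prod>i<k. g i\<bar> = (\<Prod>i<k. \<bar>g i\<bar>)" for g :: "nat \<Rightarrow> int" and k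
    by (induction k) (simp_all add: abs_mult)
  have mon: "\<bar>mon e x\<bar> \<le> 2 ^ (b * (n * d))" if e: "e \<in> Poly_Mapping.keys (t l)" for e
  proof -
    have "\<bar>mon e x\<bar> = (\<Prod>i<n. \<bar>x i\<bar> ^ Poly_Mapping.lookup e i)"
      unfolding mon_eq[OF keys_exponents[OF l\<Lambda> e]] by (simp add: abs_prod power_abs)
    also have "\<dots> \<le> (\<Prod>i<n. (2 ^ b) ^ d)"
    proof (rule prod_mono)
      fix i assume i: "i \<in> {..<n}"
      have "\<bar>x i\<bar> ^ Poly_Mapping.lookup e i \<le> (2 ^ b) ^ Poly_Mapping.lookup e i"
        using x i by (intro power_mono) auto
      also have "\<dots> \<le> (2 ^ b) ^ d" using lookup_le[OF l e] by (intro power_increasing) auto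
      finally show "0 \<le> \<bar>x i\<bar> ^ Poly_Mapping.lookup e i \<and> \<bar>x i\<bar> ^ Poly_Mapping.lookup e i \<le> (2 ^ b) ^ d"
        by simp
    qed
    also have "\<dots> = 2 ^ (b * (n * d))" by (simp add: ac_simps flip: power_mult)
    finally show ?thesis .
  qed
  have coeff: "\<bar>Poly_Mapping.lookup (t l) e\<bar> \<le> 2 ^ \<kappa>" for e
  proof -
    have "\<bar>real_of_int (Poly_Mapping.lookup (t l) e)\<bar> \<le> 2 ^ \<kappa>"
      using friendly l\<Lambda> K unfolding friendly_family_def bounded_family_def by (meson order_trans)
    then have "real_of_int \<bar>Poly_Mapping.lookup (t l) e\<bar> \<le> real_of_int (2 ^ \<kappa>)" by simp
    then show ?thesis by (simp only: of_int_le_iff)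
  qed
  have "\<bar>eval_poly (t l) x\<bar> \<le> (\<Sum>e\<in>Poly_Mapping.keys (t l). \<bar>Poly_Mapping.lookup (t l) e * mon e x\<bar>)"
    unfolding eval_poly_superset[OF finite_keys order_refl] by (rule sum_abs)
  also have "\<dots> \<le> of_nat (card (Poly_Mapping.keys (t l))) * (2 ^ \<kappa> * 2 ^ (b * (n * d)))"
    by (rule sum_bounded_above) (use coeff mon in \<open>auto simp: abs_mult intro!: mult_mono\<close>)
  also have "\<dots> \<le> 2 ^ (n * d) * (2 ^ \<kappa> * 2 ^ (b * (n * d)))"
    using of_nat_mono[OF card_keys[OF l], where 'a = int] by (intro mult_right_mono) auto
  finally show ?thesis by (simp add: power_add ac_simps)
qed

lemma eval_f_bound:
  assumes K: "\<And>l. l \<in> \<Gamma> \<Longrightarrow> K l n \<le> 2 ^ \<kappa>" and \<sigma>: "(\<Sum>l\<in>\<Gamma>. \<bar>a l\<bar>) \<le> 2 ^ \<sigma>"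
    and x: "\<And>i. i < n \<Longrightarrow> \<bar>x i\<bar> \<le> 2 ^ b"
  shows "\<bar>eval_poly f x\<bar> \<le> 2 ^ (\<sigma> + \<kappa> + n * d + b * (n * d))"
proof -
  have "\<bar>eval_poly f x\<bar> \<le> (\<Sum>l\<in>\<Gamma>. \<bar>a l * eval_poly (t l) x\<bar>)"
    unfolding eval_poly_combination[OF \<Gamma>(2)] by (rule sum_abs)
  also have "\<dots> \<le> (\<Sum>l\<in>\<Gamma>. \<bar>a l\<bar> * 2 ^ (\<kappa> + n * d + b * (n * d)))"
    unfolding abs_mult using K x by (intro sum_mono mult_left_mono eval_poly_bound) auto
  also have "\<dots> \<le> 2 ^ \<sigma> * 2 ^ (\<kappa> + n * d + b * (n * d))"
    unfolding sum_distrib_right[symmetric] using \<sigma> by (intro mult_right_mono) auto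
  finally show ?thesis by (simp add: power_add ac_simps)
qed

end


section \<open>The interpolation program\<close>

primrec DROP :: "nat \<Rightarrow> prog" where
  "DROP 0 = Basic Ident"
| "DROP (Suc k) = Seq (Basic Snd) (DROP k)"

fun ddrop :: "nat \<Rightarrow> data \<Rightarrow> data option" where
  "ddrop 0 v = Some v"
| "ddrop (Suc k) (VPair u v) = ddrop k v"
| "ddrop _ _ = None"

lemma ddrop_numeral [simp]: "ddrop (numeral k) (VPair u v) = ddrop (pred_numeral k) v"
  by (simp add: numeral_eq_Suc)

lemma computes_DROP: "ddrop k x = Some y \<Longrightarrow> small s x a \<Longrightarrow> computes s \<O> (DROP k) x y (a * (4 * k + 2) + 4 * k + 1)"
proof (induction k x rule: ddrop.induct)
  case (1 v)
  then show ?case using computes_Ident[of s v a \<O>] by (simp add: mult_2_right)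
next
  case (2 k u v)
  have "computes s \<O> (DROP (Suc k)) (VPair u v) y ((a + a + 1) + (a + a + 1) + (a * (4 * k + 2) + 4 * k + 1) + 2)"
    unfolding DROP.simps
    by (rule computes_Seq[where u = v], rule computes_Basic) (use 2 in \<open>auto dest: small_VPairD\<close>)
  then show ?case by (rule computes_mono) (simp add: algebra_simps)
qed simp_all

text \<open>The arguments are packed into a fresh environment. The first \<open>VAR 1\<close> is the
  exponent; the second stands below the binder, where the loop index shifts the positions, and is
  the base.\<close>

definition POW :: "prog \<Rightarrow> prog \<Rightarrow> prog" where
  "POW b e = Seq (Fork b (Fork e (LIT 0))) (TPROD (VAR 1) (VAR 1))"

definition FACT :: "prog \<Rightarrow> prog" where
  "FACT p = Seq (Fork p (LIT 0)) (TPROD (VAR 0) (ADD (VAR 0) (LIT 1)))"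

lemma floorlog_small [simp]: "floorlog 2 0 = 0" "floorlog 2 (Suc 0) = 1" "floorlog 2 2 = 2"
  by (simp_all add: floorlog_def)

lemma computes_POW:
  assumes b: "computes s \<O> p x (VInt b) a1" and e: "computes s \<O> q x (VInt z) a2" and z: "z = int e" and below: "below s e a3"
    and y: "y = VInt (b ^ e)"
  shows "computes s \<O> (POW p q) x y (10 ^ 12 * (a1 + a2 + a3 + 10))"
  unfolding POW_def y
  apply (rule computes_mono)
   apply (rule computes_Seq computes_Fork computes_LIT b e[unfolded z] computesD(1)[OF b] computes_TPROD[where N = e and u = "\<lambda>_. b"] computes_VAR below refl | assumption | (simp; fail))+
  done

lemma computes_FACT:
  assumes p: "computes s \<O> p x (VInt z) a1" and z: "z = int e" and below: "below s e a3"
    and y: "y = VInt (fact e)"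
  shows "computes s \<O> (FACT p) x y (10 ^ 12 * (a1 + a3 + 10))"
proof -
  have f: "VInt (fact e) = VInt (\<Prod>j<e. int j + 1)"
    by (simp add: fact_prod_Suc atLeast0LessThan add.commute)
  show ?thesis unfolding FACT_def y f
  apply (rule computes_mono)
   apply (rule computes_Seq computes_Fork computes_LIT p[unfolded z] computesD(1)[OF p] computes_TPROD[where N = e] computes_ADD computes_VAR below refl | assumption | (simp; fail))+
  done
qed

text \<open>Every procedure below runs in an environment that lists its arguments and, after them, the global
  values \<open>D, Q, n!, n, A, d, m\<close>; under a binder all indices are shifted by one (by two in the body of
  \<open>ITER\<close>). The arguments are \<open>q, i\<close> for \<open>CEXP\<close>; \<open>q, s, y\<close> for \<open>POINT\<close>; a point and the found terms
  for \<open>EV\<close>; \<open>q, s\<close> and the found terms for \<open>VALS\<close>; a list of values for \<open>TOP\<close>; \<open>q\<close> and the found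
  terms for \<open>TOPS\<close> and \<open>TESTP\<close>; the output of \<open>TOPS\<close>, \<open>q\<close> and the found terms for \<open>FLAG\<close>, \<open>EXPS\<close>
  and \<open>COEF\<close>; the found terms for \<open>FIND\<close>.\<close>

definition CEXP :: prog where
  "CEXP = TSUM (VAR 5) (MUL (NTH (VAR 0) (NTH (VAR 2) (VAR 7)))
     (ADD (VAR 1) (MOD (POW (ADD (VAR 8) (LIT 1)) (VAR 0)) (VAR 1))))"

definition POINT :: prog where
  "POINT = TAB (VAR 6) (MUL (POW (ADD (LIT 1) (MUL (ADD (VAR 0) (LIT 1)) (VAR 6))) (VAR 2))
     (POW (VAR 3) (Seq (Fork (VAR 1) (Fork (VAR 0) (DROP 4))) CEXP)))"

definition EV :: prog where
  "EV = SUB (Seq (VAR 0) (Call BlackBox))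
     (LSUM (VAR 1) (MUL (SND (VAR 0)) (Seq (Fork (FST (VAR 0)) (VAR 1)) (Call BasisOracle))))"

definition VALS :: prog where
  "VALS = TAB (ADD (VAR 3) (LIT 1))
     (Seq (Fork (Seq (Fork (VAR 1) (Fork (VAR 2) (Fork (VAR 0) (DROP 4)))) POINT) (Fork (VAR 3) (LIT 0))) EV)"

definition TOP :: prog where
  "TOP = SND (ITER (ADD (VAR 1) (LIT 1)) (Fork (VAR 0) (Fork (LIT 0) (LIT 0)))
     (Fork (TAB (VAR 0) (SUB (NTH (ADD (VAR 0) (LIT 1)) (FST (VAR 2))) (NTH (VAR 0) (FST (VAR 2)))))
        (Cond (EQ (NTH (LIT 0) (FST (VAR 1))) (LIT 0)) (SND (VAR 1))
           (Fork (VAR 0) (NTH (LIT 0) (FST (VAR 1)))))))"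

definition TOPS :: prog where
  "TOPS = TAB (ADD (VAR 8) (LIT 2))
     (Seq (Fork (Seq (Fork (VAR 1) (Fork (VAR 0) (Fork (VAR 2) (DROP 3)))) VALS) (DROP 3)) TOP)"

definition FLAG :: prog where
  "FLAG = MUL (SUB (LIT 1) (EQ (SND (NTH (LIT 0) (VAR 0))) (LIT 0)))
    (MUL (TPROD (ADD (VAR 9) (LIT 2)) (EQ (FST (NTH (VAR 0) (VAR 1))) (FST (NTH (LIT 0) (VAR 1)))))
      (TPROD (ADD (VAR 9) (LIT 1))
        (EQ (MUL (SND (NTH (ADD (VAR 0) (LIT 1)) (VAR 1))) (SND (NTH (LIT 0) (VAR 1))))
            (MUL (SND (NTH (VAR 0) (VAR 1))) (SND (NTH (LIT 1) (VAR 1)))))))"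

definition EXPS :: prog where
  "EXPS = LET (DIV (SND (NTH (LIT 1) (VAR 0))) (SND (NTH (LIT 0) (VAR 0))))
     (TAB (VAR 7) (TSUM (VAR 10)
       (EQ (MOD (VAR 2) (POW (ADD (LIT 1) (MUL (ADD (VAR 1) (LIT 1)) (VAR 8))) (ADD (VAR 0) (LIT 1)))) (LIT 0))))"

definition COEF :: prog where
  "COEF = DIV (SND (NTH (LIT 0) (VAR 0))) (FACT (SUB (VAR 3) (FST (NTH (LIT 0) (VAR 0)))))"

definition TESTP :: prog where
  "TESTP = LET TOPS (Cond FLAG (Fork EXPS COEF) (LIT 0))"

definition FIND :: prog where
  "FIND = ITER (VAR 2) (LIT 0)
     (Cond (ISPAIR (VAR 1)) (VAR 1) (Seq (Fork (ADD (VAR 0) (LIT 1)) (Fork (VAR 2) (DROP 3))) TESTP))"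

definition STEP :: "prog \<Rightarrow> prog" where
  "STEP to_idx = LET (Seq (Fork (VAR 1) (DROP 2)) FIND)
     (Cond (ISPAIR (VAR 0)) (Fork (Fork (Seq (Fork (VAR 6) (FST (VAR 0))) to_idx) (SND (VAR 0))) (VAR 2)) (VAR 2))"

definition INTERPOLATE :: "prog \<Rightarrow> prog" where
  "INTERPOLATE to_idx = LET (FACT (VAR 0))
     (LET (MUL (LIT 2) (ADD (MUL (MUL (MUL (VAR 4) (VAR 4)) (VAR 1)) (VAR 3)) (LIT 1)))
        (LET (MUL (MUL (MUL (LIT 2) (VAR 0)) (VAR 2)) (VAR 4))
           (ITER (VAR 6) (LIT 0) (STEP to_idx))))"

lemma int_lits: "0 = int 0" "1 = int 1" "int k + 1 = int (Suc k)" "int k + 2 = int (k + 2)"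
  "i \<le> k \<Longrightarrow> int k - int i = int (k - i)"
  by simp_all

text \<open>The branch not taken is given the exponent of the one taken, as nothing else determines
  it.\<close>

lemma computes_CondT:
  assumes "computes s \<O> c x v a" "v \<noteq> VInt 0" "computes s \<O> p x y b"
  shows "computes s \<O> (Cond c p q) x y (a + a + b + b + 2)"
  by (rule computes_Cond[OF assms(1)]) (use assms in simp_all)

lemma computes_CondF:
  assumes "computes s \<O> c x v a" "v = VInt 0" "computes s \<O> q x y b"
  shows "computes s \<O> (Cond c p q) x y (a + a + b + b + 2)"
  by (rule computes_Cond[OF assms(1)]) (use assms in simp_all)

lemma small_VInt_bound:
  assumes "\<bar>z\<bar> \<le> 2 ^ b" "below s b a" shows "small s (VInt z) (a + 2)"
proof -
  have "(2::int) ^ b < 2 ^ Suc b" by simp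
  with assms(1) have "dsize (VInt z) \<le> Suc (Suc b)" unfolding dsize_VInt_le by linarith
  with below_Suc[OF below_Suc[OF assms(2)]] show ?thesis unfolding below_def small_def by simp
qed

lemma small_VInt_D: "small s (VInt z) c \<Longrightarrow> \<bar>z\<bar> \<le> 2 ^ ((s + 2) ^ c)"
  using dsize_VInt_le[of z "(s + 2) ^ c"] unfolding small_def by linarith

lemma small_enc_list_el: "v \<in> set vs \<Longrightarrow> small s (enc_list vs) a \<Longrightarrow> small s v a"
  by (induction vs) (auto dest: small_VPairD)

text \<open>Kept folded in the bounds below, so that no arithmetic on huge numerals is needed.\<close>

definition test_bound :: "nat \<Rightarrow> nat" where
  "test_bound c = 10 ^ 60 * (10 ^ 150 * (c + 1) + 1)"

definition find_bound :: "nat \<Rightarrow> nat" where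
  "find_bound c = 4000 * (10 ^ 6 * (100 * (c + 1) + 1) + 2 * test_bound (1000 * (100 * (c + 1) + 1)))"

definition step_bound :: "nat \<Rightarrow> nat \<Rightarrow> nat \<Rightarrow> nat" where
  "step_bound C k c = 10 ^ 9 * (find_bound (100 * (c + 1)) + c + C + 13 * k + 100)"

definition main_bound :: "nat \<Rightarrow> nat \<Rightarrow> nat" where
  "main_bound C k = 10 ^ 5 * (step_bound C k (10 ^ 40 + C + 13 * k) + 10 ^ 50 + C + 13 * k)"

text \<open>The parameter s bounds n, d, m and the bit sizes of K and of the coefficients. It
  belongs to the analysis only; the program never receives it.\<close>

locale interpolation_run = friendly_instance n \<Lambda> t K A lead \<Gamma> a d m
  for n and \<Lambda> :: "data set" and t K A lead \<Gamma> a d m +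
  fixes s :: nat
  assumes params: "n \<le> s" "d \<le> s" "m \<le> s"
    and K_le: "\<And>l. l \<in> \<Gamma> \<Longrightarrow> K l n \<le> 2 ^ s"
    and a_le: "(\<Sum>l\<in>\<Gamma>. \<bar>a l\<bar>) \<le> 2 ^ s"
begin

abbreviation \<O> :: oracles where "\<O> \<equiv> interpolation_oracle n f \<Lambda> t"

definition glob :: data where
  "glob = enc_list [VInt (int D), VInt (int Q), VInt (fact n), VInt (int n), enc_mat A, VInt (int d), VInt (int m)]"

lemma glob_eq: "glob = VPair (VInt (int D)) (VPair (VInt (int Q)) (VPair (VInt (fact n)) (VPair (VInt (int n))
    (VPair (enc_mat A) (VPair (VInt (int d)) (VPair (VInt (int m)) (VInt 0)))))))"
  by (simp add: glob_def)

lemma below_n: "below s n 1" and below_d: "below s d 1" and below_m: "below s m 1"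
  using params below_param by auto

lemma below_Q: "below s Q 8"
proof -
  have "below s (2 * Suc (m * m * n * d)) (2 + (1 + 1 + 1 + 1 + 1))"
    by (intro below_mult below_Suc below_n below_d below_m below_const)
  then show ?thesis by (rule below_mono[THEN below_le]) (simp_all add: Q_def)
qed

lemma below_D: "below s D 12"
proof -
  have "below s (2 * Q * n * d) (2 + 8 + 1 + 1)"
    by (intro below_mult below_Suc below_n below_d below_Q below_const)
  then show ?thesis by (simp add: D_def)
qed

lemma dnth_A:
  assumes "i < n"
  shows "map enc_ints (mat_to_list A) ! i = enc_ints (map (\<lambda>j. A $$ (i, j)) [0..<n])"
  using A_carrier assms by (simp add: mat_to_list_def)

lemma weight_le: "1 \<le> q \<Longrightarrow> q \<le> Q \<Longrightarrow> weight d q j \<le> 2 * Q"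
proof -
  assume "1 \<le> q" "q \<le> Q"
  moreover then have "(d + 1) ^ j mod q < q" by simp
  ultimately show ?thesis unfolding weight_def by linarith
qed

lemma below_cexp:
  assumes "1 \<le> q" "q \<le> Q" "i < n" shows "below s (cexp q i) 11"
proof -
  have "cexp q i \<le> (\<Sum>j<n. 1 * (2 * Q))"
    unfolding cexp_def using assms A_01(2) by (intro sum_mono mult_le_mono weight_le) auto
  then have "cexp q i \<le> n * (2 * Q)" by simp
  moreover have "below s (n * (2 * Q)) (1 + (2 + 8))" by (intro below_mult below_n below_Q below_const)
  ultimately show ?thesis by (simp add: below_le)
qed

section \<open>Points on the curves and values of the residual\<close>

lemmas computes_rules = computes_Seq computes_Fork computes_LIT computes_ADD computes_SUB computes_MUL computes_DIV computes_MOD computes_FST computes_SND computes_EQ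
  computes_ISPAIR computes_LET computes_NTH computes_POW computes_FACT computes_VAR computes_DROP

lemma computes_CEXP:
  assumes "small s (VPair (VInt (int q)) (VPair (VInt (int i)) glob)) c" "i < n"
  shows "computes s \<O>' CEXP
    (VPair (VInt (int q)) (VPair (VInt (int i)) glob)) (VInt (int (cexp q i))) (10 ^ 30 * (c + 1))"
proof -
  have eq: "VInt (int (cexp q i)) = VInt (\<Sum>j<n. A $$ (i, j) * (int q + (int d + 1) ^ j mod int q))"
    unfolding cexp_def weight_def using A_01(1) assms(2) by (simp add: of_nat_mod add.commute)
  have below_j: "below s j 1" if "j < n" for j using below_le[OF below_n] that by simp
  show ?thesis
    unfolding CEXP_def eq
    apply (rule computes_mono)
     apply (rule computes_TSUM[where N = n])
         apply (rule computes_VAR, simp add: glob_eq, rule assms(1))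
        apply (rule refl)
       apply (rule below_n)
      apply (rule computes_MUL)
        apply (rule computes_NTH)
            apply (rule computes_VAR, simp, assumption)
           apply (rule computes_NTH[where vs = "map enc_ints (mat_to_list A)" and k = i])
               apply (rule computes_VAR, simp, assumption)
              apply (rule computes_VAR, simp add: glob_eq enc_mat_def, assumption)
             apply simp
            using assms(2) A_carrier apply (simp add: mat_to_list_def)
           apply (simp add: dnth_A[OF assms(2)] enc_ints_def)
          apply (rule refl)
         apply simp
       apply (rule computes_rules refl below_j | assumption | (simp add: glob_eq; fail))+
    done
qed

lemma int_base: "int (base n i) = 1 + (int i + 1) * fact n"
  by (simp add: base_def algebra_simps)

lemma computes_POINT:
  assumes "small s (VPair (VInt (int q)) (VPair (VInt (int r)) (VPair (VInt (int y)) glob))) c"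
    and "1 \<le> q" "q \<le> Q" "r < m + 2"
  shows "computes s \<O>' POINT (VPair (VInt (int q)) (VPair (VInt (int r)) (VPair (VInt (int y)) glob)))
    (enc_ints (map int (point q r y))) (10 ^ 60 * (c + 1))"
proof -
  have eq: "enc_ints (map int (point q r y)) =
      enc_list (map (\<lambda>i. VInt ((1 + (int i + 1) * fact n) ^ r * int y ^ cexp q i)) [0..<n])"
    by (auto simp: enc_ints_def point_def int_base intro!: arg_cong[of _ _ enc_list])
  have below_r: "below s r 4"
    by (rule below_le[OF below_mono[OF below_add[OF below_m below_const[of s 2]]]]) (use assms(4) in simp_all)
  show ?thesis
    unfolding POINT_def eq
    apply (rule computes_mono)
     apply (rule computes_TAB[where N = n])
         apply (rule computes_VAR, simp add: glob_eq, rule assms(1))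
        apply (rule refl)
       apply (rule below_n)
      apply (rule computes_rules computes_CEXP refl below_r below_cexp[OF assms(2,3)] | assumption | (simp; fail) |
        (simp add: glob_eq; fail))+
    done
qed

definition enc_found :: "data list \<Rightarrow> data" where
  "enc_found ls = enc_list (map (\<lambda>l. VPair l (VInt (a l))) ls)"

text \<open>\<open>nth\<close> is unspecified beyond the length of a list; a polynomial in n
  variables does not see those values.\<close>

lemma eval_poly_cong:
  assumes "p \<in> polys n" "\<And>i. i < n \<Longrightarrow> x i = y i"
  shows "eval_poly p x = eval_poly p y"
  unfolding eval_poly_superset[OF finite_keys order_refl]
proof (intro sum.cong refl arg_cong2[of _ _ _ _ "(*)"])
  fix e assume "e \<in> Poly_Mapping.keys p"
  then have "e \<in> exponents n" using assms(1) by (auto simp: polys_def)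
  then show "mon e x = mon e y" using assms(2) by (simp add: mon_eq)
qed

text \<open>Only found terms are passed to the basis oracle, and these lie in \<Lambda>, so no call
  gets stuck. The answers need size bounds before they can be processed: K and the a_l enter through
  s, the coordinates through the size of the encoded point.\<close>

lemma computes_EV:
  assumes small: "small s (VPair (enc_ints (map int x)) (VPair (enc_found ls) w)) c"
    and x: "length x = n" and ls: "distinct ls" "set ls \<subseteq> \<Gamma>"
  shows "computes s \<O> EV (VPair (enc_ints (map int x)) (VPair (enc_found ls) w))
    (VInt (\<Sum>l\<in>\<Gamma> - set ls. a l * eval_poly (t l) (\<lambda>i. int (x ! i)))) (10 ^ 10 * (c + 1))"
proof -
  let ?x = "\<lambda>i. int (x ! i)"
  define b where "b = (s + 2) ^ c"
  have xb: "\<bar>?x i\<bar> \<le> 2 ^ b" if "i < n" for i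
    unfolding b_def
  proof (rule small_VInt_D, rule small_enc_list_el)
    show "VInt (?x i) \<in> set (map VInt (map int x))" using that x by (auto intro!: image_eqI)
    show "small s (enc_list (map VInt (map int x))) c"
      using small_VPairD(1)[OF small] by (simp add: enc_ints_def)
  qed
  have vlb: "below s (s + s + n * d + b * (n * d)) (c + 20)"
  proof -
    have "below s (s + s + n * d + b * (n * d)) ((((1 + 1 + 1) + (1 + 1) + 1) + (c + (1 + 1))) + 1)"
      by (intro below_add below_mult below_n below_d below_param order_refl) (simp add: below_def b_def)
    then show ?thesis by (rule below_mono) simp
  qed
  have szf: "small s (VInt (eval_poly f ?x)) (c + 22)"
    using small_VInt_bound[OF eval_f_bound[OF K_le a_le xb] vlb] by (simp add: add.commute)
  have szt: "small s (VInt (eval_poly (t l) ?x)) (c + 22)" if "l \<in> \<Gamma>" for l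
    using small_VInt_bound[OF eval_poly_bound[OF that K_le[OF that] xb] below_le[OF vlb]] by (simp add: add.commute)
  have nth_ls: "ls ! i \<in> \<Gamma>" if "i < length ls" for i using ls that by auto
  have "(\<Sum>l\<in>set ls. a l * eval_poly (t l) ?x) = (\<Sum>i<length ls. a (ls ! i) * eval_poly (t (ls ! i)) ?x)"
    using ls(1) by (simp add: sum.reindex_bij_betw[OF bij_betw_nth[OF ls(1) refl refl], symmetric])
  then have eq: "(\<Sum>l\<in>\<Gamma> - set ls. a l * eval_poly (t l) ?x) =
      eval_poly f ?x - (\<Sum>i<length (map (\<lambda>l. VPair l (VInt (a l))) ls). a (ls ! i) * eval_poly (t (ls ! i)) ?x)"
    unfolding eval_poly_combination[OF \<Gamma>(2)] by (simp add: sum_diff[OF \<Gamma>(2) ls(2)])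
  have BB: "\<O> BlackBox (enc_ints (map int x)) (VInt (eval_poly f ?x))"
  proof -
    have "eval_poly f ((!) (map int x)) = eval_poly f ?x"
      unfolding eval_poly_combination[OF \<Gamma>(2)]
      by (intro sum.cong refl arg_cong2[of _ _ _ _ "(*)"] eval_poly_cong)
        (use polys \<Gamma> x in auto)
    then show ?thesis
      using interpolation_oracle.intros(1)[of "map int x" n f \<Lambda> t] x by simp
  qed
  have BO: "\<O> BasisOracle (VPair l (enc_ints (map int x))) (VInt (eval_poly (t l) ?x))" if "l \<in> \<Gamma>" for l
    using interpolation_oracle.intros(2)[OF _ x] that \<Gamma> by blast
  show ?thesis
    unfolding EV_def eq enc_found_def
    apply (rule computes_mono)
     apply (rule computes_SUB)
       apply (rule computes_Seq)
        apply (rule computes_VAR, simp, rule small[unfolded enc_found_def])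
       apply (erule computes_Call[of \<O>, OF BB], rule szf)
      apply (rule computes_LSUM[where vs = "map (\<lambda>l. VPair l (VInt (a l))) ls"])
        apply (rule computes_VAR, simp, rule small[unfolded enc_found_def])
       apply (rule computes_MUL)
         apply (rule computes_SND)
         apply (rule computes_VAR, simp, assumption)
        apply (rule computes_Seq)
         apply (rule computes_Fork)
          apply (rule computes_FST)
          apply (rule computes_VAR, simp, assumption)
         apply (rule computes_VAR, simp, assumption)
        apply (rule computes_Call[of \<O>])
          apply (rule BO, rule nth_ls, simp)
         apply assumption
        apply (rule szt, rule nth_ls, simp)
       apply (rule refl)+
    apply simp
    done
qed

lemma computes_VALS:
  assumes "small s (VPair (VInt (int q)) (VPair (VInt (int r)) (VPair (enc_found ls) glob))) c"
    and "1 \<le> q" "q \<le> Q" "r < m + 2" and ls: "distinct ls" "set ls \<subseteq> \<Gamma>"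
  shows "computes s \<O> VALS (VPair (VInt (int q)) (VPair (VInt (int r)) (VPair (enc_found ls) glob)))
    (enc_list (map (\<lambda>y. VInt (resid (\<Gamma> - set ls) q r y)) [0..<Suc D])) (10 ^ 90 * (c + 1))"
  unfolding VALS_def
  apply (rule computes_mono)
   apply (rule computes_TAB[where N = "Suc D"])
       apply (rule computes_ADD)
         apply (rule computes_VAR, simp add: glob_eq, rule assms(1))
        apply (rule computes_LIT, rule assms(1), rule refl)
       apply (rule refl)
      apply simp
     apply (rule below_Suc[OF below_D])
    apply (rule computes_Seq)
     apply (rule computes_Fork)
      apply (rule computes_Seq)
       apply (rule computes_Fork computes_VAR computes_DROP | assumption | (simp; fail))+
      apply (rule computes_POINT, assumption, rule assms, rule assms, rule assms)
     apply (rule computes_Fork computes_VAR computes_LIT refl | assumption | (simp; fail))+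
    apply (rule computes_EV, assumption, simp add: point_def, rule ls, rule ls)
   apply (simp add: resid_def)
  apply simp
  done

section \<open>Difference tables and leading coefficients\<close>

definition enc_top :: "nat \<times> int \<Rightarrow> data" where
  "enc_top p = VPair (VInt (int (fst p))) (VInt (snd p))"

text \<open>Each difference at most doubles the absolute value, so order k costs k bits, and k never
  exceeds D.\<close>

lemma fdiff_abs_le:
  assumes "\<And>y. y \<le> D' \<Longrightarrow> \<bar>g y\<bar> \<le> 2 ^ b" "k + y \<le> D'"
  shows "\<bar>fdiff k g y\<bar> \<le> 2 ^ (k + b)"
  using assms(2)
proof (induction k arbitrary: y)
  case (Suc k)
  then have "\<bar>fdiff k g (Suc y)\<bar> \<le> 2 ^ (k + b)" "\<bar>fdiff k g y\<bar> \<le> 2 ^ (k + b)" by simp_all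
  then show ?case by simp
qed (simp add: assms(1))

lemma top_diff_cases: "top_diff D' g k = (0, 0) \<or> (\<exists>k'<k. top_diff D' g k = (D' - k', fdiff k' g 0))"
  by (induction k) (auto simp: less_Suc_eq)

text \<open>The state pairs a row of the difference table with the record kept by
  \<open>top_diff\<close>. A round at loop index j reads off the head of the row of order D - j and
  shortens the row by one; so j itself is the distance to be recorded.\<close>

lemma computes_TOP:
  assumes small: "small s (VPair (enc_list (map (\<lambda>y. VInt (g y)) [0..<Suc D])) glob) c"
  shows "computes s \<O>' TOP (VPair (enc_list (map (\<lambda>y. VInt (g y)) [0..<Suc D])) glob)
    (enc_top (top_diff D g (Suc D))) (10 ^ 40 * (c + 1))"
proof -
  define b where "b = (s + 2) ^ c"
  have g: "\<bar>g y\<bar> \<le> 2 ^ b" if "y \<le> D" for y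
    unfolding b_def
  proof (rule small_VInt_D, rule small_enc_list_el)
    show "VInt (g y) \<in> set (map (\<lambda>y. VInt (g y)) [0..<Suc D])" using that by (auto simp del: upt_Suc)
    show "small s (enc_list (map (\<lambda>y. VInt (g y)) [0..<Suc D])) c" by (rule small_VPairD(1)[OF small])
  qed
  have szf: "small s (VInt (fdiff k g y)) (c + 15)" if "k + y \<le> D" for k y
  proof (rule small_mono[OF small_VInt_bound[OF fdiff_abs_le[OF g that]]])
    show "below s (k + b) (12 + c + 1)"
      by (rule below_add[OF below_le[OF below_D]]) (use that in \<open>simp_all add: below_def b_def\<close>)
  qed simp_all
  define st where "st j = VPair (enc_list (map (\<lambda>y. VInt (fdiff (Suc D - j) g y)) [0..<j]))
    (enc_top (top_diff D g (Suc D - j)))" for j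
  have szt: "small s (enc_top (top_diff D g k)) (c + 100)" if k: "k \<le> Suc D" for k
    using top_diff_cases[of D g k]
  proof
    assume "top_diff D g k = (0, 0)"
    then have e: "enc_top (top_diff D g k) = VPair (VInt (int 0)) (VInt (int 0))" by (simp add: enc_top_def)
    show ?thesis unfolding e by (rule small_mono[OF small_VPair[OF small_nat[OF below_0] small_nat[OF below_0]]]) simp
  next
    assume "\<exists>k'<k. top_diff D g k = (D - k', fdiff k' g 0)"
    then obtain k' where k': "k' < k" "top_diff D g k = (D - k', fdiff k' g 0)" by blast
    show ?thesis unfolding enc_top_def k'(2) fst_conv snd_conv
      by (rule small_mono[OF small_VPair[OF small_nat[OF below_le[OF below_D]] szf]]) (use k'(1) k in simp_all)
  qed
  have szst: "small s (st j) (2 * c + 200)" if "j < Suc D" for j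
    unfolding st_def
  proof (rule small_mono[OF small_VPair[OF small_enc_list szt]])
    show "below s (length (map (\<lambda>y. VInt (fdiff (Suc D - j) g y)) [0..<j])) 13"
      by (rule below_le[OF below_mono[OF below_Suc[OF below_D]]]) (use that in simp_all)
    show "small s v (c + 15)" if "v \<in> set (map (\<lambda>y. VInt (fdiff (Suc D - j) g y)) [0..<j])" for v
      using that \<open>j < Suc D\<close> by (auto intro!: szf)
  qed simp_all
  have step: "computes s \<O>' (Fork (TAB (VAR 0) (SUB (NTH (ADD (VAR 0) (LIT 1)) (FST (VAR 2))) (NTH (VAR 0) (FST (VAR 2)))))
        (Cond (EQ (NTH (LIT 0) (FST (VAR 1))) (LIT 0)) (SND (VAR 1))
           (Fork (VAR 0) (NTH (LIT 0) (FST (VAR 1))))))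
      (VPair (VInt (int j)) (VPair (st (Suc j)) x)) (st j) (10 ^ 25 * (c' + 1))"
    if j: "j < Suc D" and szj: "small s (VPair (VInt (int j)) (VPair (st (Suc j)) x)) c'" for j x c'
  proof -
    define k where "k = D - j"
    let ?l = "enc_list (map (\<lambda>y. VInt (fdiff k g y)) [0..<Suc j])"
    have st: "st (Suc j) = VPair ?l (VPair (VInt (int (fst (top_diff D g k)))) (VInt (snd (top_diff D g k))))"
      using j by (simp add: st_def k_def enc_top_def del: upt_Suc)
    have st': "st j = VPair (enc_list (map (\<lambda>y. VInt (fdiff (Suc k) g y)) [0..<j])) (enc_top (top_diff D g (Suc k)))"
      using j by (simp add: st_def k_def Suc_diff_le del: upt_Suc top_diff.simps fdiff.simps)
    have vlj: "below s j 12" by (rule below_le[OF below_D]) (use j in simp)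
    have Dk: "D - k = j" using j by (simp add: k_def)
    show ?thesis
    proof (cases "fdiff k g 0 = 0")
      case True
      then have e: "enc_top (top_diff D g (Suc k)) = VPair (VInt (int (fst (top_diff D g k)))) (VInt (snd (top_diff D g k)))"
        by (simp add: enc_top_def)
      show ?thesis using szj unfolding st st' e fdiff.simps
        by - (rule computes_mono, (rule computes_rules computes_TAB[where N = j] computes_CondT[OF _ _ computes_SND] refl vlj int_lits | assumption |
            (simp add: True del: upt_Suc; fail))+)
    next
      case False
      then have e: "enc_top (top_diff D g (Suc k)) = VPair (VInt (int j)) (VInt (fdiff k g 0))"
        by (simp add: enc_top_def Dk)
      show ?thesis using szj unfolding st st' e fdiff.simps
        by - (rule computes_mono, (rule computes_rules computes_TAB[where N = j] computes_CondF[OF _ _ computes_Fork] refl vlj int_lits | assumption |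
            (simp add: False del: upt_Suc; fail))+)
    qed
  qed
  have st_init: "st (Suc D) = VPair (enc_list (map (\<lambda>y. VInt (g y)) [0..<Suc D])) (VPair (VInt 0) (VInt 0))"
    by (simp add: st_def enc_top_def del: upt_Suc)
  show ?thesis
    unfolding TOP_def
    apply (rule computes_mono)
     apply (rule computes_SND)
     apply (rule computes_ITER[where N = "Suc D" and acc = st])
           apply (rule computes_rules small refl | (simp del: upt_Suc; fail) | (simp add: glob_eq del: upt_Suc; fail))+
         apply (rule below_Suc[OF below_D])
        apply (unfold st_init)
        apply (rule computes_rules small refl | (simp del: upt_Suc; fail))+
       apply (erule szst)
      apply (erule step, assumption)
     apply (simp add: st_def)
    apply simp
    done
qed

lemma computes_TOPS:
  assumes "small s (VPair (VInt (int q)) (VPair (enc_found ls) glob)) c"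
    and "1 \<le> q" "q \<le> Q" and ls: "distinct ls" "set ls \<subseteq> \<Gamma>"
  shows "computes s \<O> TOPS (VPair (VInt (int q)) (VPair (enc_found ls) glob))
    (enc_list (map (\<lambda>r. enc_top (tp (\<Gamma> - set ls) q r)) [0..<m + 2])) (10 ^ 150 * (c + 1))"
  unfolding TOPS_def tp_def
  apply (rule computes_mono)
   apply (rule computes_TAB[where N = "m + 2"])
       apply (rule computes_ADD)
         apply (rule computes_VAR, simp add: glob_eq, rule assms(1))
        apply (rule computes_LIT, rule assms(1), rule refl)
       apply (rule refl)
      apply simp
     apply (rule below_add[OF below_m below_const])
    apply (rule computes_rules computes_VALS computes_TOP assms refl | assumption | (simp; fail))+
  done

section \<open>Running the test and decoding a term\<close>

lemma prod_indicator: "(\<Prod>j<N :: nat. if P j then 1 else 0) = (if \<forall>j<N. P j then 1 else (0 :: int))"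
  by (induction N) (auto simp: less_Suc_eq)

definition flag :: "(nat \<Rightarrow> nat \<times> int) \<Rightarrow> bool" where
  "flag p \<longleftrightarrow> snd (p 0) \<noteq> 0 \<and> (\<forall>r<m + 2. fst (p r) = fst (p 0)) \<and>
     (\<forall>r<m + 1. snd (p (Suc r)) * snd (p 0) = snd (p r) * snd (p 1))"

lemma test_flag: "test S q = flag (tp S q)"
  by (simp only: test_def flag_def)

lemma indicator_mult: "(if \<not> x \<and> y \<and> z then 1 else 0) =
    (1 - (if x then 1 else 0)) * ((if y then 1 else 0) * (if z then 1 else 0 :: int))"
  by simp

text \<open>Bounded universal statements are computed as products of values 0 and 1.\<close>

lemma computes_FLAG:
  fixes p :: "nat \<Rightarrow> nat \<times> int"
  assumes "small s (VPair (enc_list (map (\<lambda>r. enc_top (p r)) [0..<m + 2])) (VPair u (VPair v glob))) c"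
  shows "computes s \<O>' FLAG (VPair (enc_list (map (\<lambda>r. enc_top (p r)) [0..<m + 2])) (VPair u (VPair v glob)))
    (VInt (if flag p then 1 else 0)) (10 ^ 30 * (c + 1))"
  unfolding FLAG_def
  apply (rule computes_mono)
   apply (rule computes_MUL)
     apply (rule computes_rules int_lits assms refl | assumption | (simp add: enc_top_def del: upt_Suc; fail))+
      apply (rule computes_TPROD[where N = "m + 2"])
          apply (rule computes_rules int_lits assms refl | (simp add: glob_eq; fail))+
       apply (rule below_add[OF below_m below_const])
      apply (rule computes_rules int_lits refl | assumption | (simp add: enc_top_def del: upt_Suc; fail))+
     apply (rule computes_TPROD[where N = "m + 1"])
         apply (rule computes_rules int_lits assms refl | (simp add: glob_eq; fail))+
      apply (rule below_add[OF below_m below_const])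
     apply (rule computes_rules int_lits refl | assumption | (simp add: enc_top_def del: upt_Suc; fail))+
   apply (unfold prod_indicator flag_def of_nat_eq_iff One_nat_def, rule arg_cong[of _ _ VInt], rule indicator_mult)
  apply simp
  done

lemma computes_COEF:
  fixes p :: "nat \<Rightarrow> nat \<times> int"
  assumes "small s (VPair (enc_list (map (\<lambda>r. enc_top (p r)) [0..<m + 2])) (VPair u (VPair v glob))) c" "fst (p 0) \<le> D"
  shows "computes s \<O>' COEF (VPair (enc_list (map (\<lambda>r. enc_top (p r)) [0..<m + 2])) (VPair u (VPair v glob)))
    (VInt (snd (p 0) div fact (D - fst (p 0)))) (10 ^ 30 * (c + 1))"
proof -
  have below: "below s (D - fst (p 0)) 12" by (rule below_le[OF below_D]) simp
  show ?thesis
  unfolding COEF_def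
  apply (rule computes_mono)
   apply (rule computes_rules int_lits below assms refl | assumption | (simp add: enc_top_def del: upt_Suc; fail) |
     (simp add: glob_eq; fail))+
  done
qed

lemma computes_EXPS:
  fixes p :: "nat \<Rightarrow> nat \<times> int"
  assumes "small s (VPair (enc_list (map (\<lambda>r. enc_top (p r)) [0..<m + 2])) (VPair u (VPair v glob))) c"
  shows "computes s \<O>' EXPS (VPair (enc_list (map (\<lambda>r. enc_top (p r)) [0..<m + 2])) (VPair u (VPair v glob)))
    (enc_list (map (\<lambda>i. VInt (\<Sum>k<d. if (snd (p (Suc 0)) div snd (p 0)) mod (1 + (int i + 1) * fact n) ^ Suc k = 0 then 1 else 0)) [0..<n]))
    (10 ^ 50 * (c + 1))"
proof -
  have below: "below s (Suc k) 2" if "k < d" for k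
    using below_mono[OF below_Suc[OF below_le[OF below_d, of k]], of 2] that by simp
  show ?thesis
  unfolding EXPS_def
  apply (rule computes_mono)
   apply (rule computes_LET)
    apply (rule computes_rules int_lits assms refl | assumption | (simp add: enc_top_def del: upt_Suc; fail))+
   apply (rule computes_TAB[where N = n])
       apply (rule computes_VAR, simp add: glob_eq, assumption)
      apply (rule refl)
     apply (rule below_n)
    apply (rule computes_TSUM[where N = d])
        apply (rule computes_VAR, simp add: glob_eq, assumption)
       apply (rule refl)
      apply (rule below_d)
     apply (rule computes_rules int_lits below refl | assumption | (simp add: glob_eq; fail))+
  done
qed

text \<open>Names a witness of \<open>test_sound\<close> for the specification. The program never
  handles it directly; it reads its exponent and its coefficient off \<open>tp\<close>.\<close>

definition picked :: "data set \<Rightarrow> nat \<Rightarrow> data" where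
  "picked S q = (SOME l. l \<in> S \<and> snd (tp S q 0) = fact (D - fst (tp S q 0)) * a l \<and>
    snd (tp S q 1) = snd (tp S q 0) * int (monom_val n (Poly_Mapping.lookup (lead l))))"

definition outcome :: "data set \<Rightarrow> nat \<Rightarrow> data" where
  "outcome S q = (if test S q then VPair (enc_exponent n (lead (picked S q))) (VInt (a (picked S q))) else VInt 0)"

lemma picked:
  assumes "S \<subseteq> \<Gamma>" "1 \<le> q" "q \<le> Q" "test S q"
  shows "picked S q \<in> S" "snd (tp S q 0) = fact (D - fst (tp S q 0)) * a (picked S q)"
    "snd (tp S q 1) = snd (tp S q 0) * int (monom_val n (Poly_Mapping.lookup (lead (picked S q))))"
  using someI_ex[OF test_sound[OF assms, unfolded Bex_def]] unfolding picked_def by auto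

lemma computes_TESTP:
  assumes "small s (VPair (VInt (int q)) (VPair (enc_found ls) glob)) c"
    and q: "1 \<le> q" "q \<le> Q" and ls: "distinct ls" "set ls \<subseteq> \<Gamma>"
  shows "computes s \<O> TESTP (VPair (VInt (int q)) (VPair (enc_found ls) glob))
    (outcome (\<Gamma> - set ls) q) (test_bound c)"
proof -
  let ?S = "\<Gamma> - set ls"
  have S: "?S \<subseteq> \<Gamma>" by blast
  define B where "B = 10 ^ 150 * (c + 1)"
  note tops = computes_TOPS[OF assms, folded B_def]
  \<comment> \<open>Makes the natural subtraction from D agree with the integer subtraction
    performed by \<open>COEF\<close>.\<close>
  have D: "fst (tp ?S q 0) \<le> D"
    using top_diff(1)[of D "resid ?S q 0" "fst (tp ?S q 0)" "snd (tp ?S q 0)"] unfolding tp_def prod.collapse by blast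
  show ?thesis
  proof (cases "test ?S q")
    case True
    let ?l = "picked ?S q"
    note p = picked[OF S q True]
    have l: "?l \<in> \<Gamma>" "?l \<in> \<Lambda>" using p(1) \<Gamma> by auto
    have ne: "snd (tp ?S q 0) \<noteq> 0" using True unfolding test_def by blast
    \<comment> \<open>In the ratio of the leading coefficients for s = 1 and s = 0 the factorial and
      the coefficient cancel, leaving the monomial value of the leading exponent.\<close>
    have W: "snd (tp ?S q (Suc 0)) div snd (tp ?S q 0) = int (monom_val n (Poly_Mapping.lookup (lead ?l)))"
      unfolding p(3)[unfolded One_nat_def] using ne by simp
    have A: "snd (tp ?S q 0) div fact (D - fst (tp ?S q 0)) = a ?l"
      unfolding p(2) by simp
    have E: "enc_exponent n (lead ?l) = enc_list (map (\<lambda>i. VInt (\<Sum>k<d.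
      if (snd (tp ?S q (Suc 0)) div snd (tp ?S q 0)) mod (1 + (int i + 1) * fact n) ^ Suc k = 0 then 1 else 0)) [0..<n])"
    proof -
      have "(\<Sum>k<d. if (snd (tp ?S q (Suc 0)) div snd (tp ?S q 0)) mod (1 + (int i + 1) * fact n) ^ Suc k = 0 then 1 else 0)
        = int (Poly_Mapping.lookup (lead ?l) i)" if "i < n" for i
        unfolding W int_base[symmetric] of_nat_power[symmetric] of_nat_mod[symmetric] of_nat_eq_0_iff
        by (rule exponent_from_monom_val[OF that lookup_le[OF l(1) lead_props(3)[OF l(2)]]])
      then show ?thesis unfolding enc_exponent_def enc_ints_def map_map
        by (intro arg_cong[of _ _ enc_list] map_cong refl) simp
    qed
    have r: "outcome ?S q = VPair (enc_list (map (\<lambda>i. VInt (\<Sum>k<d.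
      if (snd (tp ?S q (Suc 0)) div snd (tp ?S q 0)) mod (1 + (int i + 1) * fact n) ^ Suc k = 0 then 1 else 0)) [0..<n]))
        (VInt (snd (tp ?S q 0) div fact (D - fst (tp ?S q 0))))"
      using True by (simp only: outcome_def if_True E A)
    show ?thesis unfolding TESTP_def r test_bound_def B_def[symmetric]
      apply (rule computes_mono)
       apply (rule computes_LET, rule tops)
       apply (rule computes_CondT)
         apply (erule computes_FLAG[where p = "tp ?S q"])
        apply (use True in \<open>simp add: test_flag\<close>)
       apply (rule computes_Fork)
        apply (erule computes_EXPS[where p = "tp ?S q"])
       apply (rule computes_COEF[where p = "tp ?S q", OF _ D], assumption)
      apply simp
      done
  next
    case False
    then have r: "outcome ?S q = VInt 0" by (simp add: outcome_def)
    show ?thesis unfolding TESTP_def r test_bound_def B_def[symmetric]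
      apply (rule computes_mono)
       apply (rule computes_LET, rule tops)
       apply (rule computes_CondF)
         apply (erule computes_FLAG[where p = "tp ?S q"])
        apply (use False in \<open>simp add: test_flag\<close>)
       apply (erule computes_LIT, rule refl)
      apply simp
      done
  qed
qed

section \<open>Search for a q that passes the test\<close>

lemma computes_ADD1:
  assumes "computes s \<O>' p x (VInt (int j)) e"
  shows "computes s \<O>' (ADD p (LIT 1)) x (VInt (int (Suc j))) (20 * e + 50)"
  by (rule computes_mono[OF computes_ADD[OF assms computes_LIT[OF computesD(1)[OF assms] refl]]]) simp_all

text \<open>The successes among the candidates tried by the end of the round with loop index j. That
  round concerns q = j + 1, so the downward loop settles on the largest q that passes.\<close>

definition passing :: "data set \<Rightarrow> nat \<Rightarrow> nat set" where
  "passing S j = {q. j < q \<and> q \<le> Q \<and> test S q}"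

definition best :: "data set \<Rightarrow> nat \<Rightarrow> data" where
  "best S j = (if passing S j = {} then VInt 0 else outcome S (Max (passing S j)))"

lemma finite_passing: "finite (passing S j)"
  by (rule finite_subset[of _ "{..Q}"]) (auto simp: passing_def)

lemma passing_Suc:
  assumes "j < Q"
  shows "passing S j = (if test S (Suc j) then insert (Suc j) (passing S (Suc j)) else passing S (Suc j))"
  using assms by (auto simp: passing_def Suc_le_eq) (metis Suc_lessI)+

lemma best_Q: "best S Q = VInt 0"
  by (simp add: best_def passing_def)

lemma best_nonempty: "passing S j \<noteq> {} \<Longrightarrow> \<exists>q. j < q \<and> q \<le> Q \<and> test S q \<and> best S j = outcome S q"
proof -
  assume ne: "passing S j \<noteq> {}"
  have "Max (passing S j) \<in> passing S j" by (rule Max_in[OF finite_passing ne])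
  moreover have "best S j = outcome S (Max (passing S j))" using ne by (simp add: best_def)
  ultimately show ?thesis unfolding passing_def by blast
qed

lemma best_Suc:
  assumes "j < Q"
  shows "best S j = (if passing S (Suc j) = {} then outcome S (Suc j) else best S (Suc j))"
proof (cases "passing S (Suc j) = {}")
  case True
  then show ?thesis using passing_Suc[OF assms, of S] by (simp add: best_def outcome_def)
next
  case False
  have "Suc j \<le> Max (passing S (Suc j))"
    using Max_in[OF finite_passing False] by (auto simp: passing_def)
  then have "Max (insert (Suc j) (passing S (Suc j))) = Max (passing S (Suc j))"
    using False finite_passing by (subst Max_insert) (auto simp: max_def)
  then show ?thesis using passing_Suc[OF assms, of S] False by (simp add: best_def)
qed

lemma small_enc_exponent:
  assumes "l \<in> \<Gamma>" shows "small s (enc_exponent n (lead l)) 6"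
proof -
  have l: "l \<in> \<Lambda>" using assms \<Gamma> by auto
  have "small s (enc_exponent n (lead l)) (2 + 1 + 1 + 2)"
    unfolding enc_exponent_def enc_ints_def map_map
  proof (rule small_enc_list)
    fix v assume "v \<in> set (map (VInt \<circ> (\<lambda>i. int (Poly_Mapping.lookup (lead l) i))) [0..<n])"
    then obtain i where v: "v = VInt (int (Poly_Mapping.lookup (lead l) i))" by auto
    show "small s v 2" unfolding v
      by (rule small_mono[OF small_nat[OF below_le[OF below_d lookup_le[OF assms lead_props(3)[OF l]]]]]) simp
  qed (use below_n in simp)
  then show ?thesis by simp
qed

lemma small_coeff: assumes "l \<in> \<Gamma>" shows "small s (VInt (a l)) 3"
proof -
  have "\<bar>a l\<bar> \<le> (\<Sum>l\<in>\<Gamma>. \<bar>a l\<bar>)" by (rule member_le_sum[OF assms]) (use \<Gamma> in auto)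
  then have "\<bar>a l\<bar> \<le> 2 ^ s" using a_le by linarith
  from small_VInt_bound[OF this below_param[OF order_refl]] show ?thesis by (rule small_mono) simp
qed

text \<open>The bound is independent of the cost of the test: an outcome is 0 or consists of the
  leading exponent and the coefficient of some l in \<Gamma>. This is the uniform bound that the
  loop of \<open>FIND\<close> needs.\<close>

lemma small_outcome:
  assumes "S \<subseteq> \<Gamma>" "1 \<le> q" "q \<le> Q" shows "small s (outcome S q) 20"
proof (cases "test S q")
  case True
  have "picked S q \<in> \<Gamma>" using picked(1)[OF assms True] assms(1) by blast
  from small_mono[OF small_VPair[OF small_enc_exponent[OF this] small_coeff[OF this]], of 20] True
  show ?thesis by (simp add: outcome_def)
next
  case False
  then show ?thesis using small_mono[OF small_bit(1), of 20] by (simp add: outcome_def)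
qed

lemma small_best: assumes "S \<subseteq> \<Gamma>" shows "small s (best S j) 20"
proof (cases "passing S j = {}")
  case True
  then show ?thesis using small_mono[OF small_bit(1), of 20] by (simp add: best_def)
next
  case False
  from best_nonempty[OF this] small_outcome[OF assms] show ?thesis by force
qed

lemma computes_FIND:
  assumes "small s (VPair (enc_found ls) glob) c" and ls: "distinct ls" "set ls \<subseteq> \<Gamma>"
  shows "computes s \<O> FIND (VPair (enc_found ls) glob) (best (\<Gamma> - set ls) 0) (find_bound c)"
proof -
  let ?S = "\<Gamma> - set ls"
  have S: "?S \<subseteq> \<Gamma>" by blast
  have step: "computes s \<O> (Cond (ISPAIR (VAR 1)) (VAR 1) (Seq (Fork (ADD (VAR 0) (LIT 1)) (Fork (VAR 2) (DROP 3))) TESTP))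
      (VPair (VInt (int j)) (VPair (best ?S (Suc j)) (VPair (enc_found ls) glob))) (best ?S j)
      (10 ^ 6 * (c' + 1) + 2 * test_bound (1000 * (c' + 1)))"
    if j: "j < Q" and small: "small s (VPair (VInt (int j)) (VPair (best ?S (Suc j)) (VPair (enc_found ls) glob))) c'" for j c'
  proof (cases "passing ?S (Suc j) = {}")
    case True
    have b: "best ?S j = outcome ?S (Suc j)" "best ?S (Suc j) = VInt 0"
      using best_Suc[OF j, of ?S] True by (simp_all add: best_def)
    have args: "computes s \<O> (Fork (ADD (VAR 0) (LIT 1)) (Fork (VAR 2) (DROP 3)))
        (VPair (VInt (int j)) (VPair (VInt 0) (VPair (enc_found ls) glob)))
        (VPair (VInt (int (Suc j))) (VPair (enc_found ls) glob)) (1000 * (c' + 1))"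
      using small unfolding b
      by - (rule computes_mono, (rule computes_Fork computes_ADD1 computes_VAR computes_DROP | assumption | (simp; fail))+)
    have test: "computes s \<O> TESTP (VPair (VInt (int (Suc j))) (VPair (enc_found ls) glob))
      (outcome ?S (Suc j)) (test_bound (1000 * (c' + 1)))"
      by (rule computes_TESTP[OF computesD(2)[OF args] _ _ ls]) (use j in auto)
    show ?thesis using small unfolding b
      by - (rule computes_mono, rule computes_CondF, (rule computes_ISPAIR computes_VAR | assumption | (simp; fail))+,
        rule computes_Seq[OF args test], simp)
  next
    case False
    have b: "best ?S j = best ?S (Suc j)" using best_Suc[OF j, of ?S] False by simp
    obtain q where q: "Suc j < q" "q \<le> Q" "test ?S q" "best ?S (Suc j) = outcome ?S q"
      using best_nonempty[OF False] by blast
    have o: "best ?S (Suc j) = VPair (enc_exponent n (lead (picked ?S q))) (VInt (a (picked ?S q)))"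
      using q by (simp add: outcome_def)
    show ?thesis using small unfolding b o
      by - (rule computes_mono, rule computes_CondT, (rule computes_ISPAIR computes_VAR | assumption | (simp; fail))+)
  qed
  show ?thesis
    unfolding FIND_def
    apply (rule computes_mono)
    apply (rule computes_ITER[where N = Q and acc = "best ?S"])
          apply (rule computes_VAR, simp add: glob_eq, rule assms(1))
         apply (rule refl)
        apply (rule below_Q)
       apply (unfold best_Q)
       apply (rule computes_LIT[OF assms(1) refl])
      apply (rule small_best[OF S])
     apply (erule step, erule small_mono[of _ _ _ "100 * (c + 1)"], simp)
    apply (rule refl)
    apply (simp add: find_bound_def)
    done
qed

text \<open>If terms are left, some q passes; and a passing q always yields one of them. So
  \<open>VInt 0\<close> reliably signals that nothing remains.\<close>

lemma best_cases:
  assumes "S \<subseteq> \<Gamma>"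
  shows "if S = {} then best S 0 = VInt 0
    else \<exists>l\<in>S. best S 0 = VPair (enc_exponent n (lead l)) (VInt (a l))"
proof (cases "passing S 0 = {}")
  case True
  then have "S = {}" using test_complete[OF assms] by (force simp: passing_def)
  then show ?thesis using True by (simp add: best_def)
next
  case False
  from best_nonempty[OF this] obtain q where q: "1 \<le> q" "q \<le> Q" "test S q" "best S 0 = outcome S q"
    by (metis One_nat_def Suc_leI)
  with picked(1)[OF assms q(1-3)] show ?thesis by (auto simp: outcome_def)
qed

section \<open>The rounds of peeling\<close>

definition next_term :: "data set \<Rightarrow> data" where
  "next_term S = (SOME l. l \<in> S \<and> best S 0 = VPair (enc_exponent n (lead l)) (VInt (a l)))"

lemma next_term:
  assumes "S \<subseteq> \<Gamma>" "S \<noteq> {}"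
  shows "next_term S \<in> S" "best S 0 = VPair (enc_exponent n (lead (next_term S))) (VInt (a (next_term S)))"
proof -
  have "\<exists>l. l \<in> S \<and> best S 0 = VPair (enc_exponent n (lead l)) (VInt (a l))"
    using best_cases[OF assms(1)] assms(2) by auto
  from someI_ex[OF this] show "next_term S \<in> S"
    "best S 0 = VPair (enc_exponent n (lead (next_term S))) (VInt (a (next_term S)))"
    unfolding next_term_def by blast+
qed

primrec terms :: "nat \<Rightarrow> data list" where
  "terms 0 = []"
| "terms (Suc i) = (if \<Gamma> - set (terms i) = {} then terms i else next_term (\<Gamma> - set (terms i)) # terms i)"

lemma terms: "distinct (terms i)" "set (terms i) \<subseteq> \<Gamma>" "length (terms i) \<le> i"
  "length (terms i) = i \<or> set (terms i) = \<Gamma>"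
proof -
  have "distinct (terms i) \<and> set (terms i) \<subseteq> \<Gamma> \<and> length (terms i) \<le> i \<and>
    (length (terms i) = i \<or> set (terms i) = \<Gamma>)"
  proof (induction i)
    case (Suc i)
    show ?case
    proof (cases "\<Gamma> - set (terms i) = {}")
      case True
      then show ?thesis using Suc by auto
    next
      case False
      then have "next_term (\<Gamma> - set (terms i)) \<in> \<Gamma> - set (terms i)" by (intro next_term(1)) auto
      with Suc False show ?thesis by auto
    qed
  qed simp
  then show "distinct (terms i)" "set (terms i) \<subseteq> \<Gamma>" "length (terms i) \<le> i"
    "length (terms i) = i \<or> set (terms i) = \<Gamma>" by auto
qed

text \<open>After m rounds either \<Gamma> is exhausted or m distinct elements of it have been
  found, and \<Gamma> has at most m.\<close>

lemma set_terms: "set (terms m) = \<Gamma>"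
proof (cases "set (terms m) = \<Gamma>")
  case False
  then have "card (set (terms m)) = m" using terms[of m] by (simp add: distinct_card)
  then show ?thesis using card_seteq[OF \<Gamma>(2) terms(2)[of m]] \<Gamma>(3) by simp
qed

lemma small_found:
  assumes "\<And>l. l \<in> set ls \<Longrightarrow> l \<in> \<Gamma>" "\<And>l. l \<in> set ls \<Longrightarrow> small s l e" "length ls \<le> m"
  shows "small s (enc_found ls) (e + 9)"
proof -
  have "small s (enc_found ls) ((e + 3 + 2) + 1 + 1 + 2)"
    unfolding enc_found_def
  proof (rule small_enc_list)
    show "small s v (e + 3 + 2)" if "v \<in> set (map (\<lambda>l. VPair l (VInt (a l))) ls)" for v
    proof -
      from that obtain l where l: "l \<in> set ls" "v = VPair l (VInt (a l))" by auto
      show ?thesis unfolding l(2) by (rule small_VPair[OF assms(2)[OF l(1)] small_coeff[OF assms(1)[OF l(1)]]])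
    qed
    show "below s (length (map (\<lambda>l. VPair l (VInt (a l))) ls)) 1"
      using below_le[OF below_m assms(3)] by simp
  qed
  then show ?thesis by (rule small_mono) simp
qed

text \<open>Also bounds the size of the index l. The input has exponent 10 = 1 + 1 + 6 + 2, for n,
  the leading exponent and the pair; 13 is 10 plus 1 for n plus 2 for two additions in the time
  bound.\<close>

lemma computes_to_idx:
  assumes "computes_in_poly_time to_idx C k n \<Lambda> (\<lambda>l. enc_exponent n (lead l)) (\<lambda>l. l)" "l \<in> \<Gamma>"
  shows "computes s \<O>' to_idx (VPair (VInt (int n)) (enc_exponent n (lead l))) l (10 + C + 13 * k)"
proof (rule computes_mono[OF computes_poly_time[OF assms(1) _ _ below_n]])
  show "l \<in> \<Lambda>" using assms(2) \<Gamma> by auto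
  show "small s (VPair (VInt (int n)) (enc_exponent n (lead l))) (1 + 1 + 6 + 2)"
    by (rule small_VPair[OF small_nat[OF below_n] small_enc_exponent[OF assms(2)]])
qed simp

context
  fixes to_idx :: prog and C k :: nat
  assumes to_idx: "computes_in_poly_time to_idx C k n \<Lambda> (\<lambda>l. enc_exponent n (lead l)) (\<lambda>l. l)"
begin

lemma computes_STEP:
  assumes small: "small s (VPair (VInt (int j)) (VPair (enc_found (terms i)) glob)) c"
  shows "computes s \<O> (STEP to_idx) (VPair (VInt (int j)) (VPair (enc_found (terms i)) glob))
    (enc_found (terms (Suc i))) (step_bound C k c)"
proof -
  let ?S = "\<Gamma> - set (terms i)"
  define F where "F = find_bound (100 * (c + 1))"
  have args: "computes s \<O> (Fork (VAR 1) (DROP 2)) (VPair (VInt (int j)) (VPair (enc_found (terms i)) glob))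
      (VPair (enc_found (terms i)) glob) (100 * (c + 1))"
    using small by - (rule computes_mono, (rule computes_Fork computes_VAR computes_DROP | assumption | (simp; fail))+)
  note find = computes_Seq[OF args computes_FIND[OF computesD(2)[OF args] terms(1,2)], folded F_def]
  show ?thesis
  proof (cases "?S = {}")
    case True
    have b: "best ?S 0 = VInt 0" by (rule best_cases[of ?S, OF Diff_subset, unfolded if_P[OF True]])
    have t: "terms (Suc i) = terms i" using True by simp
    show ?thesis unfolding STEP_def t step_bound_def F_def[symmetric]
      apply (rule computes_mono)
       apply (rule computes_LET[OF find[unfolded b]])
       apply (rule computes_CondF, (rule computes_ISPAIR computes_VAR | assumption | (simp; fail))+)
      done
  next
    case False
    let ?l = "next_term ?S"
    have l: "?l \<in> \<Gamma>" using next_term(1)[OF _ False] by blast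
    have b: "best ?S 0 = VPair (enc_exponent n (lead ?l)) (VInt (a ?l))"
      by (rule next_term(2)[OF _ False]) blast
    have t: "enc_found (terms (Suc i)) = VPair (VPair ?l (VInt (a ?l))) (enc_found (terms i))"
      using False by (simp add: enc_found_def)
    show ?thesis unfolding STEP_def t step_bound_def F_def[symmetric]
      apply (rule computes_mono)
       apply (rule computes_LET[OF find[unfolded b]])
       apply (rule computes_CondT, (rule computes_ISPAIR computes_VAR | assumption | (simp; fail))+)
       apply (rule computes_Fork)
        apply (rule computes_Fork)
         apply (rule computes_Seq)
          apply (rule computes_Fork)
           apply (rule computes_VAR, simp add: glob_eq, assumption)
          apply (rule computes_FST)
          apply (rule computes_VAR, simp, assumption)
         apply (rule computes_to_idx[OF to_idx l])
        apply (rule computes_SND)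
        apply (rule computes_VAR, simp, assumption)
       apply (rule computes_VAR, simp, assumption)
      apply simp
      done
  qed
qed

lemma computes_rounds:
  assumes small: "small s glob c" "c \<le> 10 ^ 38"
  shows "computes s \<O> (ITER (VAR 6) (LIT 0) (STEP to_idx)) glob (enc_found (terms m))
    (10 ^ 4 * (step_bound C k (10 ^ 40 + C + 13 * k) + 10 ^ 45 + C + 13 * k))"
proof -
  define F where "F = step_bound C k (10 ^ 40 + C + 13 * k)"
  have t0: "enc_found (terms (m - m)) = VInt 0" by (simp add: enc_found_def)
  have szt: "small s (enc_found (terms (m - j))) ((10 + C + 13 * k) + 9)" for j
  proof (rule small_found)
    show "l \<in> \<Gamma>" if "l \<in> set (terms (m - j))" for l using terms(2) that by blast
    show "small s l (10 + C + 13 * k)" if "l \<in> set (terms (m - j))" for l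
      by (rule computesD(2)[OF computes_to_idx[OF to_idx]]) (use terms(2) that in blast)
    show "length (terms (m - j)) \<le> m" using terms(3)[of "m - j"] by simp
  qed
  have step: "computes s \<O> (STEP to_idx) (VPair (VInt (int j)) (VPair (enc_found (terms (m - Suc j))) glob))
      (enc_found (terms (m - j))) F"
    if "j < m" "small s (VPair (VInt (int j)) (VPair (enc_found (terms (m - Suc j))) glob)) c'"
      "c' \<le> 10 ^ 40 + C + 13 * k" for j c'
  proof -
    have "Suc (m - Suc j) = m - j" using that(1) by simp
    with computes_STEP[OF small_mono[OF that(2,3)]] show ?thesis unfolding F_def by (simp only:)
  qed
  show ?thesis unfolding F_def[symmetric]
    apply (rule computes_mono)
     apply (rule computes_ITER[where N = m and acc = "\<lambda>j. enc_found (terms (m - j))"])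
           apply (rule computes_VAR, simp add: glob_eq, rule small(1))
          apply (rule refl)
         apply (rule below_m)
        apply (unfold t0)
        apply (rule computes_LIT[OF small(1) refl])
       apply (rule szt)
      apply (erule step, assumption, use small(2) in simp)
     apply simp
    using small(2) apply simp
    done
qed

section \<open>The input and the complete program\<close>

lemma small_input: "small s (enc_input n A d m) 24"
proof -
  have row: "small s (enc_ints r) 5" if r: "r \<in> set (mat_to_list A)" for r
  proof -
    from r obtain i where i: "i < n" "r = map (\<lambda>j. A $$ (i, j)) [0..<n]"
      using A_carrier by (auto simp: mat_to_list_def)
    have "small s (enc_ints r) (1 + 1 + 1 + 2)"
      unfolding enc_ints_def
    proof (rule small_enc_list)
      fix v assume "v \<in> set (map VInt r)"
      then obtain j where j: "j < n" "v = VInt (int (Anat i j))" using i A_01(1) by auto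
      show "small s v 1" unfolding j(2)
        using small_nat[OF below_le[OF below_1(1) A_01(2)[OF i(1) j(1)]]] by simp
    qed (use below_n in \<open>simp add: i(2)\<close>)
    then show ?thesis by (rule small_mono) simp
  qed
  have A: "small s (enc_mat A) (5 + 1 + 1 + 2)"
    unfolding enc_mat_def
    by (rule small_enc_list) (use row A_carrier below_n in \<open>auto simp: mat_to_list_def\<close>)
  show ?thesis unfolding enc_input_def enc_list.simps
    by (rule small_mono[OF small_VPair[OF small_nat[OF below_n] small_VPair[OF A small_VPair[OF small_nat[OF below_d]
      small_VPair[OF small_nat[OF below_m] small_bit(1)]]]]]) simp
qed

lemma computes_INTERPOLATE:
  "computes s \<O> (INTERPOLATE to_idx) (enc_input n A d m) (enc_found (terms m)) (main_bound C k)"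
proof -
  define F where "F = step_bound C k (10 ^ 40 + C + 13 * k)"
  have e: "enc_input n A d m = VPair (VInt (int n)) (VPair (enc_mat A) (VPair (VInt (int d)) (VPair (VInt (int m)) (VInt 0))))"
    by (simp add: enc_input_def)
  have Q: "int Q = 2 * (int m * int m * int n * int d + 1)" by (simp add: Q_def)
  have D: "int D = 2 * int Q * int n * int d" by (simp add: D_def)
  have 1: "computes s \<O> (FACT (VAR 0)) (enc_input n A d m) (VInt (fact n)) (10 ^ 15)"
    by (rule computes_mono[OF computes_FACT[OF computes_VAR[OF _ small_input] refl below_n refl]]) (simp_all add: e)
  let ?e1 = "VPair (VInt (fact n)) (enc_input n A d m)"
  have 2: "computes s \<O> (MUL (LIT 2) (ADD (MUL (MUL (MUL (VAR 4) (VAR 4)) (VAR 1)) (VAR 3)) (LIT 1))) ?e1 (VInt (int Q)) (10 ^ 25)"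
    if "small s ?e1 (4 * 10 ^ 15 + 10)"
    using that unfolding e Q
    by - (rule computes_mono, (rule computes_rules refl | assumption | (simp; fail))+)
  let ?e2 = "VPair (VInt (int Q)) ?e1"
  have 3: "computes s \<O> (MUL (MUL (MUL (LIT 2) (VAR 0)) (VAR 2)) (VAR 4)) ?e2 (VInt (int D)) (10 ^ 35)"
    if "small s ?e2 (4 * 10 ^ 25 + 10)"
    using that unfolding e D
    by - (rule computes_mono, (rule computes_rules refl | assumption | (simp; fail))+)
  \<comment> \<open>Pushing n!, Q and D onto the input produces the list of global values in the
    order that all procedures expect.\<close>
  have g: "VPair (VInt (int D)) ?e2 = glob" by (simp add: e glob_eq)
  show ?thesis unfolding INTERPOLATE_def main_bound_def F_def[symmetric]
    apply (rule computes_mono)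
     apply (rule computes_LET[OF 1])
     apply (rule computes_LET[OF 2], assumption)
     apply (rule computes_LET[OF 3], assumption)
     apply (unfold g)
     apply (erule computes_rounds[folded F_def])
     apply simp
    apply simp
    done
qed

end

end

section \<open>From the size parameter to the stated time bound\<close>

lemma real_log_ceiling:
  assumes "1 \<le> x" shows "x \<le> 2 ^ nat \<lceil>log 2 x\<rceil>" "real (nat \<lceil>log 2 x\<rceil>) \<le> log 2 x + 1" "0 \<le> log 2 x"
proof -
  show 0: "0 \<le> log 2 x" using assms by simp
  have "x = 2 powr log 2 x" using assms by simp
  also have "\<dots> \<le> 2 powr real (nat \<lceil>log 2 x\<rceil>)" by (intro powr_mono) linarith+
  also have "\<dots> = 2 ^ nat \<lceil>log 2 x\<rceil>" by (simp add: powr_realpow)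
  finally show "x \<le> 2 ^ nat \<lceil>log 2 x\<rceil>" .
  show "real (nat \<lceil>log 2 x\<rceil>) \<le> log 2 x + 1" using 0 by linarith
qed

theorem theorem4p1:
  fixes to_exp to_idx :: prog and C k :: nat
  shows "\<exists>alg :: prog. \<exists>C' k' :: nat.
    \<forall>(n :: nat) (R :: int_mpoly set) (\<Lambda> :: data set) (t :: data \<Rightarrow> int_mpoly)
      (K :: data \<Rightarrow> nat \<Rightarrow> real) (A :: int mat) (lead :: data \<Rightarrow> exponent).
      subring_of_polys n R \<and> int_basis R \<Lambda> t \<and>
      invertible_01_mat n A \<and> friendly_family K n A \<Lambda> t lead \<and>
      lead_efficient to_exp to_idx C k n \<Lambda> lead \<longrightarrow>
      (\<forall>(f :: int_mpoly) (\<Gamma> :: data set) (a :: data \<Rightarrow> int) (d :: nat) (m :: nat).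
        \<Gamma> \<subseteq> \<Lambda> \<and> finite \<Gamma> \<and> (\<forall>l\<in>\<Gamma>. a l \<noteq> 0) \<and> f = (\<Sum>l\<in>\<Gamma>. int_scale (a l) (t l)) \<and>
        total_degree f \<le> d \<and> card \<Gamma> \<le> m \<longrightarrow>
        (\<exists>ls T. distinct ls \<and> set ls = \<Gamma> \<and>
          exec (interpolation_oracle n f \<Lambda> t) alg (enc_input n A d m) (enc_expansion a ls) T \<and>
          real T \<le> real C' * (1 + real n + real d + real m
             + log 2 (real_of_int (\<Sum>l\<in>\<Gamma>. \<bar>a l\<bar>))
             + log 2 (Max (insert 1 ((\<lambda>l. K l n) ` \<Gamma>)))) ^ k'))"
proof (rule exI[of _ "INTERPOLATE to_idx"], rule exI[of _ "4 ^ main_bound C k"], rule exI[of _ "main_bound C k"],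
    intro allI impI, elim conjE)
  define E where "E = main_bound C k"
  fix n R \<Lambda> and t :: "data \<Rightarrow> int_mpoly" and K A lead f \<Gamma> and a :: "data \<Rightarrow> int" and d m
  assume R: "subring_of_polys n R" "int_basis R \<Lambda> t"
    and inv: "invertible_01_mat n A" and friendly: "friendly_family K n A \<Lambda> t lead"
    and eff: "lead_efficient to_exp to_idx C k n \<Lambda> lead"
    and \<Gamma>: "\<Gamma> \<subseteq> \<Lambda>" "finite \<Gamma>" and a: "\<forall>l\<in>\<Gamma>. a l \<noteq> 0" and f: "f = (\<Sum>l\<in>\<Gamma>. int_scale (a l) (t l))"
    and deg: "total_degree f \<le> d" and card: "card \<Gamma> \<le> m"
  define \<sigma> where "\<sigma> = real_of_int (\<Sum>l\<in>\<Gamma>. \<bar>a l\<bar>)"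
  define \<kappa> where "\<kappa> = Max (insert 1 ((\<lambda>l. K l n) ` \<Gamma>))"
  define s where "s = n + d + m + nat \<lceil>log 2 \<sigma>\<rceil> + nat \<lceil>log 2 \<kappa>\<rceil>"
  have "1 \<le> \<kappa>" unfolding \<kappa>_def using \<Gamma>(2) by simp
  note \<kappa> = real_log_ceiling[OF this]
  have "(\<Sum>l\<in>\<Gamma>. \<bar>a l\<bar>) \<ge> 0" by (intro sum_nonneg) simp
  then have "(\<Sum>l\<in>\<Gamma>. \<bar>a l\<bar>) = 0 \<or> 1 \<le> (\<Sum>l\<in>\<Gamma>. \<bar>a l\<bar>)" by linarith
  \<comment> \<open>The value 0 occurs when \<Gamma> is empty; its logarithm is 0 by convention, so
    the bound by a power of 2 holds there too.\<close>
  then have \<sigma>_cases: "\<sigma> = 0 \<or> 1 \<le> \<sigma>" unfolding \<sigma>_def by (metis of_int_0 of_int_1 of_int_le_iff)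
  have log0: "log 2 (0 :: real) = 0" by (simp add: log_def)
  have \<sigma>: "\<sigma> \<le> 2 ^ nat \<lceil>log 2 \<sigma>\<rceil>" "real (nat \<lceil>log 2 \<sigma>\<rceil>) \<le> log 2 \<sigma> + 1" "0 \<le> log 2 \<sigma>"
    using \<sigma>_cases real_log_ceiling[of \<sigma>] log0 by auto
  interpret interpolation_run n \<Lambda> t K A lead \<Gamma> a d m s
  proof unfold_locales
    show "t l \<in> polys n" if "l \<in> \<Lambda>" for l
      using R that int_module.span_base[of "t l" "t ` \<Lambda>"]
      unfolding int_basis_def subring_of_polys_def by blast
    show "K l n \<le> 2 ^ s" if "l \<in> \<Gamma>" for l
    proof -
      have "K l n \<le> \<kappa>" unfolding \<kappa>_def using \<Gamma>(2) that by (intro Max_ge) auto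
      also have "\<dots> \<le> 2 ^ nat \<lceil>log 2 \<kappa>\<rceil>" by (rule \<kappa>(1))
      also have "\<dots> \<le> 2 ^ s" unfolding s_def by (intro power_increasing) linarith+
      finally show ?thesis .
    qed
    have "\<sigma> \<le> 2 ^ nat \<lceil>log 2 \<sigma>\<rceil>" by (rule \<sigma>(1))
    also have "\<dots> \<le> 2 ^ s" unfolding s_def by (intro power_increasing) linarith+
    finally have "real_of_int (\<Sum>l\<in>\<Gamma>. \<bar>a l\<bar>) \<le> real_of_int (2 ^ s)" by (simp add: \<sigma>_def)
    then show "(\<Sum>l\<in>\<Gamma>. \<bar>a l\<bar>) \<le> 2 ^ s" by (simp only: of_int_le_iff)
  qed (use inv friendly \<Gamma> a card deg f in \<open>auto simp: s_def\<close>)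
  have idx: "computes_in_poly_time to_idx C k n \<Lambda> (\<lambda>l. enc_exponent n (lead l)) (\<lambda>l. l)"
    using eff by (simp add: lead_efficient_def)
  from computes_INTERPOLATE[OF idx] obtain T where T: "exec (interpolation_oracle n f \<Lambda> t) (INTERPOLATE to_idx)
      (enc_input n A d m) (enc_expansion a (terms m)) T" "T \<le> (s + 2) ^ E"
    unfolding computes_def below_def E_def f enc_found_def enc_expansion_def by blast
  define X where "X = 1 + real n + real d + real m + log 2 \<sigma> + log 2 \<kappa>"
  \<comment> \<open>Two ceilings cost 1 each and the base is s + 2, so s + 2 exceeds the stated sum
    by at most 3; that sum is at least 1, whence the factor 4.\<close>
  have arith: "n' + d' + m' + p + q + 2 \<le> 4 * (1 + n' + d' + m' + u + v)"
    if "p \<le> u + 1" "0 \<le> u" "q \<le> v + 1" "0 \<le> v" "0 \<le> n'" "0 \<le> d'" "0 \<le> m'" for n' d' m' p q u v :: real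
    using that by (simp add: distrib_left)
  have "real (s + 2) \<le> 4 * X"
    unfolding s_def X_def of_nat_add of_nat_numeral by (intro arith \<sigma>(2,3) \<kappa>(2,3) of_nat_0_le_iff)
  then have "real (s + 2) ^ E \<le> (4 * X) ^ E" by (intro power_mono) auto
  moreover have "real T \<le> real (s + 2) ^ E" using T(2) by (metis of_nat_le_iff of_nat_power)
  ultimately have "real T \<le> real (4 ^ E) * X ^ E" by (simp add: power_mult_distrib)
  then show "\<exists>ls T. distinct ls \<and> set ls = \<Gamma> \<and>
      exec (interpolation_oracle n f \<Lambda> t) (INTERPOLATE to_idx) (enc_input n A d m) (enc_expansion a ls) T \<and>
      real T \<le> real (4 ^ main_bound C k) * (1 + real n + real d + real m
         + log 2 (real_of_int (\<Sum>l\<in>\<Gamma>. \<bar>a l\<bar>))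
         + log 2 (Max (insert 1 ((\<lambda>l. K l n) ` \<Gamma>)))) ^ main_bound C k"
    using T(1) terms(1) set_terms unfolding X_def \<sigma>_def \<kappa>_def E_def by blast
qed

end
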